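(* Let $1<p<\infty$, let $(a,b)\in L^\infty\times L^\infty$ be a matching pair with the subordinated pair $(c,d)$, and let $T(c):H^p\to H^p$ be a Fredholm operator. Then, for operators acting on $H^p$: (i) If $\operatorname{ind}T(c)=1$ and $\boldsymbol\sigma(c)=1$, then $\ker(T(a)+H(b))=\{0\}$ or $\operatorname{coker}(T(a)+H(b))=\{0\}$. (ii) If $\operatorname{ind}T(c)=-1$ and $\boldsymbol\sigma(c)=1$, then $\ker(T(a)-H(b))=\{0\}$ or $\operatorname{coker}(T(a)-H(b))=\{0\}$. (iii) If $\operatorname{ind}T(c)=0$, then, for each choice of sign, $\ker(T(a)\pm H(b))=\{0\}$ or $\operatorname{coker}(T(a)\pm H(b))=\{0\}$.
   Context: $\mathbb{T}$ is the unit circle, $L^p=L^p(\mathbb{T})$, $1/p+1/q=1$, $H^p=\{f\in L^p:\widehat f_n=0\text{ for }n<0\}$, $\overline{H^p}=\{f\in L^p:\widehat f_n=0\text{ for }n>0\}$; $f(0)=\widehat f_0$ for $f\in H^p$, $f(\infty)=\widehat f_0$ for $f\in\overline{H^p}$. $P$ is the Riesz projection of $L^p$ onto $H^p$, $Q=I-P$, $(Jf)(t)=\overline tf(\overline t)$, $\widetilde a(t)=a(1/t)$; $T(a)f=P(af)$, $H(a)f=PaQJf$ on $H^p$ for $a\in L^\infty$. $\operatorname{coker}A:=\ker A^*$; the index is $\dim\ker-\dim\operatorname{coker}$. A matching pair $(a,b)$ consists of $a\in L^\infty$ invertible in $L^\infty$ and $b\in L^\infty$ with $a\widetilde a=b\widetilde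 b$ (then $b$ is invertible too). Its subordinated pair is $(c,d)$ with $c=ab^{-1}=\widetilde b\widetilde a^{-1}$, $d=b\widetilde a^{-1}=a\widetilde b^{-1}$; then $c\widetilde c=d\widetilde d=1$. Wiener--Hopf factorization of $g\in L^\infty$ in $H^p$: $g=g_-t^{\nu}g_+$ with $\nu\in\mathbb{Z}$, $g_+\in H^q$, $g_+^{-1}\in H^p$, $g_-\in\overline{H^p}$, $g_-^{-1}\in\overline{H^q}$, $g_-(\infty)=1$, such that $g_+^{-1}Pg_-^{-1}I$, defined on $\operatorname{span}\{t^k:k\ge0\}$, extends boundedly to $H^p$. It is unique and exists iff $T(g)$ is Fredholm on $H^p$; then $\nu=-\operatorname{ind}T(g)$. If $g\widetilde g=1$ and $T(g)$ is Fredholm, then $\boldsymbol\sigma(g):=g_+(0)\in\{1,-1\}$ is the factorization signature. *)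

theory Defs
  imports "HOL-Probability.Probability" "HOL-Library.Function_Algebras"
begin

section \<open>Measurable functions on the unit circle modulo null sets\<close>

text \<open>Normalised arc length on the unit circle, as a measure on the Borel sets of the plane.\<close>

definition circ_measure :: "complex measure" where
  "circ_measure = distr (uniform_measure lborel {-pi..pi}) borel cis"

lemma sets_circ_measure [simp, measurable_cong]: "sets circ_measure = sets borel"
  and space_circ_measure [simp]: "space circ_measure = UNIV"
  by (simp_all add: circ_measure_def)

lemma cis_borel [measurable]: "cis \<in> borel_measurable borel"
  by (intro borel_measurable_continuous_onI continuous_intros)

lemma prob_space_circ_measure: "prob_space circ_measure"
  unfolding circ_measure_def
  by (intro prob_space.prob_space_distr prob_space_uniform_measure) auto

lemma AE_circ_measure_iff:
  assumes [measurable]: "Measurable.pred borel P"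
  shows "(AE t in circ_measure. P t) \<longleftrightarrow> (AE x in lborel. x \<in> {-pi..pi} \<longrightarrow> P (cis x))"
  unfolding circ_measure_def by (subst AE_distr_iff) (auto simp: AE_uniform_measure)

lemma AE_circ_measure_reflect:
  assumes h [measurable]: "h \<in> borel_measurable borel" and h': "\<And>x. h (cis x) = cis (- x)"
    and P [measurable]: "Measurable.pred borel P"
    and AE: "AE t in circ_measure. P t"
  shows "AE t in circ_measure. P (h t)"
proof -
  have "AE x in distr lborel borel uminus. x \<in> {-pi..pi} \<longrightarrow> P (cis x)"
    using AE unfolding lborel_distr_uminus by (simp add: AE_circ_measure_iff)
  hence "AE x in lborel. x \<in> {-pi..pi} \<longrightarrow> P (cis (- x))"
    by (subst (asm) AE_distr_iff) auto
  thus ?thesis by (simp add: AE_circ_measure_iff h')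
qed

definition circ_eq :: "(complex \<Rightarrow> complex) \<Rightarrow> (complex \<Rightarrow> complex) \<Rightarrow> bool" where
  "circ_eq f g \<longleftrightarrow> f \<in> borel_measurable borel \<and> g \<in> borel_measurable borel \<and>
     (AE t in circ_measure. f t = g t)"

quotient_type circ_fun = "complex \<Rightarrow> complex" / partial: circ_eq
proof (rule part_equivpI)
  show "\<exists>f. circ_eq f f" by (rule exI[of _ "\<lambda>_. 0"]) (simp add: circ_eq_def)
  show "symp circ_eq" by (rule sympI) (auto simp: circ_eq_def eq_commute)
  show "transp circ_eq" by (rule transpI) (auto simp: circ_eq_def)
qed

instantiation circ_fun :: "{comm_ring_1, inverse}"
begin

lift_definition zero_circ_fun :: circ_fun is "\<lambda>_. 0" by (simp add: circ_eq_def)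
lift_definition one_circ_fun :: circ_fun is "\<lambda>_. 1" by (simp add: circ_eq_def)
lift_definition plus_circ_fun :: "circ_fun \<Rightarrow> circ_fun \<Rightarrow> circ_fun" is "\<lambda>f g t. f t + g t"
  by (auto simp: circ_eq_def)
lift_definition minus_circ_fun :: "circ_fun \<Rightarrow> circ_fun \<Rightarrow> circ_fun" is "\<lambda>f g t. f t - g t"
  by (auto simp: circ_eq_def)
lift_definition uminus_circ_fun :: "circ_fun \<Rightarrow> circ_fun" is "\<lambda>f t. - f t"
  by (auto simp: circ_eq_def)
lift_definition times_circ_fun :: "circ_fun \<Rightarrow> circ_fun \<Rightarrow> circ_fun" is "\<lambda>f g t. f t * g t"
  by (auto simp: circ_eq_def)

text \<open>The pointwise inverse is totalised by \<open>inverse 0 = 0\<close>; thus \<open>f * inverse f = 1\<close> holds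
  exactly if \<open>f\<close> is nonzero almost everywhere.\<close>

lift_definition inverse_circ_fun :: "circ_fun \<Rightarrow> circ_fun" is "\<lambda>f t. inverse (f t)"
  by (auto simp: circ_eq_def)
lift_definition divide_circ_fun :: "circ_fun \<Rightarrow> circ_fun \<Rightarrow> circ_fun" is "\<lambda>f g t. f t / g t"
  by (auto simp: circ_eq_def)

instance
proof
  show "(0::circ_fun) \<noteq> 1"
  proof (transfer, clarsimp simp: circ_eq_def)
    interpret prob_space circ_measure by (rule prob_space_circ_measure)
    assume "AE t in circ_measure. False"
    thus False by simp
  qed
qed (transfer, auto simp: circ_eq_def algebra_simps)+

end

lift_definition cscale :: "complex \<Rightarrow> circ_fun \<Rightarrow> circ_fun" is "\<lambda>z f t. z * f t"
  by (auto simp: circ_eq_def)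

lemma vector_space_cscale: "vector_space cscale"
  by unfold_locales (transfer, auto simp: circ_eq_def algebra_simps)+

lift_definition tpow :: "int \<Rightarrow> circ_fun" is "\<lambda>n t. t powi n"
proof -
  fix n :: int
  have "(\<lambda>t::complex. t powi n) \<in> borel_measurable borel"
    by (cases "n \<ge> 0") (simp_all add: power_int_def)
  thus "circ_eq (\<lambda>t. t powi n) (\<lambda>t. t powi n)" by (simp add: circ_eq_def)
qed

lift_definition reflect :: "circ_fun \<Rightarrow> circ_fun" is "\<lambda>f t. f (1 / t)"
proof -
  fix f g :: "complex \<Rightarrow> complex"
  assume fg: "circ_eq f g"
  hence [measurable]: "f \<in> borel_measurable borel" "g \<in> borel_measurable borel"
    by (simp_all add: circ_eq_def)
  have "AE t in circ_measure. f (1 / t) = g (1 / t)"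
    by (rule AE_circ_measure_reflect[where P = "\<lambda>t. f t = g t"])
      (use fg in \<open>auto simp: circ_eq_def cis_inverse divide_inverse\<close>)
  thus "circ_eq (\<lambda>t. f (1 / t)) (\<lambda>t. g (1 / t))" by (simp add: circ_eq_def)
qed

lift_definition flip :: "circ_fun \<Rightarrow> circ_fun" is "\<lambda>f t. cnj t * f (cnj t)"
proof -
  fix f g :: "complex \<Rightarrow> complex"
  assume fg: "circ_eq f g"
  hence [measurable]: "f \<in> borel_measurable borel" "g \<in> borel_measurable borel"
    by (simp_all add: circ_eq_def)
  have [measurable]: "cnj \<in> borel_measurable borel"
    by (intro borel_measurable_continuous_onI continuous_intros)
  have "AE t in circ_measure. f (cnj t) = g (cnj t)"
    by (rule AE_circ_measure_reflect[where P = "\<lambda>t. f t = g t"])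
      (use fg in \<open>auto simp: circ_eq_def cis_cnj\<close>)
  hence "AE t in circ_measure. cnj t * f (cnj t) = cnj t * g (cnj t)" by auto
  thus "circ_eq (\<lambda>t. cnj t * f (cnj t)) (\<lambda>t. cnj t * g (cnj t))" by (simp add: circ_eq_def)
qed


section \<open>Lebesgue and Hardy spaces\<close>

lift_definition in_Lp :: "real \<Rightarrow> circ_fun \<Rightarrow> bool" is
  "\<lambda>p f. integrable circ_measure (\<lambda>t. norm (f t) powr p)"
  by (intro integrable_cong_AE) (auto simp: circ_eq_def)

lift_definition in_Linf :: "circ_fun \<Rightarrow> bool" is
  "\<lambda>f. \<exists>C. AE t in circ_measure. norm (f t) \<le> C"
proof -
  fix f g :: "complex \<Rightarrow> complex"
  assume "circ_eq f g"
  hence *: "AE t in circ_measure. f t = g t" by (simp add: circ_eq_def)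
  have "(AE t in circ_measure. norm (f t) \<le> C) \<longleftrightarrow> (AE t in circ_measure. norm (g t) \<le> C)" for C
    by (rule eventually_subst) (use * in eventually_elim, simp)
  thus "(\<exists>C. AE t in circ_measure. norm (f t) \<le> C) \<longleftrightarrow>
        (\<exists>C. AE t in circ_measure. norm (g t) \<le> C)" by simp
qed

lift_definition Lp_norm :: "real \<Rightarrow> circ_fun \<Rightarrow> real" is
  "\<lambda>p f. (LINT t|circ_measure. norm (f t) powr p) powr (1 / p)"
proof -
  fix p :: real and f g :: "complex \<Rightarrow> complex"
  assume "circ_eq f g"
  hence "(LINT t|circ_measure. norm (f t) powr p) = (LINT t|circ_measure. norm (g t) powr p)"
    by (intro integral_cong_AE) (auto simp: circ_eq_def)
  thus "(LINT t|circ_measure. norm (f t) powr p) powr (1 / p) =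
        (LINT t|circ_measure. norm (g t) powr p) powr (1 / p)" by simp
qed

lift_definition fourier :: "circ_fun \<Rightarrow> int \<Rightarrow> complex" is
  "\<lambda>f n. LINT t|circ_measure. f t * t powi (- n)"
proof -
  fix f g :: "complex \<Rightarrow> complex"
  have [measurable]: "(\<lambda>t::complex. t powi m) \<in> borel_measurable borel" for m :: int
    by (cases "m \<ge> 0") (simp_all add: power_int_def)
  assume "circ_eq f g"
  thus "(\<lambda>n. LINT t|circ_measure. f t * t powi (- n)) =
        (\<lambda>n. LINT t|circ_measure. g t * t powi (- n))"
    by (intro ext integral_cong_AE) (auto simp: circ_eq_def)
qed

definition Lp :: "real \<Rightarrow> circ_fun set" where
  "Lp p = {f. in_Lp p f}"

definition Linf :: "circ_fun set" where
  "Linf = {f. in_Linf f}"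

definition Hardy :: "real \<Rightarrow> circ_fun set" where
  "Hardy p = {f \<in> Lp p. \<forall>n<0. fourier f n = 0}"

definition conj_Hardy :: "real \<Rightarrow> circ_fun set" where
  "conj_Hardy p = {f \<in> Lp p. \<forall>n>0. fourier f n = 0}"

definition dual_exponent :: "real \<Rightarrow> real" where
  "dual_exponent p = p / (p - 1)"

text \<open>Existence of the Riesz projection on \<open>Lp p\<close>, \<open>1 < p < \<infinity>\<close>, is M. Riesz's theorem, and
  uniqueness is the uniqueness theorem for Fourier series.\<close>

definition riesz :: "real \<Rightarrow> circ_fun \<Rightarrow> circ_fun" where
  "riesz p f = (THE g. g \<in> Hardy p \<and> (\<forall>n\<ge>0. fourier g n = fourier f n))"

definition coriesz :: "real \<Rightarrow> circ_fun \<Rightarrow> circ_fun" where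
  "coriesz p f = f - riesz p f"


section \<open>Bounded and Fredholm operators on Hardy spaces\<close>

text \<open>An operator on \<open>Hardy p\<close> is a function on the whole type of which only the values on
  \<open>Hardy p\<close> matter.\<close>

definition bounded_op :: "real \<Rightarrow> (circ_fun \<Rightarrow> circ_fun) \<Rightarrow> bool" where
  "bounded_op p A \<longleftrightarrow>
     (\<forall>f\<in>Hardy p. A f \<in> Hardy p) \<and>
     (\<forall>f\<in>Hardy p. \<forall>g\<in>Hardy p. A (f + g) = A f + A g) \<and>
     (\<forall>z. \<forall>f\<in>Hardy p. A (cscale z f) = cscale z (A f)) \<and>
     (\<exists>C. \<forall>f\<in>Hardy p. Lp_norm p (A f) \<le> C * Lp_norm p f)"

text \<open>The Banach space dual of \<open>Hardy p\<close>; functionals are extended by zero outside \<open>Hardy p\<close>,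
  so that equality of functionals is equality of functions.\<close>

definition Hardy_dual :: "real \<Rightarrow> (circ_fun \<Rightarrow> complex) set" where
  "Hardy_dual p = {\<phi>.
     (\<forall>f\<in>Hardy p. \<forall>g\<in>Hardy p. \<phi> (f + g) = \<phi> f + \<phi> g) \<and>
     (\<forall>z. \<forall>f\<in>Hardy p. \<phi> (cscale z f) = z * \<phi> f) \<and>
     (\<exists>C. \<forall>f\<in>Hardy p. norm (\<phi> f) \<le> C * Lp_norm p f) \<and>
     (\<forall>f. f \<notin> Hardy p \<longrightarrow> \<phi> f = 0)}"

definition adjoint_op ::
    "real \<Rightarrow> (circ_fun \<Rightarrow> circ_fun) \<Rightarrow> (circ_fun \<Rightarrow> complex) \<Rightarrow> circ_fun \<Rightarrow> complex" where
  "adjoint_op p A \<phi> = (\<lambda>f. if f \<in> Hardy p then \<phi> (A f) else 0)"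

definition dual_scale :: "complex \<Rightarrow> (circ_fun \<Rightarrow> complex) \<Rightarrow> circ_fun \<Rightarrow> complex" where
  "dual_scale z \<phi> = (\<lambda>f. z * \<phi> f)"

lemma vector_space_dual_scale: "vector_space dual_scale"
  by unfold_locales (auto simp: dual_scale_def algebra_simps)

definition ker_op :: "real \<Rightarrow> (circ_fun \<Rightarrow> circ_fun) \<Rightarrow> circ_fun set" where
  "ker_op p A = {f \<in> Hardy p. A f = 0}"

definition coker_op :: "real \<Rightarrow> (circ_fun \<Rightarrow> circ_fun) \<Rightarrow> (circ_fun \<Rightarrow> complex) set" where
  "coker_op p A = {\<phi> \<in> Hardy_dual p. adjoint_op p A \<phi> = 0}"

definition closed_range :: "real \<Rightarrow> (circ_fun \<Rightarrow> circ_fun) \<Rightarrow> bool" where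
  "closed_range p A \<longleftrightarrow>
     (\<forall>u g. (\<forall>n::nat. u n \<in> A ` Hardy p) \<and> g \<in> Hardy p \<and>
        (\<lambda>n. Lp_norm p (u n - g)) \<longlonglongrightarrow> 0 \<longrightarrow> g \<in> A ` Hardy p)"

definition fredholm :: "real \<Rightarrow> (circ_fun \<Rightarrow> circ_fun) \<Rightarrow> bool" where
  "fredholm p A \<longleftrightarrow> bounded_op p A \<and> closed_range p A \<and>
     (\<exists>B. finite B \<and> ker_op p A \<subseteq> module.span cscale B) \<and>
     (\<exists>B. finite B \<and> coker_op p A \<subseteq> module.span dual_scale B)"

definition fredholm_index :: "real \<Rightarrow> (circ_fun \<Rightarrow> circ_fun) \<Rightarrow> int" where
  "fredholm_index p A =
     int (vector_space.dim cscale (ker_op p A)) - int (vector_space.dim dual_scale (coker_op p A))"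


section \<open>Toeplitz and Hankel operators, matching pairs, factorization signature\<close>

definition toeplitz :: "real \<Rightarrow> circ_fun \<Rightarrow> circ_fun \<Rightarrow> circ_fun" where
  "toeplitz p a f = riesz p (a * f)"

definition hankel :: "real \<Rightarrow> circ_fun \<Rightarrow> circ_fun \<Rightarrow> circ_fun" where
  "hankel p a f = riesz p (a * coriesz p (flip f))"

definition matching_pair :: "circ_fun \<Rightarrow> circ_fun \<Rightarrow> bool" where
  "matching_pair a b \<longleftrightarrow> a \<in> Linf \<and> (\<exists>a'\<in>Linf. a * a' = 1) \<and> b \<in> Linf \<and>
     a * reflect a = b * reflect b"

definition subordinated_pair :: "circ_fun \<Rightarrow> circ_fun \<Rightarrow> circ_fun \<times> circ_fun" where
  "subordinated_pair a b = (a * inverse b, b * inverse (reflect a))"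

text \<open>On \<open>span {t^k : k \<ge> 0}\<close>, multiplication by \<open>inverse gm\<close> takes values in
  \<open>Lp (dual_exponent p)\<close>, so the Riesz projection in the last clause is the one on that space.\<close>

definition wiener_hopf :: "real \<Rightarrow> circ_fun \<Rightarrow> circ_fun \<Rightarrow> int \<Rightarrow> circ_fun \<Rightarrow> bool" where
  "wiener_hopf p g gm \<nu> gp \<longleftrightarrow>
     g = gm * tpow \<nu> * gp \<and>
     gp * inverse gp = 1 \<and> gp \<in> Hardy (dual_exponent p) \<and> inverse gp \<in> Hardy p \<and>
     gm * inverse gm = 1 \<and> gm \<in> conj_Hardy p \<and> inverse gm \<in> conj_Hardy (dual_exponent p) \<and>
     fourier gm 0 = 1 \<and>
     (\<exists>B. bounded_op p B \<and>
        (\<forall>f \<in> module.span cscale (range (\<lambda>k::nat. tpow (int k))).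
           B f = inverse gp * riesz (dual_exponent p) (inverse gm * f)))"

text \<open>The value at \<open>0\<close> of the factor \<open>gp\<close>; the factorization is unique, and it exists
  whenever the Toeplitz operator with symbol \<open>g\<close> is Fredholm on \<open>Hardy p\<close>.\<close>

definition signature :: "real \<Rightarrow> circ_fun \<Rightarrow> complex" where
  "signature p g = (THE s. \<exists>gm \<nu> gp. wiener_hopf p g gm \<nu> gp \<and> s = fourier gp 0)"

end

theory Submission
  imports Defs "HOL-Complex_Analysis.Complex_Analysis"
begin

text \<open>Write \<open>J\<close> for \<open>flip\<close>. If \<open>f\<close> is in the kernel of \<open>T(a) + H(b)\<close>, then \<open>a f + b J f = J g\<close> with
  \<open>g \<in> H\<^sup>p\<close>, and \<open>a a~ = b b~\<close> yields \<open>a~ J g = b g\<close>; moreover \<open>g = 0\<close> forces \<open>c f = - J f\<close>. Dually, a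
  functional in the cokernel is given by some \<open>w \<in> H\<^sup>q\<close> with \<open>a J w + b~ w = h \<in> H\<^sup>q\<close>, which yields
  \<open>h = c J h\<close>. If \<open>g \<noteq> 0\<close> and \<open>h = 0\<close>, multiplying the two relations gives \<open>g w = - J g J w\<close>, where the left
  side is analytic and the right side is \<open>t\<^sup>-\<^sup>2\<close> times a coanalytic function; so \<open>g w = 0\<close> and \<open>w = 0\<close>.

  It remains to exclude the nonzero solutions of \<open>c f = - J f\<close> in \<open>H\<^sup>p\<close> and of \<open>h = c J h\<close> in \<open>H\<^sup>q\<close> (with
  opposite signs for \<open>T(a) - H(b)\<close>). They lie in the kernel and in the cokernel of \<open>T(c)\<close>, one of which is
  trivial by Coburn's argument. For index \<open>0\<close> both are. For index \<open>1\<close> and \<open>-1\<close>, a solution on the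
  nontrivial side makes \<open>T(t c)\<close>, respectively \<open>T(t\<^sup>-\<^sup>1 c)\<close>, bijective, which gives a Wiener--Hopf
  factorization of \<open>c\<close>, and comparing mean values shows that the signature is \<open>-1\<close>.

  The Riesz projection is bounded by M. Riesz's argument: for \<open>1 < p \<le> 2\<close> and an analytic polynomial \<open>F\<close>
  with \<open>Re F > 0\<close>, the mean of \<open>F\<^sup>p\<close> is \<open>F(0)\<^sup>p\<close>, while \<open>\<bar>F\<bar>\<^sup>p \<le> A (Re F)\<^sup>p - B Re F\<^sup>p\<close> pointwise.\<close>

section \<open>Lebesgue spaces on the circle\<close>

text \<open>The cokernel consists of abstract bounded functionals, which have to become functions
  before they can be multiplied. \<open>separation\<close> obtains functionals from best
  approximations, and \<open>Hardy_dual_representation\<close> writes each element of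
  \<open>Hardy_dual p\<close> as \<open>pairing p (reflect w)\<close>; the reflection makes
  \<open>w\<close> analytic, so that it can be flipped like a kernel function. The same tool shows
  that a closed range is cut out by the cokernel, which is how surjectivity is obtained. If
  \<open>toeplitz p g0\<close> has the inverse \<open>R\<close>, the factors are built from
  \<open>x = R 1\<close> and from the function \<open>y\<close> that represents the functional
  taking \<open>f\<close> to \<open>fourier (R f) 0\<close>. Then \<open>gm = g0 * x\<close> is
  coanalytic, \<open>z = g0 * y\<close> is analytic, and \<open>x * z = gm * y\<close> is both,
  hence constant. Boundedness of \<open>R\<close> enters through that functional and through the
  definition of the factorization; it comes from the open mapping theorem. That the constant is not
  zero, Coburn's argument and the last step from \<open>g * w = 0\<close> rest on one fact: an
  analytic function that vanishes on a set of positive measure is zero.\<close>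

interpretation circ: prob_space circ_measure
  by (rule prob_space_circ_measure)

interpretation cvs: vector_space cscale
  by (rule vector_space_cscale)

lemma circ_fun_cases:
  obtains f where "f \<in> borel_measurable borel" "F = abs_circ_fun f"
proof -
  have "\<exists>f. f \<in> borel_measurable borel \<and> F = abs_circ_fun f"
    by (induct F rule: circ_fun.abs_induct) (auto simp: circ_eq_def)
  thus ?thesis using that by blast
qed

lemma circ_eq_refl [simp]: "circ_eq f f \<longleftrightarrow> f \<in> borel_measurable borel"
  by (simp add: circ_eq_def)

lemma AE_circ_norm: "AE t in circ_measure. norm t = 1"
  by (subst AE_circ_measure_iff) auto

lemma AE_circ_inverse: "AE t in circ_measure. 1 / t = cnj t"
proof -
  have "1 / t = cnj t" if "norm t = 1" for t :: complex
    using complex_norm_square[of t] that by (cases "t = 0") (auto simp: divide_eq_eq mult.commute)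
  thus ?thesis using AE_circ_norm by auto
qed

lemma borel_measurable_cnj [measurable]: "cnj \<in> borel_measurable borel"
  by (intro borel_measurable_continuous_onI continuous_intros)

lemma borel_measurable_powi [measurable]: "(\<lambda>t::complex. t powi m) \<in> borel_measurable borel"
  by (cases "m \<ge> 0") (simp_all add: power_int_def)

text \<open>Conjugation acts on \<open>cis x\<close> by changing the sign of \<open>x\<close>, and
  both Lebesgue measure and the interval from \<open>- pi\<close> to \<open>pi\<close> are symmetric
  under this change.\<close>

lemma circ_measure_reflect: "distr circ_measure borel cnj = circ_measure"
proof -
  have "distr (uniform_measure lborel {-pi..pi}) borel (\<lambda>x. - x) = uniform_measure lborel {-pi..pi}"
  proof (rule measure_eqI)
    fix A assume "A \<in> sets (distr (uniform_measure lborel {-pi..pi}) borel (\<lambda>x. - x))"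
    hence [measurable]: "A \<in> sets borel" by simp
    have pre: "uminus -` A \<in> sets borel"
      by (rule measurable_sets_borel[of _ borel]) auto
    have "emeasure lborel ({-pi..pi} \<inter> uminus -` A) = emeasure (distr lborel borel uminus) ({-pi..pi} \<inter> A)"
      by (subst emeasure_distr) (auto intro!: arg_cong[where f = "emeasure lborel"])
    also have "\<dots> = emeasure lborel ({-pi..pi} \<inter> A)" by (simp add: lborel_distr_uminus)
    finally show "emeasure (distr (uniform_measure lborel {-pi..pi}) borel (\<lambda>x. - x)) A =
       emeasure (uniform_measure lborel {-pi..pi}) A"
      by (subst emeasure_distr) (auto simp: pre)
  qed simp
  thus ?thesis
    unfolding circ_measure_def
    by (subst distr_distr) (auto simp: comp_def cis_cnj distr_distr[symmetric] fun_eq_iff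
         distr_distr[of cis borel borel "\<lambda>x. - x" "uniform_measure lborel {-pi..pi}", unfolded comp_def, symmetric])
qed

lemma integrable_circ_reflect:
  fixes f :: "complex \<Rightarrow> 'b::{banach, second_countable_topology}"
  assumes [measurable]: "f \<in> borel_measurable borel"
  shows "integrable circ_measure (\<lambda>t. f (cnj t)) \<longleftrightarrow> integrable circ_measure f"
  by (subst (2) circ_measure_reflect[symmetric]) (simp add: integrable_distr_eq)

lemma integral_circ_reflect:
  fixes f :: "complex \<Rightarrow> 'b::{banach, second_countable_topology}"
  assumes [measurable]: "f \<in> borel_measurable borel"
  shows "(LINT t|circ_measure. f (cnj t)) = (LINT t|circ_measure. f t)"
  by (subst (2) circ_measure_reflect[symmetric]) (simp add: integral_distr)

text \<open>The \<open>p\<close>-th power of \<open>Lp_norm p\<close>. It is a plain integral, so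
  that pointwise inequalities between powers can be integrated before any root is taken.\<close>

lift_definition Lp_int :: "real \<Rightarrow> circ_fun \<Rightarrow> real" is
  "\<lambda>p f. LINT t|circ_measure. norm (f t) powr p"
  by (intro integral_cong_AE) (auto simp: circ_eq_def)

lemma Lp_int_nonneg [simp]: "Lp_int p f \<ge> 0"
  by transfer auto

lemma Lp_norm_Lp_int: "Lp_norm p f = Lp_int p f powr (1 / p)"
  by transfer auto

lemma Lp_norm_nonneg [simp]: "Lp_norm p f \<ge> 0"
  by (simp add: Lp_norm_Lp_int)

lemma Lp_int_Lp_norm: "p > 0 \<Longrightarrow> Lp_int p f = Lp_norm p f powr p"
  by (simp add: Lp_norm_Lp_int powr_powr)

lemma powr_add_le:
  fixes a b p :: real
  assumes "a \<ge> 0" "b \<ge> 0" "p \<ge> 0"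
  shows "(a + b) powr p \<le> 2 powr p * (a powr p + b powr p)"
proof -
  have "(a + b) powr p \<le> (2 * max a b) powr p"
    using assms by (intro powr_mono2) auto
  also have "\<dots> = 2 powr p * (max a b) powr p"
    using assms by (simp add: powr_mult)
  also have "\<dots> \<le> 2 powr p * (a powr p + b powr p)"
    by (intro mult_left_mono) (auto simp: max_def)
  finally show ?thesis .
qed

lemma in_Lp_add: "p \<ge> 0 \<Longrightarrow> in_Lp p f \<Longrightarrow> in_Lp p g \<Longrightarrow> in_Lp p (f + g)"
proof (transfer fixing: p)
  fix f g :: "complex \<Rightarrow> complex"
  assume p: "p \<ge> 0" and fg: "circ_eq f f" "circ_eq g g"
  and i: "integrable circ_measure (\<lambda>t. cmod (f t) powr p)" "integrable circ_measure (\<lambda>t. cmod (g t) powr p)"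
  have [measurable]: "f \<in> borel_measurable borel" "g \<in> borel_measurable borel"
    using fg by auto
  show "integrable circ_measure (\<lambda>t. cmod (f t + g t) powr p)"
  proof (rule Bochner_Integration.integrable_bound)
    show "integrable circ_measure (\<lambda>t. 2 powr p * (cmod (f t) powr p + cmod (g t) powr p))"
      using i by auto
    have "cmod (f t + g t) powr p \<le> 2 powr p * (cmod (f t) powr p + cmod (g t) powr p)" for t
      using powr_mono2[OF p norm_ge_zero norm_triangle_ineq[of "f t" "g t"]]
        powr_add_le[of "norm (f t)" "norm (g t)" p] p by auto
    thus "AE t in circ_measure. norm (cmod (f t + g t) powr p)
        \<le> norm (2 powr p * (cmod (f t) powr p + cmod (g t) powr p))"
      by auto
  qed measurable
qed

lemma in_Lp_cscale: "in_Lp p f \<Longrightarrow> in_Lp p (cscale z f)"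
  by transfer (auto simp: norm_mult powr_mult)

lemma Lp_int_cscale: "Lp_int p (cscale z f) = norm z powr p * Lp_int p f"
  by transfer (auto simp: norm_mult powr_mult)

lemma Lp_norm_cscale: "p > 0 \<Longrightarrow> Lp_norm p (cscale z f) = norm z * Lp_norm p f"
  by (simp add: Lp_norm_Lp_int Lp_int_cscale powr_mult powr_powr)

lemma cscale_minus_one: "cscale (- 1) f = - f"
  by transfer auto

lemma cscale_mult_left: "cscale z f * g = cscale z (f * g)"
  and cscale_mult_right: "f * cscale z g = cscale z (f * g)"
  by (transfer, auto simp: algebra_simps)+

lemma cscale_cscale [simp]: "cscale z (cscale w f) = cscale (z * w) f"
  by transfer (auto simp: algebra_simps)

lemma cscale_one [simp]: "cscale 1 f = f"
  by transfer auto

lemma cscale_0_left [simp]: "cscale 0 f = 0"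
  and cscale_0_right [simp]: "cscale z 0 = 0"
  by (transfer, auto)+

lemma cscale_diff_right: "cscale z (f - g) = cscale z f - cscale z g"
  and cscale_add_right: "cscale z (f + g) = cscale z f + cscale z g"
  by (transfer, auto simp: algebra_simps)+

lemma LpD: "f \<in> Lp p \<longleftrightarrow> in_Lp p f"
  by (simp add: Lp_def)

lemma zero_Lp [simp]: "0 \<in> Lp p"
  unfolding LpD by transfer auto

lemma Lp_add: "p \<ge> 0 \<Longrightarrow> f \<in> Lp p \<Longrightarrow> g \<in> Lp p \<Longrightarrow> f + g \<in> Lp p"
  by (simp add: LpD in_Lp_add)

lemma Lp_cscale: "f \<in> Lp p \<Longrightarrow> cscale z f \<in> Lp p"
  by (simp add: LpD in_Lp_cscale)

lemma Lp_uminus: "f \<in> Lp p \<Longrightarrow> - f \<in> Lp p"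
  using Lp_cscale[of f p "- 1"] by (simp add: cscale_minus_one)

lemma Lp_diff: "p \<ge> 0 \<Longrightarrow> f \<in> Lp p \<Longrightarrow> g \<in> Lp p \<Longrightarrow> f - g \<in> Lp p"
  using Lp_add[of p f "- g"] by (simp add: Lp_uminus)

lemma Lp_sum: "p \<ge> 0 \<Longrightarrow> (\<And>i. i \<in> I \<Longrightarrow> f i \<in> Lp p) \<Longrightarrow> (\<Sum>i\<in>I. f i) \<in> Lp p"
  by (induct I rule: infinite_finite_induct) (auto intro!: Lp_add)

lemma Lp_norm_minus [simp]: "Lp_norm p (- f) = Lp_norm p f"
  by transfer auto

lemma Lp_norm_minus_commute: "Lp_norm p (f - g) = Lp_norm p (g - f)"
  by transfer (auto simp: norm_minus_commute)

lemma Lp_norm_zero [simp]: "Lp_norm p 0 = 0"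
  by transfer auto

lemma Lp_int_eq_0: "f \<in> Lp p \<Longrightarrow> Lp_int p f = 0 \<longleftrightarrow> f = 0"
  unfolding LpD
proof (transfer fixing: p)
  fix f :: "complex \<Rightarrow> complex" assume "circ_eq f f"
    and i: "integrable circ_measure (\<lambda>t. cmod (f t) powr p)"
  hence [measurable]: "f \<in> borel_measurable borel" by simp
  have "(LINT t|circ_measure. cmod (f t) powr p) = 0 \<longleftrightarrow> (AE t in circ_measure. cmod (f t) powr p = 0)"
    by (rule integral_nonneg_eq_0_iff_AE) (use i in auto)
  thus "(LINT t|circ_measure. cmod (f t) powr p) = 0 \<longleftrightarrow> circ_eq f (\<lambda>_. 0)"
    by (auto simp: circ_eq_def)
qed

lemma Lp_norm_eq_0: "p > 0 \<Longrightarrow> f \<in> Lp p \<Longrightarrow> Lp_norm p f = 0 \<longleftrightarrow> f = 0"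
  by (simp add: Lp_norm_Lp_int Lp_int_eq_0)

lemma Lp_norm_pos: "p > 0 \<Longrightarrow> f \<in> Lp p \<Longrightarrow> f \<noteq> 0 \<Longrightarrow> Lp_norm p f > 0"
  using Lp_norm_eq_0[of p f] Lp_norm_nonneg[of p f] by linarith

text \<open>The weights are those that turn convexity into Minkowski's inequality. If one argument
  is \<open>0\<close>, the claim reduces to \<open>l powr p \<le> l\<close> for \<open>l\<close>
  between \<open>0\<close> and \<open>1\<close>.\<close>

lemma powr_convex_mean:
  fixes x y a b p :: real
  assumes "x \<ge> 0" "y \<ge> 0" "a > 0" "b > 0" "p \<ge> 1"
  shows "((x + y) / (a + b)) powr p \<le> a / (a + b) * (x / a) powr p + b / (a + b) * (y / b) powr p"
proof -
  have small: "(l * s) powr p \<le> l * s powr p" if "0 \<le> l" "l \<le> 1" "s \<ge> 0" for l s :: real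
  proof -
    have "l powr p \<le> l"
      using that assms powr_mono'[of 1 p l] by (cases "l = 0") auto
    thus ?thesis using that by (simp add: powr_mult mult_right_mono)
  qed
  consider "x = 0" | "y = 0" | "x > 0" "y > 0" using assms by linarith
  thus ?thesis
  proof cases
    case 1 
    have "y / (a + b) = b / (a + b) * (y / b)" using assms by simp
    thus ?thesis using small[of "b / (a + b)" "y / b"] 1 assms by simp
  next
    case 2
    have "x / (a + b) = a / (a + b) * (x / a)" using assms by simp
    thus ?thesis using small[of "a / (a + b)" "x / a"] 2 assms by simp
  next
    case 3
    have weights: "1 - b / (a + b) = a / (a + b)" using assms by (simp add: field_simps)
    have eq: "(x + y) / (a + b) = (1 - b / (a + b)) *\<^sub>R (x / a) + (b / (a + b)) *\<^sub>R (y / b)"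
      "1 - b / (a + b) = a / (a + b)"
      using assms by (simp_all add: add_divide_distrib[symmetric] field_simps weights)
    show ?thesis
      using convex_onD[OF powr_convex[OF \<open>p \<ge> 1\<close>], of "b / (a + b)" "x / a" "y / b"] 3 assms
      unfolding eq(1) by (simp add: eq(2))
  qed
qed

text \<open>With \<open>a\<close> and \<open>b\<close> the two norms,
  \<open>|f + g| / (a + b)\<close> is at most the convex combination of \<open>|f| / a\<close> and
  \<open>|g| / b\<close> with weights \<open>a / (a + b)\<close> and \<open>b / (a + b)\<close>. The
  \<open>p\<close>-th powers of both quotients have mean 1, and convexity of the power gives the
  bound.\<close>

lemma Lp_norm_triangle:
  assumes p: "p \<ge> 1" and f: "f \<in> Lp p" and g: "g \<in> Lp p"
  shows "Lp_norm p (f + g) \<le> Lp_norm p f + Lp_norm p g"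
proof (cases "f = 0 \<or> g = 0")
  case True thus ?thesis by auto
next
  case False
  define a where "a = Lp_norm p f"
  define b where "b = Lp_norm p g"
  have pos: "a > 0" "b > 0" using False p f g by (auto simp: a_def b_def intro!: Lp_norm_pos)
  have "Lp_int p (f + g) \<le> (a + b) powr p * (a / (a + b) * (Lp_int p f / a powr p) + b / (a + b) * (Lp_int p g / b powr p))"
    using f g unfolding LpD
  proof (transfer fixing: p a b)
    fix f g :: "complex \<Rightarrow> complex"
    assume "circ_eq f f" "circ_eq g g"
    and i: "integrable circ_measure (\<lambda>t. cmod (f t) powr p)" "integrable circ_measure (\<lambda>t. cmod (g t) powr p)"
    hence [measurable]: "f \<in> borel_measurable borel" "g \<in> borel_measurable borel" by auto
    have pw: "cmod (f t + g t) powr p \<le> (a + b) powr p * (a / (a + b) * (cmod (f t) powr p / a powr p) + b / (a + b) * (cmod (g t) powr p / b powr p))" for t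
    proof -
      have "cmod (f t + g t) powr p \<le> (cmod (f t) + cmod (g t)) powr p"
        using p by (intro powr_mono2 norm_triangle_ineq) auto
      also have "\<dots> = (a + b) powr p * ((cmod (f t) + cmod (g t)) / (a + b)) powr p"
        using pos by (simp add: powr_divide)
      also have "\<dots> \<le> (a + b) powr p * (a / (a + b) * (cmod (f t) / a) powr p + b / (a + b) * (cmod (g t) / b) powr p)"
        using pos p by (intro mult_left_mono powr_convex_mean) auto
      finally show ?thesis using pos by (simp add: powr_divide)
    qed
    have "(LINT t|circ_measure. cmod (f t + g t) powr p) \<le> (LINT t|circ_measure. (a + b) powr p * (a / (a + b) * (cmod (f t) powr p / a powr p) + b / (a + b) * (cmod (g t) powr p / b powr p)))"
    proof (rule integral_mono')
      show "integrable circ_measure (\<lambda>t. (a + b) powr p * (a / (a + b) * (cmod (f t) powr p / a powr p) + b / (a + b) * (cmod (g t) powr p / b powr p)))"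
        using i by (intro integrable_mult_right Bochner_Integration.integrable_add integrable_divide) auto
    qed (use pw pos in auto)
    also have "\<dots> = (a + b) powr p *
          (a / (a + b) * ((LINT t|circ_measure. cmod (f t) powr p) / a powr p) +
           b / (a + b) * ((LINT t|circ_measure. cmod (g t) powr p) / b powr p))"
      using i by (simp add: Bochner_Integration.integral_add)
    finally show "(LINT t|circ_measure. cmod (f t + g t) powr p) \<le> (a + b) powr p *
          (a / (a + b) * ((LINT t|circ_measure. cmod (f t) powr p) / a powr p) +
           b / (a + b) * ((LINT t|circ_measure. cmod (g t) powr p) / b powr p))" .
  qed
  also have "Lp_int p f / a powr p = 1" using pos p by (simp add: Lp_int_Lp_norm a_def[symmetric])
  also have "Lp_int p g / b powr p = 1" using pos p by (simp add: Lp_int_Lp_norm b_def[symmetric])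
  also have "a / (a + b) * 1 + b / (a + b) * 1 = 1" using pos by (simp add: add_divide_distrib[symmetric])
  finally have "Lp_norm p (f + g) powr p \<le> (a + b) powr p" using p by (simp add: Lp_int_Lp_norm)
  hence "Lp_norm p (f + g) \<le> a + b"
    using powr_less_mono2[of p "a + b" "Lp_norm p (f + g)"] pos p by (smt (verit))
  thus ?thesis by (simp add: a_def b_def)
qed

lemma Lp_norm_triangle_diff:
  assumes "p \<ge> 1" "f \<in> Lp p" "g \<in> Lp p"
  shows "Lp_norm p (f - g) \<le> Lp_norm p f + Lp_norm p g"
  using Lp_norm_triangle[of p f "- g"] assms by (simp add: Lp_uminus)

lemma Lp_norm_triangle_mid:
  assumes "p \<ge> 1" "f \<in> Lp p" "g \<in> Lp p" "h \<in> Lp p"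
  shows "Lp_norm p (f - h) \<le> Lp_norm p (f - g) + Lp_norm p (g - h)"
  using Lp_norm_triangle[of p "f - g" "g - h"] assms by (simp add: Lp_diff)

lemma Lp_norm_diff_le:
  assumes "p \<ge> 1" "f \<in> Lp p" "g \<in> Lp p"
  shows "Lp_norm p f \<le> Lp_norm p g + Lp_norm p (f - g)"
  using Lp_norm_triangle[of p g "f - g"] assms by (simp add: Lp_diff)

lemma dual_exponent:
  assumes "1 < p"
  shows "1 < dual_exponent p" "1 / p + 1 / dual_exponent p = 1"
    "dual_exponent (dual_exponent p) = p" "(p - 1) * dual_exponent p = p"
    "p / dual_exponent p = p - 1"
  using assms by (auto simp: dual_exponent_def field_simps)

lemma Holder_Lp_int:
  assumes p: "1 < p" and f: "f \<in> Lp p" and g: "g \<in> Lp (dual_exponent p)"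
  shows "f * g \<in> Lp 1" "Lp_norm 1 (f * g) \<le> Lp_norm p f * Lp_norm (dual_exponent p) g"
proof -
  let ?q = "dual_exponent p"
  note q = dual_exponent[OF p]
  have young: "x * y \<le> a * b * (x powr p / a powr p / p + y powr ?q / b powr ?q / ?q)"
    if "x \<ge> 0" "y \<ge> 0" "a > 0" "b > 0" for x y a b :: real
  proof -
    have "(x / a) * (y / b) \<le> (x / a) powr p / p + (y / b) powr ?q / ?q"
      using that p q by (intro Youngs_inequality) auto
    hence "a * b * ((x / a) * (y / b)) \<le> a * b * ((x / a) powr p / p + (y / b) powr ?q / ?q)"
      using that by (intro mult_left_mono) auto
    thus ?thesis using that by (simp add: powr_divide)
  qed
  \<comment> \<open>Young's inequality is scaled by free constants: \<open>a = b = 1\<close> gives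
    integrability of the product, and the two norms themselves make the bracket equal to 1, which
    gives the sharp bound.\<close>
  have *: "in_Lp 1 (f * g) \<and> Lp_int 1 (f * g) \<le> a * b * (Lp_int p f / a powr p / p + Lp_int ?q g / b powr ?q / ?q)"
    if ab: "a > 0" "b > 0" for a b :: real
    using f g unfolding LpD
  proof (transfer fixing: p a b)
    fix f g :: "complex \<Rightarrow> complex"
    assume "circ_eq f f" "circ_eq g g"
    and i: "integrable circ_measure (\<lambda>t. cmod (f t) powr p)" "integrable circ_measure (\<lambda>t. cmod (g t) powr ?q)"
    hence [measurable]: "f \<in> borel_measurable borel" "g \<in> borel_measurable borel" by auto
    let ?B = "\<lambda>t. a * b * (cmod (f t) powr p / a powr p / p + cmod (g t) powr ?q / b powr ?q / ?q)"
    have iB: "integrable circ_measure ?B" using i by auto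
    have pw: "cmod (f t * g t) powr 1 \<le> ?B t" for t
      using young[of "cmod (f t)" "cmod (g t)" a b] ab by (simp add: norm_mult)
    have "?B t \<ge> 0" for t using ab p q by (intro mult_nonneg_nonneg add_nonneg_nonneg divide_nonneg_nonneg) auto
    hence 1: "integrable circ_measure (\<lambda>t. cmod (f t * g t) powr 1)"
      using pw by (intro Bochner_Integration.integrable_bound[OF iB]) (auto simp: abs_of_nonneg)
    have "(LINT t|circ_measure. cmod (f t * g t) powr 1) \<le> (LINT t|circ_measure. ?B t)"
      by (rule integral_mono[OF 1 iB]) (use pw in auto)
    also have "\<dots> = a * b * ((LINT t|circ_measure. cmod (f t) powr p) / a powr p / p +
         (LINT t|circ_measure. cmod (g t) powr ?q) / b powr ?q / ?q)"
      using i by (simp add: Bochner_Integration.integral_add)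
    finally show "integrable circ_measure (\<lambda>t. cmod (f t * g t) powr 1) \<and>
       (LINT t|circ_measure. cmod (f t * g t) powr 1) \<le> a * b * ((LINT t|circ_measure. cmod (f t) powr p) / a powr p / p +
         (LINT t|circ_measure. cmod (g t) powr ?q) / b powr ?q / ?q)" using 1 by simp
  qed
  show "f * g \<in> Lp 1" using *[of 1 1] by (simp add: LpD)
  show "Lp_norm 1 (f * g) \<le> Lp_norm p f * Lp_norm ?q g"
  proof (cases "f = 0 \<or> g = 0")
    case True thus ?thesis by auto
  next
    case False
    have pos: "Lp_norm p f > 0" "Lp_norm ?q g > 0" using False p q f g by (auto intro!: Lp_norm_pos)
    have "Lp_int p f / Lp_norm p f powr p / p + Lp_int ?q g / Lp_norm ?q g powr ?q / ?q = 1"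
      using pos p q by (simp add: Lp_int_Lp_norm)
    with *[OF pos] show ?thesis by (simp add: Lp_norm_Lp_int[of 1])
  qed
qed

section \<open>Fourier coefficients and powers of \<open>t\<close>\<close>

lemma borel_measurable_mult_powi [measurable]:
  fixes f :: "complex \<Rightarrow> complex"
  assumes [measurable]: "f \<in> borel_measurable borel"
  shows "(\<lambda>t. f t * t powi n) \<in> borel_measurable borel"
  by (intro borel_measurable_times assms borel_measurable_powi)

lemma AE_norm_powi: "AE t in circ_measure. norm (t powi n) = 1"
  using AE_circ_norm by eventually_elim (simp add: norm_power_int)

lemma integrable_powi:
  assumes [measurable]: "f \<in> borel_measurable borel"
  shows "integrable circ_measure (\<lambda>t. f t * t powi n) \<longleftrightarrow> integrable circ_measure f"
proof -
  have "integrable circ_measure (\<lambda>t. norm (f t * t powi n)) \<longleftrightarrow> integrable circ_measure (\<lambda>t. norm (f t))"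
    by (rule integrable_cong_AE) (use AE_norm_powi[of n] in \<open>auto simp: norm_mult\<close>)
  thus ?thesis by (simp add: integrable_norm_iff)
qed

lemma in_Lp_1: "f \<in> borel_measurable borel \<Longrightarrow> in_Lp 1 (abs_circ_fun f) \<longleftrightarrow> integrable circ_measure f"
  by (simp add: in_Lp.abs_eq integrable_norm_iff)

lemma fourier_add:
  "f \<in> Lp 1 \<Longrightarrow> g \<in> Lp 1 \<Longrightarrow> fourier (f + g) n = fourier f n + fourier g n"
  unfolding LpD
proof (transfer fixing: n)
  fix f g :: "complex \<Rightarrow> complex"
  assume "circ_eq f f" "circ_eq g g" "integrable circ_measure (\<lambda>t. cmod (f t) powr 1)"
    "integrable circ_measure (\<lambda>t. cmod (g t) powr 1)"
  hence "integrable circ_measure (\<lambda>t. f t * t powi - n)" "integrable circ_measure (\<lambda>t. g t * t powi - n)"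
    by (subst integrable_powi; auto simp: integrable_norm_iff)+
  thus "(LINT t|circ_measure. (f t + g t) * t powi - n) =
    (LINT t|circ_measure. f t * t powi - n) + (LINT t|circ_measure. g t * t powi - n)"
    by (simp add: algebra_simps)
qed

lemma fourier_cscale: "fourier (cscale z f) n = z * fourier f n"
  by transfer (simp add: mult.assoc)

lemma fourier_uminus: "fourier (- f) n = - fourier f n"
  using fourier_cscale[of "- 1" f n] by (simp add: cscale_minus_one)

lemma fourier_diff:
  "f \<in> Lp 1 \<Longrightarrow> g \<in> Lp 1 \<Longrightarrow> fourier (f - g) n = fourier f n - fourier g n"
  using fourier_add[of f "- g" n] by (simp add: Lp_uminus fourier_uminus)

lemma fourier_0 [simp]: "fourier 0 n = 0"
  by transfer auto

lemma fourier_sum: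
  "(\<And>i. i \<in> I \<Longrightarrow> f i \<in> Lp 1) \<Longrightarrow> fourier (\<Sum>i\<in>I. f i) n = (\<Sum>i\<in>I. fourier (f i) n)"
  by (induct I rule: infinite_finite_induct) (auto simp: fourier_add Lp_sum)

lemma norm_fourier_le: "norm (fourier f n) \<le> Lp_norm 1 f"
proof (transfer fixing: n)
  fix f :: "complex \<Rightarrow> complex" assume "circ_eq f f"
  hence [measurable]: "f \<in> borel_measurable borel" by simp
  have "cmod (LINT t|circ_measure. f t * t powi - n) \<le> (LINT t|circ_measure. norm (f t * t powi - n))"
    by (rule integral_norm_bound)
  also have "\<dots> = (LINT t|circ_measure. norm (f t) powr 1)"
    by (rule integral_cong_AE) (use AE_norm_powi[of "- n"] in \<open>auto simp: norm_mult\<close>)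
  finally show "cmod (LINT t|circ_measure. f t * t powi - n)
         \<le> (LINT t|circ_measure. cmod (f t) powr 1) powr (1 / 1)" by simp
qed

lemma tpow_0 [simp]: "tpow 0 = 1"
  by transfer simp

lemma AE_circ_nonzero: "AE t in circ_measure. t \<noteq> 0"
  using AE_circ_norm by eventually_elim auto

lemma tpow_add: "tpow (m + n) = tpow m * tpow n"
  by transfer (use AE_circ_nonzero in \<open>auto simp: circ_eq_def power_int_add\<close>)

lemma tpow_minus_cancel [simp]: "tpow n * tpow (- n) = 1" "tpow (- n) * tpow n = 1"
  by (simp_all add: tpow_add[symmetric])

lemma fourier_tpow_mult: "fourier (tpow m * f) n = fourier f (n - m)"
proof (transfer fixing: n m)
  fix f :: "complex \<Rightarrow> complex" assume "circ_eq f f"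
  hence [measurable]: "f \<in> borel_measurable borel" by simp
  show "(LINT t|circ_measure. t powi m * f t * t powi - n) = (LINT t|circ_measure. f t * t powi - (n - m))"
  proof (rule integral_cong_AE)
    show "AE t in circ_measure. t powi m * f t * t powi - n = f t * t powi - (n - m)"
      using AE_circ_nonzero by eventually_elim (simp add: power_int_diff field_simps power_int_minus)
  qed measurable
qed

lemma integral_circ_measure:
  fixes f :: "complex \<Rightarrow> complex"
  assumes [measurable]: "f \<in> borel_measurable borel"
  shows "(LINT t|circ_measure. f t) = (LINT x:{-pi..pi}|lborel. f (cis x)) / (2 * pi)"
proof -
  have eq: "uniform_measure lborel {-pi..pi} = density lborel (\<lambda>x. ennreal (indicator {-pi..pi} x / (2 * pi)))"
    unfolding uniform_measure_def
    by (intro density_cong) (auto simp: indicator_def divide_ennreal[symmetric] ennreal_mult[symmetric])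
  have "(LINT t|circ_measure. f t) = (LINT x|uniform_measure lborel {-pi..pi}. f (cis x))"
    unfolding circ_measure_def by (simp add: integral_distr)
  also have "\<dots> = (LINT x|lborel. (indicator {-pi..pi} x / (2 * pi)) *\<^sub>R f (cis x))"
    unfolding eq by (subst integral_density) auto
  also have "\<dots> = (LINT x:{-pi..pi}|lborel. f (cis x)) / (2 * pi)"
    unfolding set_lebesgue_integral_def
    by (subst integral_divide_zero[symmetric]) (auto simp: scaleR_conv_of_real intro!: Bochner_Integration.integral_cong)
  finally show ?thesis .
qed

lemma fourier_1: "fourier 1 n = (if n = 0 then 1 else 0)"
proof (cases "n = 0")
  case True thus ?thesis by transfer (simp add: circ.prob_space[simplified])
next
  case False
  define m where "m = real_of_int (- n)"
  have m: "m \<noteq> 0" using False by (simp add: m_def)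
  have "(LBINT x:{-pi..pi}. cis (m * x)) = cis (m * pi) / (\<i> * m) - cis (m * (- pi)) / (\<i> * m)"
    unfolding set_lebesgue_integral_def
  proof (rule integral_FTC_atLeastAtMost)
    show "((\<lambda>x. cis (m * x) / (\<i> * m)) has_vector_derivative cis (m * x)) (at x within {-pi..pi})" for x
    proof -
      have "((\<lambda>z. exp (\<i> * m * z) / (\<i> * m)) has_field_derivative exp (\<i> * m * x)) (at (of_real x))"
        by (rule derivative_eq_intros refl | simp add: m)+
      from has_vector_derivative_real_field[OF this, of "{-pi..pi}"] show ?thesis
        by (simp add: cis_conv_exp mult.assoc)
    qed
  qed (auto intro!: continuous_intros)
  also have "cis (m * pi) = cis (m * (- pi))"
    using sin_npi_int[of n] by (simp add: m_def complex_eq_iff mult.commute[of pi])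
  finally have 0: "(LBINT x:{-pi..pi}. cis (m * x)) = 0" by simp
  have "(LINT t|circ_measure. 1 * t powi (- n)) = 0"
    using 0 by (subst integral_circ_measure) (auto simp: m_def cis_power_int mult.commute)
  thus ?thesis using False by transfer simp
qed

lemma fourier_tpow: "fourier (tpow m) n = (if n = m then 1 else 0)"
  using fourier_tpow_mult[of m 1 n] by (simp add: fourier_1)

section \<open>Bounded functions as multipliers\<close>

lemma Linf_D: "f \<in> Linf \<longleftrightarrow> in_Linf f" by (simp add: Linf_def)

lemma tpow_Linf [simp]: "tpow n \<in> Linf"
  unfolding Linf_D
proof transfer
  fix n show "\<exists>C. AE t in circ_measure. cmod (t powi n) \<le> C"
    using AE_norm_powi[of n] by (intro exI[of _ 1]) (auto elim!: eventually_mono)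
qed

lemma one_Linf [simp]: "1 \<in> Linf"
  using tpow_Linf[of 0] by simp

lemma uminus_Linf: "f \<in> Linf \<Longrightarrow> - f \<in> Linf"
  unfolding Linf_D by transfer auto

lemma mult_Linf: "f \<in> Linf \<Longrightarrow> g \<in> Linf \<Longrightarrow> f * g \<in> Linf"
  unfolding Linf_D
proof transfer
  fix f g :: "complex \<Rightarrow> complex"
  assume "\<exists>C. AE t in circ_measure. cmod (f t) \<le> C" "\<exists>C. AE t in circ_measure. cmod (g t) \<le> C"
  then obtain C D where "AE t in circ_measure. cmod (f t) \<le> C" "AE t in circ_measure. cmod (g t) \<le> D" by auto
  hence "AE t in circ_measure. cmod (f t * g t) \<le> C * D"
    by eventually_elim (auto simp: norm_mult intro!: mult_mono intro: order_trans[OF norm_ge_zero])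
  thus "\<exists>C. AE t in circ_measure. cmod (f t * g t) \<le> C" by blast
qed

lemma reflect_Linf: "f \<in> Linf \<Longrightarrow> reflect f \<in> Linf"
  unfolding Linf_D
proof transfer
  fix f :: "complex \<Rightarrow> complex" assume "circ_eq f f"
    and "\<exists>C. AE t in circ_measure. cmod (f t) \<le> C"
  then obtain C where [measurable]: "f \<in> borel_measurable borel" and C: "AE t in circ_measure. cmod (f t) \<le> C" by auto
  have "AE t in circ_measure. cmod (f (1 / t)) \<le> C"
    by (rule AE_circ_measure_reflect[where P = "\<lambda>t. cmod (f t) \<le> C"])
      (use C in \<open>auto simp: cis_inverse divide_inverse\<close>)
  thus "\<exists>C. AE t in circ_measure. cmod (f (1 / t)) \<le> C" by blast
qed

lemma Lp_mult_Linf_bound: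
  assumes a: "a \<in> Linf" and p: "p > 0"
  obtains C where "C \<ge> 0" "\<And>f. f \<in> Lp p \<Longrightarrow> a * f \<in> Lp p \<and> Lp_norm p (a * f) \<le> C * Lp_norm p f"
proof -
  have "\<exists>C\<ge>0. \<forall>f. in_Lp p f \<longrightarrow> in_Lp p (a * f) \<and> Lp_int p (a * f) \<le> C powr p * Lp_int p f"
    using a unfolding Linf_D
  proof (transfer fixing: p)
    fix a :: "complex \<Rightarrow> complex"
    assume "circ_eq a a" "\<exists>C. AE t in circ_measure. cmod (a t) \<le> C"
    then obtain C where [measurable]: "a \<in> borel_measurable borel" and C: "AE t in circ_measure. cmod (a t) \<le> C" by auto
    define D where "D = max C 0"
    have D: "AE t in circ_measure. cmod (a t) \<le> D" "D \<ge> 0" using C by (auto simp: D_def elim: eventually_mono)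
    show "\<exists>C\<ge>0. \<forall>f\<in>{x. circ_eq x x}.
             integrable circ_measure (\<lambda>t. cmod (f t) powr p) \<longrightarrow>
             integrable circ_measure (\<lambda>t. cmod (a t * f t) powr p) \<and>
             (LINT t|circ_measure. cmod (a t * f t) powr p) \<le> C powr p * (LINT t|circ_measure. cmod (f t) powr p)"
    proof (intro exI[of _ D] conjI ballI impI D)
      fix f :: "complex \<Rightarrow> complex" assume "f \<in> {x. circ_eq x x}"
      and i: "integrable circ_measure (\<lambda>t. cmod (f t) powr p)"
      hence [measurable]: "f \<in> borel_measurable borel" by simp
      have pw: "AE t in circ_measure. cmod (a t * f t) powr p \<le> D powr p * cmod (f t) powr p"
        using D(1)
      proof eventually_elim
        case (elim t)
        have "cmod (a t * f t) powr p \<le> (D * cmod (f t)) powr p"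
          using elim p by (intro powr_mono2) (auto simp: norm_mult mult_right_mono)
        thus ?case using D(2) by (simp add: powr_mult)
      qed
      have i2: "integrable circ_measure (\<lambda>t. D powr p * cmod (f t) powr p)" using i by simp
      show 1: "integrable circ_measure (\<lambda>t. cmod (a t * f t) powr p)"
        by (rule Bochner_Integration.integrable_bound[OF i2]) (use pw in auto)
      show "(LINT t|circ_measure. cmod (a t * f t) powr p) \<le> D powr p * (LINT t|circ_measure. cmod (f t) powr p)"
        using integral_mono_AE[OF 1 i2 pw] by simp
    qed
  qed
  then obtain C where C: "C \<ge> 0" "\<And>f. in_Lp p f \<Longrightarrow> in_Lp p (a * f) \<and> Lp_int p (a * f) \<le> C powr p * Lp_int p f"
    by blast
  show ?thesis
  proof (rule that[OF C(1)], intro conjI)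
    fix f assume f: "f \<in> Lp p"
    show "a * f \<in> Lp p" using C(2)[of f] f by (simp add: LpD)
    have "Lp_int p (a * f) powr (1 / p) \<le> (C powr p * Lp_int p f) powr (1 / p)"
      using C(2)[of f] f p by (intro powr_mono2) (auto simp: LpD)
    thus "Lp_norm p (a * f) \<le> C * Lp_norm p f"
      using p C(1) by (simp add: Lp_norm_Lp_int powr_mult powr_powr)
  qed
qed

lemma Lp_mult_Linf: "a \<in> Linf \<Longrightarrow> p > 0 \<Longrightarrow> f \<in> Lp p \<Longrightarrow> a * f \<in> Lp p"
  using Lp_mult_Linf_bound[of a p] by metis

lemma one_Lp [simp]: "1 \<in> Lp p"
  unfolding LpD by transfer simp

lemma Lp_norm_one: "Lp_norm p 1 = 1"
  by transfer (simp add: circ.prob_space[simplified])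

lemma Linf_Lp: "p > 0 \<Longrightarrow> f \<in> Linf \<Longrightarrow> f \<in> Lp p"
  using Lp_mult_Linf[of f p 1] by simp

lemma tpow_Lp [simp]: "p > 0 \<Longrightarrow> tpow n \<in> Lp p"
  by (simp add: Linf_Lp)

lemma Lp_norm_1_le:
  assumes "1 < p" "f \<in> Lp p"
  shows "f \<in> Lp 1" "Lp_norm 1 f \<le> Lp_norm p f"
  using Holder_Lp_int[of p f 1] assms by (auto simp: Lp_norm_one)

lemma Lp_tpow_mult: "p > 0 \<Longrightarrow> f \<in> Lp p \<Longrightarrow> tpow n * f \<in> Lp p"
  by (simp add: Lp_mult_Linf)

section \<open>The reflection of the circle and the operator \<open>flip\<close>\<close>

lemma reflect_mult: "reflect (f * g) = reflect f * reflect g"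
  and reflect_add: "reflect (f + g) = reflect f + reflect g"
  and reflect_uminus: "reflect (- f) = - reflect f"
  and reflect_one [simp]: "reflect 1 = 1"
  and reflect_zero [simp]: "reflect 0 = 0"
  and reflect_cscale: "reflect (cscale z f) = cscale z (reflect f)"
  and reflect_reflect [simp]: "reflect (reflect f) = f"
  by (transfer, auto)+

lemma reflect_tpow: "reflect (tpow n) = tpow (- n)"
  by transfer (use AE_circ_nonzero in \<open>auto simp: circ_eq_def power_int_minus power_int_divide_distrib field_simps\<close>)

text \<open>On the circle \<open>cnj t = 1 / t\<close>, so the conjugations in the definition become
  a power and a reflection; all further rules for \<open>flip\<close> come from this form.\<close>

lemma flip_eq: "flip f = tpow (- 1) * reflect f"
proof transfer
  fix f :: "complex \<Rightarrow> complex" assume "circ_eq f f"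
  hence [measurable]: "f \<in> borel_measurable borel" by simp
  have "AE t in circ_measure. cnj t * f (cnj t) = t powi (- 1) * f (1 / t)"
    using AE_circ_inverse
    by eventually_elim (simp add: power_int_minus divide_inverse)
  thus "circ_eq (\<lambda>t. cnj t * f (cnj t)) (\<lambda>t. t powi - 1 * f (1 / t))"
    unfolding circ_eq_def by (intro conjI) measurable
qed

lemma flip_flip [simp]: "flip (flip f) = f"
  by (simp add: flip_eq reflect_mult reflect_tpow mult.assoc[symmetric])

lemma flip_mult: "flip (a * f) = reflect a * flip f"
  by (simp add: flip_eq reflect_mult ac_simps)

lemma flip_add: "flip (f + g) = flip f + flip g"
  by (simp add: flip_eq reflect_add algebra_simps)

lemma flip_0 [simp]: "flip 0 = 0"
  by (simp add: flip_eq)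

lemma reflect_Lp: "f \<in> Lp p \<Longrightarrow> reflect f \<in> Lp p"
  unfolding LpD
proof (transfer fixing: p)
  fix f :: "complex \<Rightarrow> complex" assume "circ_eq f f" and i: "integrable circ_measure (\<lambda>t. cmod (f t) powr p)"
  hence [measurable]: "f \<in> borel_measurable borel" by simp
  have "integrable circ_measure (\<lambda>t. cmod (f (1 / t)) powr p) \<longleftrightarrow> integrable circ_measure (\<lambda>t. cmod (f (cnj t)) powr p)"
    by (rule integrable_cong_AE) (use AE_circ_inverse in auto)
  thus "integrable circ_measure (\<lambda>t. cmod (f (1 / t)) powr p)"
    using i by (simp add: integrable_circ_reflect[where f = "\<lambda>t. cmod (f t) powr p"])
qed

lemma fourier_reflect: "fourier (reflect f) n = fourier f (- n)"
proof (transfer fixing: n)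
  fix f :: "complex \<Rightarrow> complex" assume "circ_eq f f"
  hence [measurable]: "f \<in> borel_measurable borel" by simp
  have "(LINT t|circ_measure. f (1 / t) * t powi - n) = (LINT t|circ_measure. f (cnj t) * (cnj t) powi n)"
  proof (rule integral_cong_AE)
    show "AE t in circ_measure. f (1 / t) * t powi - n = f (cnj t) * (cnj t) powi n"
      using AE_circ_inverse
      by eventually_elim (simp add: power_int_minus power_int_inverse[symmetric] divide_inverse)
    show "(\<lambda>t. f (cnj t) * (cnj t) powi n) \<in> borel_measurable circ_measure"
      using measurable_compose[OF borel_measurable_cnj borel_measurable_mult_powi[of f n]] by simp
  qed measurable
  also have "\<dots> = (LINT t|circ_measure. f t * t powi - (- n))"
    using integral_circ_reflect[of "\<lambda>t. f t * t powi n"] by simp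
  finally show "(LINT t|circ_measure. f (1 / t) * t powi - n) = (LINT t|circ_measure. f t * t powi - (- n))" .
qed

lemma flip_Lp: "p > 0 \<Longrightarrow> f \<in> Lp p \<Longrightarrow> flip f \<in> Lp p"
  by (simp add: flip_eq Lp_tpow_mult reflect_Lp)

text \<open>\<open>flip\<close> exchanges the indices \<open>n \<ge> 0\<close> with the indices
  \<open>n < 0\<close>; the shift by one makes this a bijection between analytic functions and
  functions without analytic part.\<close>

lemma fourier_flip: "fourier (flip f) n = fourier f (- n - 1)"
proof -
  have "- (n - - 1) = - n - 1" by simp
  thus ?thesis by (simp only: flip_eq fourier_tpow_mult fourier_reflect)
qed

text \<open>A product equal to 1 forces \<open>f\<close> to be nonzero almost everywhere, where the
  totalised inverse is the true one.\<close>

lemma inverse_eqI: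
  fixes f g :: circ_fun
  assumes "f * g = 1"
  shows "inverse f = g"
  using assms
proof transfer
  fix f g :: "complex \<Rightarrow> complex"
  assume fg: "circ_eq f f" "circ_eq g g" "circ_eq (\<lambda>t. f t * g t) (\<lambda>_. 1)"
  hence "AE t in circ_measure. f t * g t = 1" by (simp add: circ_eq_def)
  hence "AE t in circ_measure. inverse (f t) = g t"
    by eventually_elim (rule inverse_unique)
  thus "circ_eq (\<lambda>t. inverse (f t)) g" using fg by (simp add: circ_eq_def)
qed

text \<open>Fatou's lemma carries a uniform norm bound to the limit and yields membership along with
  it. \<open>Lp_complete\<close> applies this to the differences \<open>f (r k) - f (r j)\<close> as
  \<open>j\<close> grows.\<close>

lemma Lp_Fatou:
  fixes f :: "nat \<Rightarrow> complex \<Rightarrow> complex"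
  assumes p: "p > 0" and [measurable]: "\<And>n. f n \<in> borel_measurable borel" "g \<in> borel_measurable borel"
    and lim: "AE t in circ_measure. (\<lambda>n. f n t) \<longlonglongrightarrow> g t"
    and f: "\<forall>\<^sub>F n in sequentially. abs_circ_fun (f n) \<in> Lp p \<and> Lp_norm p (abs_circ_fun (f n)) \<le> C"
  shows "abs_circ_fun g \<in> Lp p" "Lp_norm p (abs_circ_fun g) \<le> C"
proof -
  have C: "C \<ge> 0"
  proof -
    obtain n where "Lp_norm p (abs_circ_fun (f n)) \<le> C"
      using f by (auto simp: eventually_sequentially)
    thus ?thesis using Lp_norm_nonneg order_trans by blast
  qed
  have "(\<integral>\<^sup>+ t. ennreal (cmod (g t) powr p) \<partial>circ_measure) = (\<integral>\<^sup>+ t. liminf (\<lambda>n. ennreal (cmod (f n t) powr p)) \<partial>circ_measure)"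
  proof (rule nn_integral_cong_AE)
    show "AE t in circ_measure. ennreal (cmod (g t) powr p) = liminf (\<lambda>n. ennreal (cmod (f n t) powr p))"
      using lim
    proof eventually_elim
      case (elim t)
      have "(\<lambda>n. ennreal (cmod (f n t) powr p)) \<longlonglongrightarrow> ennreal (cmod (g t) powr p)"
        using p by (intro tendsto_ennrealI tendsto_powr' tendsto_norm elim tendsto_const) auto
      thus ?case by (rule lim_imp_Liminf[OF trivial_limit_sequentially, symmetric])
    qed
  qed
  also have "\<dots> \<le> liminf (\<lambda>n. \<integral>\<^sup>+ t. ennreal (cmod (f n t) powr p) \<partial>circ_measure)"
    by (rule nn_integral_liminf) measurable
  also have "\<dots> \<le> ennreal (C powr p)"
  proof (rule Liminf_le)
    show "\<forall>\<^sub>F n in sequentially. (\<integral>\<^sup>+ t. ennreal (cmod (f n t) powr p) \<partial>circ_measure) \<le> ennreal (C powr p)"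
      using f
    proof eventually_elim
      case (elim n)
      hence i: "integrable circ_measure (\<lambda>t. cmod (f n t) powr p)" by (simp add: LpD in_Lp.abs_eq)
      have "(\<integral>\<^sup>+ t. ennreal (cmod (f n t) powr p) \<partial>circ_measure) = ennreal (Lp_int p (abs_circ_fun (f n)))"
        using i by (simp add: nn_integral_eq_integral Lp_int.abs_eq)
      also have "\<dots> \<le> ennreal (C powr p)"
        using elim p by (intro ennreal_leI) (auto simp: Lp_int_Lp_norm intro!: powr_mono2)
      finally show ?case .
    qed
  qed simp
  finally have *: "(\<integral>\<^sup>+ t. ennreal (cmod (g t) powr p) \<partial>circ_measure) \<le> ennreal (C powr p)" .
  have i: "integrable circ_measure (\<lambda>t. cmod (g t) powr p)"
    by (rule integrableI_bounded) (use * in \<open>auto simp: top.not_eq_extremum intro: le_less_trans\<close>)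
  thus g: "abs_circ_fun g \<in> Lp p" by (simp add: LpD in_Lp.abs_eq)
  have "Lp_int p (abs_circ_fun g) \<le> C powr p"
    using * i by (subst (asm) nn_integral_eq_integral) (auto simp: Lp_int.abs_eq ennreal_le_iff)
  hence "Lp_int p (abs_circ_fun g) powr (1 / p) \<le> (C powr p) powr (1 / p)"
    using p by (intro powr_mono2) auto
  thus "Lp_norm p (abs_circ_fun g) \<le> C"
    using p C by (simp add: Lp_norm_Lp_int powr_powr)
qed

text \<open>Riesz-Fischer: along a subsequence whose steps are below \<open>(1/2) ^ k\<close>, the
  sum of the absolute differences has a finite integral, so the subsequence converges almost
  everywhere.\<close>

lemma Lp_complete:
  assumes p: "1 < p" and u: "\<And>n. u n \<in> Lp p"
    and cauchy: "\<And>e. e > 0 \<Longrightarrow> \<exists>N. \<forall>m\<ge>N. \<forall>n\<ge>N. Lp_norm p (u m - u n) < e"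
  obtains g where "g \<in> Lp p" "(\<lambda>n. Lp_norm p (u n - g)) \<longlonglongrightarrow> 0"
proof -
  have "\<exists>f. \<forall>n. f n \<in> borel_measurable borel \<and> u n = abs_circ_fun (f n)"
    by (rule choice) (metis circ_fun_cases)
  then obtain f where f [measurable]: "\<And>n. f n \<in> borel_measurable borel" and uf: "\<And>n. u n = abs_circ_fun (f n)"
    by blast
  define N where "N e = (SOME N. \<forall>m\<ge>N. \<forall>n\<ge>N. Lp_norm p (u m - u n) < e)" for e :: real
  have N: "Lp_norm p (u m - u n) < e" if "m \<ge> N e" "n \<ge> N e" "e > 0" for m n e
    using someI_ex[OF cauchy[OF \<open>e > 0\<close>]] that unfolding N_def by blast
  \<comment> \<open>Summing the thresholds makes \<open>r k\<close> at least
    \<open>N ((1/2) ^ i)\<close> for every \<open>i \<le> k\<close>, so that one index serves all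
    these tolerances.\<close>
  define r where "r k = (\<Sum>i\<le>k. N ((1/2) ^ i) )" for k
  have r: "r k \<ge> N ((1/2) ^ i)" if "i \<le> k" for i k
    unfolding r_def using member_le_sum[of i "{..k}" "\<lambda>i. N ((1/2)^i)"] that by auto
  have diff: "abs_circ_fun (\<lambda>t. f m t - f n t) = u m - u n" for m n
    by (simp add: uf minus_circ_fun.abs_eq)
  have step: "Lp_norm p (u (r k) - u (r j)) < (1/2) ^ i" if "i \<le> k" "i \<le> j" for i j k
    using that r by (intro N) auto
  have "(\<integral>\<^sup>+ t. (\<Sum>k. ennreal (cmod (f (r (Suc k)) t - f (r k) t))) \<partial>circ_measure) =
        (\<Sum>k. \<integral>\<^sup>+ t. ennreal (cmod (f (r (Suc k)) t - f (r k) t)) \<partial>circ_measure)"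
    by (rule nn_integral_suminf) measurable
  also have "\<dots> \<le> (\<Sum>k. ennreal ((1/2) ^ k))"
  proof (rule suminf_le)
    fix k
    have L1: "u (r (Suc k)) - u (r k) \<in> Lp 1" "Lp_norm 1 (u (r (Suc k)) - u (r k)) \<le> Lp_norm p (u (r (Suc k)) - u (r k))"
      using Lp_norm_1_le[OF p, of "u (r (Suc k)) - u (r k)"] p u by (simp_all add: Lp_diff)
    have i: "integrable circ_measure (\<lambda>t. f (r (Suc k)) t - f (r k) t)"
      using L1(1) by (simp add: diff[symmetric] LpD in_Lp_1)
    have "(\<integral>\<^sup>+ t. ennreal (cmod (f (r (Suc k)) t - f (r k) t)) \<partial>circ_measure) = ennreal (Lp_norm 1 (u (r (Suc k)) - u (r k)))"
      using i by (simp add: diff[symmetric] Lp_norm.abs_eq nn_integral_eq_integral)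
    also have "\<dots> \<le> ennreal ((1/2) ^ k)"
      using L1(2) step[of k "Suc k" k] by (intro ennreal_leI) auto
    finally show "(\<integral>\<^sup>+ t. ennreal (cmod (f (r (Suc k)) t - f (r k) t)) \<partial>circ_measure) \<le> ennreal ((1/2) ^ k)" .
  qed auto
  also have "\<dots> < \<infinity>"
    by (subst suminf_ennreal_eq[where x = 2]) (use power_half_series geometric_sums[of "1/2::real"] in auto)
  finally have "(\<integral>\<^sup>+ t. (\<Sum>k. ennreal (cmod (f (r (Suc k)) t - f (r k) t))) \<partial>circ_measure) \<noteq> \<infinity>" by simp
  hence "AE t in circ_measure. (\<Sum>k. ennreal (cmod (f (r (Suc k)) t - f (r k) t))) \<noteq> \<infinity>"
    by (intro nn_integral_PInf_AE) measurable
  hence conv: "AE t in circ_measure. convergent (\<lambda>k. f (r k) t)"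
  proof eventually_elim
    case (elim t)
    have "summable (\<lambda>k. f (r (Suc k)) t - f (r k) t)"
      by (rule summable_norm_cancel, rule summable_suminf_not_top) (use elim in auto)
    hence "convergent (\<lambda>n. \<Sum>k<n. f (r (Suc k)) t - f (r k) t)"
      by (simp add: summable_iff_convergent)
    hence "convergent (\<lambda>n. (f (r n) t - f (r 0) t) + f (r 0) t)"
      using sum_lessThan_telescope[of "\<lambda>k. f (r k) t"] by (intro convergent_add convergent_const) simp
    thus ?case by simp
  qed
  \<comment> \<open>Where the subsequence diverges \<open>lim\<close> is unspecified; this happens
    on a null set only.\<close>
  define g where "g t = lim (\<lambda>k. f (r k) t)" for t
  have g [measurable]: "g \<in> borel_measurable borel"
    unfolding g_def by (rule borel_measurable_lim_metric) measurable
  have lim: "AE t in circ_measure. (\<lambda>k. f (r k) t) \<longlonglongrightarrow> g t"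
    using conv by eventually_elim (simp add: g_def convergent_LIMSEQ_iff)
  have G: "abs_circ_fun (\<lambda>t. f (r k) t - g t) \<in> Lp p \<and> Lp_norm p (abs_circ_fun (\<lambda>t. f (r k) t - g t)) \<le> (1/2) ^ k" for k
  proof (intro conjI)
    have p0: "p > 0" using p by simp
    have meas: "(\<lambda>t. f (r k) t - f (r j) t) \<in> borel_measurable borel"
      "(\<lambda>t. f (r k) t - g t) \<in> borel_measurable borel" for j
      by measurable
    have AE: "AE t in circ_measure. (\<lambda>j. f (r k) t - f (r j) t) \<longlonglongrightarrow> f (r k) t - g t"
      using lim by eventually_elim (intro tendsto_intros)
    have ev: "\<forall>\<^sub>F j in sequentially. abs_circ_fun (\<lambda>t. f (r k) t - f (r j) t) \<in> Lp p \<and>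
        Lp_norm p (abs_circ_fun (\<lambda>t. f (r k) t - f (r j) t)) \<le> (1/2) ^ k"
      unfolding diff using eventually_ge_at_top[of k]
      by eventually_elim (use step[of k k] p u in \<open>auto intro!: Lp_diff less_imp_le\<close>)
    show "abs_circ_fun (\<lambda>t. f (r k) t - g t) \<in> Lp p"
      by (rule Lp_Fatou[OF p0 meas AE ev])
    show "Lp_norm p (abs_circ_fun (\<lambda>t. f (r k) t - g t)) \<le> (1/2) ^ k"
      by (rule Lp_Fatou[OF p0 meas AE ev])
  qed
  have G': "u (r k) - abs_circ_fun g \<in> Lp p" "Lp_norm p (u (r k) - abs_circ_fun g) \<le> (1/2) ^ k" for k
    using G[of k] by (simp_all add: uf minus_circ_fun.abs_eq)
  have gL: "abs_circ_fun g \<in> Lp p"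
    using Lp_diff[OF _ u[of "r 0"] G'(1)[of 0]] p by simp
  show ?thesis
  proof (rule that[OF gL], rule LIMSEQ_I)
    fix e :: real assume e: "e > 0"
    then obtain k where k: "(1/2) ^ k < e / 2"
      using real_arch_pow_inv[of "e/2" "1/2"] by auto
    show "\<exists>n0. \<forall>n\<ge>n0. norm (Lp_norm p (u n - abs_circ_fun g) - 0) < e"
    proof (intro exI allI impI)
      fix n assume n: "n \<ge> N ((1/2) ^ k)"
      have "Lp_norm p (u n - abs_circ_fun g) \<le> Lp_norm p (u n - u (r k)) + Lp_norm p (u (r k) - abs_circ_fun g)"
        using p u gL by (intro Lp_norm_triangle_mid) auto
      also have "\<dots> < (1/2) ^ k + (1/2) ^ k"
        using n r[of k k] by (intro add_less_le_mono N G') auto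
      also have "\<dots> < e" using k by simp
      finally show "norm (Lp_norm p (u n - abs_circ_fun g) - 0) < e" by simp
    qed
  qed
qed

section \<open>Nearest points and separation in Lebesgue spaces\<close>

text \<open>The mean value theorem on each half of the interval compares two values of the
  derivative \<open>p * z powr (p - 1)\<close>, which increases strictly because
  \<open>p > 1\<close>.\<close>

lemma powr_midpoint_strict:
  fixes x y p :: real
  assumes "0 \<le> x" "x < y" "1 < p"
  shows "((x + y) / 2) powr p < (x powr p + y powr p) / 2"
proof -
  define m where "m = (x + y) / 2"
  have m: "x < m" "m < y" "m > 0" using assms by (auto simp: m_def)
  have mvt: "\<exists>z. a < z \<and> z < b \<and> b powr p - a powr p = (b - a) * (p * z powr (p - 1))" if "0 \<le> a" "a < b" for a b :: real
  proof -
    have "continuous_on {a..b} (\<lambda>x. x powr p)"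
      using that assms by (intro continuous_on_powr' continuous_intros) auto
    moreover have der: "((\<lambda>x. x powr p) has_real_derivative p * z powr (p - 1)) (at z)" if "a < z" for z
      using that \<open>0 \<le> a\<close> by (intro has_real_derivative_powr) auto
    moreover have "(\<lambda>x. x powr p) differentiable at z" if "a < z" "z < b" for z
      unfolding real_differentiable_def using der[OF that(1)] by blast
    ultimately obtain l z where z: "a < z" "z < b" "((\<lambda>x. x powr p) has_real_derivative l) (at z)" "b powr p - a powr p = (b - a) * l"
      using MVT[of a b "\<lambda>x. x powr p"] \<open>a < b\<close> by blast
    have "l = p * z powr (p - 1)"
      by (rule DERIV_unique[OF z(3) der[OF z(1)]])
    thus ?thesis using z by blast
  qed
  obtain z1 where z1: "x < z1" "z1 < m" "m powr p - x powr p = (m - x) * (p * z1 powr (p - 1))"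
    using mvt[of x m] m assms by auto
  obtain z2 where z2: "m < z2" "z2 < y" "y powr p - m powr p = (y - m) * (p * z2 powr (p - 1))"
    using mvt[of m y] m assms by auto
  have "z1 powr (p - 1) < z2 powr (p - 1)"
    using z1 z2 assms by (intro powr_less_mono2) auto
  hence "(m - x) * (p * z1 powr (p - 1)) < (m - x) * (p * z2 powr (p - 1))"
    using m assms by auto
  moreover have "m - x = y - m" by (simp add: m_def field_simps)
  ultimately have "m powr p - x powr p < y powr p - m powr p" unfolding z1(3) z2(3) by (simp only:)
  thus ?thesis by (simp add: m_def)
qed

lemma powr_midpoint_le:
  fixes x y p :: real
  assumes "0 \<le> x" "0 \<le> y" "1 < p"
  shows "((x + y) / 2) powr p \<le> (x powr p + y powr p) / 2"
proof (cases x y rule: linorder_cases)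
  case less
  thus ?thesis using powr_midpoint_strict[of x y p] assms by linarith
next
  case greater
  have "((y + x) / 2) powr p \<le> (y powr p + x powr p) / 2"
    using powr_midpoint_strict[of y x p] assms greater by linarith
  thus ?thesis by (simp only: add.commute)
qed simp

lemma norm_powr_midpoint_le:
  fixes a b :: complex
  assumes "1 < p"
  shows "norm ((a + b) / 2) powr p \<le> (norm a powr p + norm b powr p) / 2"
proof -
  have "norm ((a + b) / 2) powr p \<le> ((norm a + norm b) / 2) powr p"
    using norm_triangle_ineq[of a b] assms by (intro powr_mono2) (auto simp: norm_divide)
  also have "\<dots> \<le> (norm a powr p + norm b powr p) / 2"
    using assms by (intro powr_midpoint_le) auto
  finally show ?thesis .
qed

text \<open>Strictness has two sources: if the moduli differ it comes from the power, and if they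
  agree it comes from the triangle inequality, where equality would force
  \<open>a = b\<close>.\<close>

lemma norm_powr_midpoint_strict:
  fixes a b :: complex
  assumes "1 < p" "a \<noteq> b"
  shows "norm ((a + b) / 2) powr p < (norm a powr p + norm b powr p) / 2"
proof (cases "norm a = norm b")
  case False
  have "norm ((a + b) / 2) powr p \<le> ((norm a + norm b) / 2) powr p"
    using norm_triangle_ineq[of a b] assms by (intro powr_mono2) (auto simp: norm_divide)
  also have "\<dots> < (norm a powr p + norm b powr p) / 2"
  proof (cases "norm a < norm b")
    case True
    thus ?thesis using powr_midpoint_strict[of "norm a" "norm b" p] assms by simp
  next
    case lt: False
    have "((norm b + norm a) / 2) powr p < (norm b powr p + norm a powr p) / 2"
      using powr_midpoint_strict[of "norm b" "norm a" p] assms lt False by simp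
    thus ?thesis by (simp only: add.commute)
  qed
  finally show ?thesis .
next
  case True
  have "norm (a + b) \<noteq> norm a + norm b"
  proof
    assume "norm (a + b) = norm a + norm b"
    hence "norm a *\<^sub>R b = norm b *\<^sub>R a" by (simp add: norm_triangle_eq)
    hence "norm a = 0 \<or> b = a" by (auto simp only: True[symmetric] scaleR_cancel_left)
    thus False using True assms by auto
  qed
  hence "norm (a + b) < norm a + norm b" using norm_triangle_ineq[of a b] by simp
  hence "norm ((a + b) / 2) powr p < norm a powr p"
    using True assms by (intro powr_less_mono2) (simp_all add: norm_divide)
  thus ?thesis using True by simp
qed

text \<open>A quantitative form of the uniform convexity of \<open>L\<^sup>p\<close>: by homogeneity and compactness, it
  follows from the strict convexity of \<open>z \<mapsto> \<bar>z\<bar>\<^sup>p\<close>.\<close>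

lemma uniform_convexity_pointwise:
  fixes p e :: real
  assumes p: "1 < p" and e: "0 < e"
  obtains C where "C \<ge> 0" "\<And>a b :: complex. norm (a - b) powr p \<le>
      e * (norm a powr p + norm b powr p) +
      C * ((norm a powr p + norm b powr p) / 2 - norm ((a + b) / 2) powr p)"
proof -
  define S where "S = (\<lambda>z :: complex \<times> complex. norm (fst z) powr p + norm (snd z) powr p)"
  define D where "D = (\<lambda>z :: complex \<times> complex. S z / 2 - norm ((fst z + snd z) / 2) powr p)"
  define E where "E = (\<lambda>z :: complex \<times> complex. norm (fst z - snd z) powr p)"
  have cont: "continuous_on UNIV S" "continuous_on UNIV D" "continuous_on UNIV E"
  proof -
    have c: "continuous_on UNIV (\<lambda>z. norm (h z) powr p)"
      if "continuous_on UNIV h" for h :: "complex \<times> complex \<Rightarrow> complex"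
      using p that by (intro continuous_on_powr' continuous_on_norm continuous_on_const) auto
    show 1: "continuous_on UNIV S"
      unfolding S_def by (intro continuous_on_add c continuous_on_fst continuous_on_snd continuous_on_id)
    show "continuous_on UNIV D"
      unfolding D_def
      by (intro continuous_on_diff continuous_on_divide 1 c continuous_on_add continuous_on_fst
          continuous_on_snd continuous_on_id continuous_on_const) auto
    show "continuous_on UNIV E"
      unfolding E_def by (intro c continuous_on_diff continuous_on_fst continuous_on_snd continuous_on_id)
  qed
  \<comment> \<open>Normalised pairs whose difference stays away from zero. On this compact set the
    convexity deficit \<open>D\<close> is positive, so it has a positive lower bound
    \<open>d\<close>.\<close>
  define K where "K = {z. S z = 1} \<inter> {z. E z \<ge> e}"
  have "closed K"
    unfolding K_def by (intro closed_Int closed_Collect_eq closed_Collect_le cont continuous_on_const)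
  moreover have "K \<subseteq> cball 0 1 \<times> cball 0 1"
  proof
    fix z assume "z \<in> K"
    hence z: "norm (fst z) powr p + norm (snd z) powr p = 1" by (auto simp: K_def S_def)
    have "x \<le> 1" if "x powr p \<le> 1" "x \<ge> 0" for x :: real
      using that powr_less_mono2[of p 1 x] p by (smt (verit) powr_one_eq_one)
    moreover have "norm (fst z) powr p \<le> 1" "norm (snd z) powr p \<le> 1"
      using z powr_ge_zero[of "norm (fst z)" p] powr_ge_zero[of "norm (snd z)" p] by linarith+
    ultimately show "z \<in> cball 0 1 \<times> cball 0 1" by (cases z) auto
  qed
  ultimately have "compact K"
    by (metis compact_Times compact_cball compact_Int_closed inf.absorb_iff2)
  have Dpos: "D z > 0" if "z \<in> K" for z
  proof -
    have "fst z \<noteq> snd z" using that e p by (auto simp: K_def E_def)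
    from norm_powr_midpoint_strict[OF p this] show ?thesis by (simp add: D_def S_def)
  qed
  have "\<exists>d>0. \<forall>z\<in>K. d \<le> D z"
  proof (cases "K = {}")
    case True thus ?thesis by (auto intro: exI[of _ 1])
  next
    case False
    obtain z0 where "z0 \<in> K" "\<forall>z\<in>K. D z0 \<le> D z"
      using continuous_attains_inf[OF \<open>compact K\<close> False continuous_on_subset[OF cont(2)]] by auto
    thus ?thesis using Dpos by blast
  qed
  then obtain d where d: "d > 0" "\<And>z. z \<in> K \<Longrightarrow> d \<le> D z" by blast
  \<comment> \<open>By \<open>powr_add_le\<close>, \<open>E\<close> is at most
    \<open>2 powr p * S\<close>, and on normalised pairs the deficit is at least \<open>d\<close>;
    the quotient settles all pairs with \<open>E z > e * S z\<close>.\<close>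
  define C where "C = 2 powr p / d"
  have scale: "S (of_real r * fst z, of_real r * snd z) = r powr p * S z"
    "D (of_real r * fst z, of_real r * snd z) = r powr p * D z"
    "E (of_real r * fst z, of_real r * snd z) = r powr p * E z" if "r \<ge> 0" for r z
  proof -
    show 1: "S (of_real r * fst z, of_real r * snd z) = r powr p * S z"
      using that by (simp add: S_def norm_mult powr_mult distrib_left)
    have "of_real r * fst z + of_real r * snd z = of_real r * (fst z + snd z)" by (simp add: algebra_simps)
    thus "D (of_real r * fst z, of_real r * snd z) = r powr p * D z"
      using that unfolding D_def 1 by (simp add: norm_mult norm_divide powr_mult powr_divide right_diff_distrib)
    have "of_real r * fst z - of_real r * snd z = of_real r * (fst z - snd z)" by (simp add: algebra_simps)
    thus "E (of_real r * fst z, of_real r * snd z) = r powr p * E z"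
      using that unfolding E_def by (simp add: norm_mult powr_mult)
  qed
  have main: "E z \<le> e * S z + C * D z" for z
  proof -
    have D0: "D z \<ge> 0" using norm_powr_midpoint_le[OF p, of "fst z" "snd z"] by (simp add: D_def S_def)
    have C0: "C > 0" using d by (simp add: C_def)
    have S0: "S z \<ge> 0" by (simp add: S_def)
    show ?thesis
    proof (cases "E z \<le> e * S z")
      case True thus ?thesis using D0 C0 by (simp add: add_increasing2)
    next
      case False
      have "S z \<noteq> 0"
      proof
        assume "S z = 0"
        hence "norm (fst z) powr p = 0" "norm (snd z) powr p = 0"
          using powr_ge_zero[of "norm (fst z)" p] powr_ge_zero[of "norm (snd z)" p] unfolding S_def by linarith+
        hence "E z = 0" by (simp add: E_def)
        thus False using False \<open>S z = 0\<close> by simp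
      qed
      hence S: "S z > 0" using S0 by simp
      \<comment> \<open>Rescales the pair to \<open>S = 1\<close>; \<open>S\<close>,
        \<open>D\<close> and \<open>E\<close> are all homogeneous of degree
        \<open>p\<close>.\<close>
      define r where "r = S z powr (- 1 / p)"
      have rp: "r powr p = 1 / S z" "r \<ge> 0"
      proof -
        have "r powr p = S z powr (- 1 / p * p)" unfolding r_def by (rule powr_powr)
        also have "- 1 / p * p = - 1" using p by simp
        finally show "r powr p = 1 / S z" using S by (simp add: powr_minus_divide)
        show "r \<ge> 0" by (simp add: r_def)
      qed
      have "(of_real r * fst z, of_real r * snd z) \<in> K"
      proof -
        have "e \<le> 1 / S z * E z" using False S by (simp add: field_simps)
        thus ?thesis using S by (simp add: K_def scale[OF rp(2), of z] rp(1))
      qed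
      from d(2)[OF this] have "S z * d \<le> D z"
        using S unfolding scale(2)[OF rp(2), of z] rp(1) by (simp add: field_simps)
      hence "2 powr p * S z \<le> C * D z"
        using d by (simp add: C_def field_simps)
      moreover have "E z \<le> 2 powr p * S z"
      proof -
        have "E z \<le> (norm (fst z) + norm (snd z)) powr p"
          unfolding E_def using p by (intro powr_mono2 norm_triangle_ineq4) auto
        also have "\<dots> \<le> 2 powr p * S z"
          unfolding S_def using p by (intro powr_add_le) auto
        finally show ?thesis .
      qed
      ultimately show ?thesis using e S by (simp add: add_increasing)
    qed
  qed
  show ?thesis
  proof (rule that[of C])
    show "C \<ge> 0" using d by (simp add: C_def)
    fix a b :: complex
    show "norm (a - b) powr p \<le>
      e * (norm a powr p + norm b powr p) +
      C * ((norm a powr p + norm b powr p) / 2 - norm ((a + b) / 2) powr p)"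
      using main[of "(a, b)"] by (simp add: E_def S_def D_def)
  qed
qed

lemma uniform_convexity_Lp:
  assumes p: "1 < p" and e: "0 < e"
  obtains C where "C \<ge> 0" "\<And>f g. f \<in> Lp p \<Longrightarrow> g \<in> Lp p \<Longrightarrow> Lp_int p (f - g) \<le>
      e * (Lp_int p f + Lp_int p g) +
      C * ((Lp_int p f + Lp_int p g) / 2 - Lp_int p (cscale (1/2) (f + g)))"
proof -
  obtain C where C: "C \<ge> 0" "\<And>a b :: complex. norm (a - b) powr p \<le>
      e * (norm a powr p + norm b powr p) +
      C * ((norm a powr p + norm b powr p) / 2 - norm ((a + b) / 2) powr p)"
    using uniform_convexity_pointwise[OF assms] by blast
  show ?thesis
  proof (rule that[OF C(1)])
    fix f g assume f: "f \<in> Lp p" and g: "g \<in> Lp p"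
    have "in_Lp p (f - g)" "in_Lp p (cscale (1/2) (f + g))"
      using f g p Lp_diff[of p f g] Lp_cscale[OF Lp_add[of p f g], of "1/2"] by (simp_all add: LpD)
    with f g show "Lp_int p (f - g) \<le>
      e * (Lp_int p f + Lp_int p g) +
      C * ((Lp_int p f + Lp_int p g) / 2 - Lp_int p (cscale (1/2) (f + g)))"
      unfolding LpD
    proof (transfer fixing: p e C)
      fix f g :: "complex \<Rightarrow> complex"
      assume "circ_eq f f" "circ_eq g g"
       and i: "integrable circ_measure (\<lambda>t. cmod (f t) powr p)" "integrable circ_measure (\<lambda>t. cmod (g t) powr p)"
       "integrable circ_measure (\<lambda>t. cmod (f t - g t) powr p)" "integrable circ_measure (\<lambda>t. cmod (1 / 2 * (f t + g t)) powr p)"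
      let ?B = "\<lambda>t. e * (cmod (f t) powr p + cmod (g t) powr p) + C * ((cmod (f t) powr p + cmod (g t) powr p) / 2 - cmod (1 / 2 * (f t + g t)) powr p)"
      have "(LINT t|circ_measure. cmod (f t - g t) powr p) \<le> (LINT t|circ_measure. ?B t)"
      proof (rule integral_mono[OF i(3)])
        show "integrable circ_measure ?B"
          by (intro Bochner_Integration.integrable_add Bochner_Integration.integrable_diff integrable_mult_right integrable_divide i)
        fix t
        have "1 / 2 * (f t + g t) = (f t + g t) / 2" by simp
        thus "cmod (f t - g t) powr p \<le> ?B t" using C(2)[of "f t" "g t"] by (simp only:)
      qed
      also have "\<dots> = e * ((LINT t|circ_measure. cmod (f t) powr p) + (LINT t|circ_measure. cmod (g t) powr p)) +
        C * (((LINT t|circ_measure. cmod (f t) powr p) + (LINT t|circ_measure. cmod (g t) powr p)) / 2 - (LINT t|circ_measure. cmod (1 / 2 * (f t + g t)) powr p))"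
      proof -
        have "(LINT t|circ_measure. e * (F t + G t) + C * ((F t + G t) / 2 - H t)) =
          e * (integral\<^sup>L circ_measure F + integral\<^sup>L circ_measure G) +
          C * ((integral\<^sup>L circ_measure F + integral\<^sup>L circ_measure G) / 2 - integral\<^sup>L circ_measure H)"
          if "integrable circ_measure F" "integrable circ_measure G" "integrable circ_measure H" for F G H :: "complex \<Rightarrow> real"
          using that by simp
        from this[OF i(1,2,4)] show ?thesis .
      qed
      finally show "(LINT t|circ_measure. cmod (f t - g t) powr p) \<le> e * ((LINT t|circ_measure. cmod (f t) powr p) + (LINT t|circ_measure. cmod (g t) powr p)) +
        C * (((LINT t|circ_measure. cmod (f t) powr p) + (LINT t|circ_measure. cmod (g t) powr p)) / 2 - (LINT t|circ_measure. cmod (1 / 2 * (f t + g t)) powr p))" .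
    qed
  qed
qed

definition closed_subspace :: "real \<Rightarrow> circ_fun set \<Rightarrow> bool" where
  "closed_subspace p Y \<longleftrightarrow> Y \<subseteq> Lp p \<and> cvs.subspace Y \<and>
     (\<forall>u g. (\<forall>n::nat. u n \<in> Y) \<and> g \<in> Lp p \<and> (\<lambda>n. Lp_norm p (u n - g)) \<longlonglongrightarrow> 0 \<longrightarrow> g \<in> Y)"

text \<open>A minimising sequence is Cauchy: the midpoint of two members is again in
  \<open>Y\<close>, so its distance from \<open>g\<close> cannot fall below the infimum. This leaves
  a small convexity deficit, and uniform convexity bounds the difference of the two members.\<close>

lemma nearest_point:
  assumes p: "1 < p" and Y: "closed_subspace p Y" and g: "g \<in> Lp p"
  obtains y0 where "y0 \<in> Y" "\<And>y. y \<in> Y \<Longrightarrow> Lp_int p (g - y0) \<le> Lp_int p (g - y)"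
proof -
  have YL: "Y \<subseteq> Lp p" and sub: "cvs.subspace Y"
    and cl: "\<And>u h. (\<And>n::nat. u n \<in> Y) \<Longrightarrow> h \<in> Lp p \<Longrightarrow> (\<lambda>n. Lp_norm p (u n - h)) \<longlonglongrightarrow> 0 \<Longrightarrow> h \<in> Y"
    using Y unfolding closed_subspace_def by blast+
  define m where "m = Inf ((\<lambda>y. Lp_int p (g - y)) ` Y)"
  have ne: "(\<lambda>y. Lp_int p (g - y)) ` Y \<noteq> {}" using cvs.subspace_0[OF sub] by auto
  have bdd: "bdd_below ((\<lambda>y. Lp_int p (g - y)) ` Y)" by (rule bdd_belowI[of _ 0]) auto
  have mle: "m \<le> Lp_int p (g - y)" if "y \<in> Y" for y
    unfolding m_def using that by (intro cInf_lower bdd) auto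
  have m0: "m \<ge> 0" unfolding m_def by (rule cInf_greatest[OF ne]) auto
  have "\<exists>y\<in>Y. Lp_int p (g - y) < m + 1 / Suc n" for n
    using cInf_lessD[OF ne, of "m + 1 / Suc n"] by (auto simp: m_def)
  then obtain u where u: "\<And>n. u n \<in> Y" "\<And>n. Lp_int p (g - u n) < m + 1 / Suc n"
    by metis
  have uL: "u n \<in> Lp p" for n using u YL by auto
  obtain h where h: "h \<in> Lp p" "(\<lambda>n. Lp_norm p (u n - h)) \<longlonglongrightarrow> 0"
  proof (rule Lp_complete[OF p uL])
    fix d :: real assume d: "d > 0"
    \<comment> \<open>Makes the first term of the convexity estimate at most
      \<open>d powr p / 2\<close>, as the two distances sum to at most \<open>2 * (m + 1)\<close>;
      the choice of \<open>N\<close> keeps the second term below the other half.\<close>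
    define e where "e = d powr p / (4 * (m + 1))"
    have e: "e > 0" using d m0 by (simp add: e_def)
    obtain C where C: "C \<ge> 0" "\<And>f g. f \<in> Lp p \<Longrightarrow> g \<in> Lp p \<Longrightarrow> Lp_int p (f - g) \<le>
      e * (Lp_int p f + Lp_int p g) + C * ((Lp_int p f + Lp_int p g) / 2 - Lp_int p (cscale (1/2) (f + g)))"
      using uniform_convexity_Lp[OF p e] by blast
    obtain N where N: "2 * C / d powr p < real N" using reals_Archimedean2 by blast
    have "C / Suc N < d powr p / 2"
    proof -
      have "2 * C / d powr p < real (Suc N)" using N by simp
      thus ?thesis using d by (simp add: field_simps)
    qed
    show "\<exists>N. \<forall>i\<ge>N. \<forall>j\<ge>N. Lp_norm p (u i - u j) < d"
    proof (intro exI allI impI)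
      fix i j assume ij: "i \<ge> N" "j \<ge> N"
      have le: "Lp_int p (g - u k) \<le> m + 1 / Suc N" if "k \<ge> N" for k
      proof -
        have "1 / real (Suc k) \<le> 1 / Suc N" using that by (intro divide_left_mono) auto
        thus ?thesis using u(2)[of k] by linarith
      qed
      have mid: "cscale (1/2) ((g - u j) + (g - u i)) = g - cscale (1/2) (u j + u i)"
      proof -
        have "cscale (1/2) (g + g) = g"
          by (simp only: cscale_add_right cvs.scale_left_distrib[symmetric]) simp
        moreover have "(g - u j) + (g - u i) = (g + g) - (u j + u i)" by simp
        ultimately show ?thesis by (simp only: cscale_diff_right)
      qed
      have "cscale (1/2) (u j + u i) \<in> Y"
        by (intro cvs.subspace_scale[OF sub] cvs.subspace_add[OF sub] u)
      hence ge: "m \<le> Lp_int p (cscale (1/2) ((g - u j) + (g - u i)))"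
        unfolding mid by (rule mle)
      have "1 / real (Suc N) \<le> 1" by simp
      hence le1: "Lp_int p (g - u j) + Lp_int p (g - u i) \<le> 2 * (m + 1)"
      proof -
        have "Lp_int p (g - u k) \<le> m + 1" if "k \<ge> N" for k
          by (rule order_trans[OF le[OF that] add_left_mono[OF \<open>1 / real (Suc N) \<le> 1\<close>]])
        moreover have "x + y \<le> 2 * (m + 1)" if "x \<le> m + 1" "y \<le> m + 1" for x y :: real
          using that by simp
        ultimately show ?thesis using ij by blast
      qed
      have "u i - u j = (g - u j) - (g - u i)" by simp
      hence "Lp_int p (u i - u j) \<le> e * (Lp_int p (g - u j) + Lp_int p (g - u i)) +
         C * ((Lp_int p (g - u j) + Lp_int p (g - u i)) / 2 - Lp_int p (cscale (1/2) ((g - u j) + (g - u i))))"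
        using C(2)[of "g - u j" "g - u i"] g uL p by (simp only:) (simp add: Lp_diff)
      also have "\<dots> \<le> e * (2 * (m + 1)) + C * (1 / Suc N)"
      proof -
        have "(x + y) / 2 - z \<le> r" if "x \<le> m + r" "y \<le> m + r" "m \<le> z" for x y z r :: real
        proof -
          have "x + y \<le> 2 * r + 2 * z" using that by linarith
          thus ?thesis by (simp add: field_simps)
        qed
        from this[OF le[OF ij(2)] le[OF ij(1)] ge] show ?thesis
          using e C(1) le1 by (intro add_mono mult_left_mono) auto
      qed
      also have "e * (2 * (m + 1)) = d powr p / 2" using m0 by (simp add: e_def field_simps)
      also have "d powr p / 2 + C * (1 / Suc N) < d powr p"
      proof -
        have "d powr p / 2 + x < d powr p" if "x < d powr p / 2" for x
          using that by (simp add: field_simps)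
        from this[OF \<open>C / Suc N < _\<close>] show ?thesis by simp
      qed
      finally have "Lp_norm p (u i - u j) powr p < d powr p" using p by (simp add: Lp_int_Lp_norm)
      thus "Lp_norm p (u i - u j) < d"
        using powr_mono2[of p d "Lp_norm p (u i - u j)"] d p by (smt (verit))
    qed
  qed
  have hY: "h \<in> Y" by (rule cl[OF u(1) h])
  show ?thesis
  proof (rule that[OF hY])
    fix y assume y: "y \<in> Y"
    have "Lp_norm p (g - h) \<le> m powr (1 / p)"
    proof (rule LIMSEQ_le_const)
      have "(\<lambda>n. (m + 1 / Suc n) powr (1 / p)) \<longlonglongrightarrow> (m + 0) powr (1 / p)"
        using p m0 by (intro tendsto_powr' tendsto_intros) (auto intro!: LIMSEQ_Suc lim_1_over_n simp del: of_nat_Suc)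
      thus "(\<lambda>n. (m + 1 / Suc n) powr (1 / p) + Lp_norm p (u n - h)) \<longlonglongrightarrow> m powr (1 / p)"
        using tendsto_add[OF _ h(2)] by fastforce
      have "Lp_norm p (g - h) \<le> (m + 1 / Suc n) powr (1 / p) + Lp_norm p (u n - h)" for n
      proof -
        have "Lp_norm p (g - u n) \<le> (m + 1 / Suc n) powr (1 / p)"
          unfolding Lp_norm_Lp_int using u(2)[of n] p by (intro powr_mono2) auto
        thus ?thesis using Lp_norm_triangle_mid[of p g "u n" h] p g uL h by force
      qed
      thus "\<exists>N. \<forall>n\<ge>N. Lp_norm p (g - h) \<le> (m + 1 / Suc n) powr (1 / p) + Lp_norm p (u n - h)" by blast
    qed
    hence "Lp_norm p (g - h) powr p \<le> (m powr (1 / p)) powr p" using p by (intro powr_mono2) auto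
    hence "Lp_int p (g - h) \<le> m" using p m0 by (simp add: Lp_int_Lp_norm powr_powr)
    thus "Lp_int p (g - h) \<le> Lp_int p (g - y)" using mle[OF y] by linarith
  qed
qed

text \<open>The duality map of \<open>Lp p\<close>: up to the factor \<open>p\<close>, the real part
  of the pairing with it is the directional derivative of \<open>Lp_int p\<close> at
  \<open>f\<close>. At zeros of \<open>f\<close> its value is \<open>0\<close>.\<close>

lift_definition dual_map :: "real \<Rightarrow> circ_fun \<Rightarrow> circ_fun" is
  "\<lambda>p f t. of_real (norm (f t) powr (p - 2)) * cnj (f t)"
  by (auto simp: circ_eq_def)

lemma norm_dual_map:
  fixes z :: complex
  shows "norm (of_real (norm z powr (p - 2)) * cnj z) = norm z powr (p - 1)"
proof (cases "z = 0")
  case False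
  have "norm z powr (p - 2) * norm z powr 1 = norm z powr (p - 1)"
    by (subst powr_add[symmetric]) simp
  thus ?thesis using False by (simp add: norm_mult)
qed simp

lemma dual_map_Lp:
  assumes p: "1 < p" and e: "e \<in> Lp p"
  shows "dual_map p e \<in> Lp (dual_exponent p)"
  using e unfolding LpD
proof (transfer fixing: p)
  fix f :: "complex \<Rightarrow> complex"
  have "cmod (of_real (cmod (f t) powr (p - 2)) * cnj (f t)) powr dual_exponent p = cmod (f t) powr p" for t
    unfolding norm_dual_map by (simp add: powr_powr dual_exponent[OF p])
  moreover assume "integrable circ_measure (\<lambda>t. cmod (f t) powr p)"
  ultimately show "integrable circ_measure (\<lambda>t. cmod (of_real (cmod (f t) powr (p - 2)) * cnj (f t)) powr dual_exponent p)"
    by simp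
qed

lemma dual_map_mult_pointwise:
  fixes z :: complex
  assumes "1 < p"
  shows "of_real (cmod z powr (p - 2)) * cnj z * z = of_real (cmod z powr p)"
proof (cases "z = 0")
  case False
  have "cmod z powr p = cmod z powr (p - 2) * cmod z powr 2"
    by (subst powr_add[symmetric]) simp
  also have "cmod z powr 2 = (cmod z)\<^sup>2" using False by simp
  finally have "complex_of_real (cmod z powr p) = of_real (cmod z powr (p - 2)) * (cnj z * z)"
    using complex_norm_square[of z] by (simp only: of_real_mult mult.commute[of "cnj z"])
  thus ?thesis by (simp add: mult.assoc)
qed (use assms in auto)

lemma dual_map_mult_self:
  assumes "1 < p"
  shows "fourier (dual_map p e * e) 0 = of_real (Lp_int p e)"
proof (transfer fixing: p)
  fix f :: "complex \<Rightarrow> complex"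
  show "(LINT t|circ_measure. of_real (cmod (f t) powr (p - 2)) * cnj (f t) * f t * t powi - 0) =
         of_real (LINT t|circ_measure. cmod (f t) powr p)"
    by (simp add: dual_map_mult_pointwise[OF assms] integral_complex_of_real)
qed

text \<open>Tangent form of the convexity of \<open>|z| powr p\<close>: Young's inequality is
  applied to \<open>|a| powr (p - 1)\<close> and \<open>|b|\<close>, and
  \<open>(p - 1) * dual_exponent p = p\<close> restores \<open>|a| powr p\<close>.\<close>

lemma gradient_inequality:
  fixes a b :: complex
  assumes p: "1 < p"
  shows "p * Re (of_real (norm a powr (p - 2)) * cnj a * (b - a)) \<le> norm b powr p - norm a powr p"
proof -
  let ?w = "of_real (norm a powr (p - 2)) * cnj a"
  let ?q = "dual_exponent p"
  note q = dual_exponent[OF p]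
  have "?w * a = of_real (norm a powr p)" by (rule dual_map_mult_pointwise[OF p])
  hence 1: "Re (?w * (b - a)) = Re (?w * b) - norm a powr p"
    by (simp only: right_diff_distrib minus_complex.simps) simp
  have "Re (?w * b) \<le> norm (?w * b)" by (rule complex_Re_le_cmod)
  also have "\<dots> = norm a powr (p - 1) * norm b" by (simp add: norm_mult[of ?w b] norm_dual_map)
  also have "\<dots> \<le> (norm a powr (p - 1)) powr ?q / ?q + norm b powr p / p"
    using p q by (intro Youngs_inequality) auto
  also have "(norm a powr (p - 1)) powr ?q = norm a powr p" by (simp add: powr_powr q)
  finally have "p * Re (?w * b) \<le> p * (norm a powr p / ?q + norm b powr p / p)"
    using p by (intro mult_left_mono) auto
  also have "\<dots> = (p / ?q) * norm a powr p + norm b powr p" using p by (simp add: distrib_left)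
  also have "\<dots> = (p - 1) * norm a powr p + norm b powr p" by (simp add: q)
  finally show ?thesis unfolding 1 by (simp add: algebra_simps)
qed

text \<open>For \<open>p < 2\<close> the real factor blows up near zero, so continuity there is read
  off from the modulus \<open>|z| powr (p - 1)\<close>, which tends to 0 because
  \<open>p > 1\<close>.\<close>

lemma tendsto_dual_map:
  fixes z :: "nat \<Rightarrow> complex"
  assumes p: "1 < p" and z: "z \<longlonglongrightarrow> a"
  shows "(\<lambda>n. of_real (norm (z n) powr (p - 2)) * cnj (z n)) \<longlonglongrightarrow> of_real (norm a powr (p - 2)) * cnj a"
proof (cases "a = 0")
  case False
  thus ?thesis using z by (intro tendsto_intros) auto
next
  case True
  have "(\<lambda>n. norm (z n) powr (p - 1)) \<longlonglongrightarrow> norm a powr (p - 1)"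
    using z p by (intro tendsto_powr' tendsto_norm tendsto_const) auto
  hence "(\<lambda>n. norm (of_real (norm (z n) powr (p - 2)) * cnj (z n))) \<longlonglongrightarrow> 0"
    unfolding norm_dual_map using True p by simp
  thus ?thesis using True by (simp add: tendsto_norm_zero_iff)
qed

text \<open>First-order condition for a minimum. The gradient inequality based at the displaced
  point \<open>e + s y\<close> gives the sign for each \<open>s > 0\<close>, and dominated
  convergence lets \<open>s\<close> tend to 0; this takes the place of differentiating under the
  integral.\<close>

lemma minimal_imp_Re_nonneg:
  assumes p: "1 < p" and e: "e \<in> Lp p" and y: "y \<in> Lp p"
    and min: "\<And>s. s > 0 \<Longrightarrow> Lp_int p e \<le> Lp_int p (e + cscale (of_real s) y)"
  shows "Re (fourier (dual_map p e * y) 0) \<ge> 0"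
proof -
  obtain f where f [measurable]: "f \<in> borel_measurable borel" and ef: "e = abs_circ_fun f" by (rule circ_fun_cases)
  obtain h where h [measurable]: "h \<in> borel_measurable borel" and yh: "y = abs_circ_fun h" by (rule circ_fun_cases)
  define w where "w z = of_real (norm z powr (p - 2)) * cnj z" for z :: complex
  have w_meas [measurable]: "w \<in> borel_measurable borel" unfolding w_def by measurable
  have iE: "integrable circ_measure (\<lambda>t. norm (f t) powr p)" using e by (simp add: ef LpD in_Lp.abs_eq)
  have iH: "integrable circ_measure (\<lambda>t. norm (h t) powr p)" using y by (simp add: yh LpD in_Lp.abs_eq)
  define s where "s n = 1 / real (Suc n)" for n
  have s: "s n > 0" "s n \<le> 1" for n by (simp_all add: s_def)
  have s0: "s \<longlonglongrightarrow> 0" unfolding s_def by (rule LIMSEQ_Suc[OF lim_1_over_n])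
  define F where "F n t = f t + of_real (s n) * h t" for n t
  have F_meas [measurable]: "F n \<in> borel_measurable borel" for n unfolding F_def by measurable
  have eF: "e + cscale (of_real (s n)) y = abs_circ_fun (F n)" for n
    by (simp add: ef yh cscale.abs_eq plus_circ_fun.abs_eq F_def[abs_def])
  have iF: "integrable circ_measure (\<lambda>t. norm (F n t) powr p)" for n
    using Lp_add[OF _ e Lp_cscale[OF y], of "of_real (s n)"] p unfolding eF by (simp add: LpD in_Lp.abs_eq)
  \<comment> \<open>Dominates the integrands for all \<open>n\<close> at once, since
    \<open>s n \<le> 1\<close>.\<close>
  define D where "D t = 2 powr p * (norm (f t) powr p + norm (h t) powr p)" for t
  have iD: "integrable circ_measure D" unfolding D_def using iE iH by simp
  have bound: "norm (w (F n t) * h t) \<le> D t" for n t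
  proof -
    have "norm (of_real (s n) * h t) \<le> norm (h t)"
      using s[of n] by (simp add: norm_mult mult_left_le_one_le)
    hence nF: "norm (F n t) \<le> norm (f t) + norm (h t)"
      unfolding F_def using norm_triangle_ineq[of "f t" "of_real (s n) * h t"] by linarith
    have "norm (w (F n t) * h t) = norm (F n t) powr (p - 1) * norm (h t)"
      unfolding w_def norm_mult[of _ "h t"] norm_dual_map ..
    also have "\<dots> \<le> (norm (f t) + norm (h t)) powr (p - 1) * (norm (f t) + norm (h t)) powr 1"
      using p nF by (intro mult_mono powr_mono2) auto
    also have "\<dots> = (norm (f t) + norm (h t)) powr p"
      by (subst powr_add[symmetric]) simp
    also have "\<dots> \<le> D t" unfolding D_def using p by (intro powr_add_le) auto
    finally show ?thesis .
  qed
  have iw: "integrable circ_measure (\<lambda>t. w (F n t) * h t)" for n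
    by (rule Bochner_Integration.integrable_bound[OF iD]) (use bound order_trans[OF bound abs_ge_self] in auto)
  have pos: "Re (LINT t|circ_measure. w (F n t) * h t) \<ge> 0" for n
  proof -
    have pw: "- (p * s n) * Re (w (F n t) * h t) \<le> norm (f t) powr p - norm (F n t) powr p" for t
    proof -
      have "p * Re (w (F n t) * (f t - F n t)) \<le> norm (f t) powr p - norm (F n t) powr p"
        unfolding w_def by (rule gradient_inequality[OF p])
      also have "w (F n t) * (f t - F n t) = - (of_real (s n) * (w (F n t) * h t))"
        by (simp add: F_def)
      finally show ?thesis by simp
    qed
    have "(LINT t|circ_measure. - (p * s n) * Re (w (F n t) * h t)) \<le> (LINT t|circ_measure. norm (f t) powr p - norm (F n t) powr p)"
      by (intro integral_mono pw integrable_mult_right integrable_Re iw Bochner_Integration.integrable_diff iE iF)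
    also have "\<dots> = Lp_int p e - Lp_int p (e + cscale (of_real (s n)) y)"
    proof -
      have "Lp_int p e = (LINT t|circ_measure. norm (f t) powr p)" by (simp add: ef Lp_int.abs_eq)
      moreover have "Lp_int p (e + cscale (of_real (s n)) y) = (LINT t|circ_measure. norm (F n t) powr p)"
        unfolding eF by (simp add: Lp_int.abs_eq)
      ultimately show ?thesis using iE iF by simp
    qed
    also have "\<dots> \<le> 0" using min[OF s(1)[of n]] by simp
    finally have "- (p * s n) * Re (LINT t|circ_measure. w (F n t) * h t) \<le> 0"
      using iw[of n] by (simp only: integral_mult_right_zero integral_Re)
    hence "0 \<le> (p * s n) * Re (LINT t|circ_measure. w (F n t) * h t)" by simp
    moreover have "p * s n > 0" using p s[of n] by simp
    ultimately show ?thesis by (simp only: zero_le_mult_iff) auto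
  qed
  have "(\<lambda>n. LINT t|circ_measure. w (F n t) * h t) \<longlonglongrightarrow> (LINT t|circ_measure. w (f t) * h t)"
  proof (rule integral_dominated_convergence[OF _ _ iD])
    have "(\<lambda>n. F n t) \<longlonglongrightarrow> f t + of_real 0 * h t" for t
      unfolding F_def by (intro tendsto_intros s0)
    hence "(\<lambda>n. w (F n t) * h t) \<longlonglongrightarrow> w (f t) * h t" for t
      unfolding w_def by (intro tendsto_mult tendsto_const tendsto_dual_map p) simp
    thus "AE t in circ_measure. (\<lambda>n. w (F n t) * h t) \<longlonglongrightarrow> w (f t) * h t" by simp
  qed (use bound in auto)
  from tendsto_Re[OF this] have "Re (LINT t|circ_measure. w (f t) * h t) \<ge> 0"
    by (rule LIMSEQ_le_const) (use pos in auto)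
  moreover have "fourier (dual_map p e * y) 0 = (LINT t|circ_measure. w (f t) * h t)"
    by (simp add: ef yh dual_map.abs_eq times_circ_fun.abs_eq fourier.abs_eq w_def)
  ultimately show ?thesis by simp
qed

lemma mult_Lp_dual:
  assumes "1 < p" "f \<in> Lp p" "w \<in> Lp (dual_exponent p)"
  shows "w * f \<in> Lp 1"
  using Holder_Lp_int(1)[of p f w] assms by (simp add: mult.commute)

text \<open>This replaces the Hahn--Banach theorem: the separating functional is given by the error
  of a best approximation.\<close>

lemma separation:
  assumes p: "1 < p" and Y: "closed_subspace p Y" and g: "g \<in> Lp p" "g \<notin> Y"
  obtains w where "w \<in> Lp (dual_exponent p)" "\<And>y. y \<in> Y \<Longrightarrow> fourier (w * y) 0 = 0" "fourier (w * g) 0 \<noteq> 0"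
proof -
  have YL: "Y \<subseteq> Lp p" and sub: "cvs.subspace Y"
    using Y unfolding closed_subspace_def by blast+
  obtain y0 where y0: "y0 \<in> Y" "\<And>y. y \<in> Y \<Longrightarrow> Lp_int p (g - y0) \<le> Lp_int p (g - y)"
    using nearest_point[OF p Y g(1)] by blast
  define e where "e = g - y0"
  define w where "w = dual_map p e"
  have y0L: "y0 \<in> Lp p" using y0 YL by auto
  have e: "e \<in> Lp p" using p g y0L by (simp add: e_def Lp_diff)
  have e0: "e \<noteq> 0" using g(2) y0(1) by (auto simp: e_def)
  have wL: "w \<in> Lp (dual_exponent p)" unfolding w_def by (rule dual_map_Lp[OF p e])
  have Re: "Re (fourier (w * y) 0) \<ge> 0" if y: "y \<in> Y" for y
    unfolding w_def
  proof (rule minimal_imp_Re_nonneg[OF p e])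
    show "y \<in> Lp p" using y YL by auto
    fix s :: real
    have "y0 - cscale (of_real s) y \<in> Y"
      by (intro cvs.subspace_diff[OF sub] cvs.subspace_scale[OF sub] y y0)
    from y0(2)[OF this] show "Lp_int p e \<le> Lp_int p (e + cscale (of_real s) y)"
      by (simp add: e_def algebra_simps)
  qed
  have Re_z: "0 \<le> Re (z * fourier (w * y) 0)" if "y \<in> Y" for y z
    using Re[OF cvs.subspace_scale[OF sub that, of z]] by (simp add: cscale_mult_right fourier_cscale)
  \<comment> \<open>\<open>Y\<close> is invariant under the scalars \<open>1\<close>,
    \<open>- 1\<close>, \<open>\<i>\<close> and \<open>- \<i>\<close>, which bound the real and the
    imaginary part from both sides.\<close>
  have zero: "fourier (w * y) 0 = 0" if "y \<in> Y" for y
    using Re_z[OF that, of 1] Re_z[OF that, of "- 1"] Re_z[OF that, of \<i>] Re_z[OF that, of "- \<i>"]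
    by (auto simp: complex_eq_iff)
  have "fourier (w * g) 0 = fourier (w * e + w * y0) 0" by (simp add: e_def algebra_simps)
  also have "\<dots> = fourier (w * e) 0 + fourier (w * y0) 0"
    by (intro fourier_add mult_Lp_dual[OF p] e y0L wL)
  also have "\<dots> = of_real (Lp_int p e)" using zero[OF y0(1)] by (simp add: w_def dual_map_mult_self[OF p])
  finally have "fourier (w * g) 0 \<noteq> 0" using e0 Lp_int_eq_0[OF e] by simp
  thus ?thesis using that wL zero by blast
qed

section \<open>Trigonometric polynomials and uniqueness of Fourier coefficients\<close>

definition trig_sum :: "nat \<Rightarrow> (int \<Rightarrow> complex) \<Rightarrow> complex \<Rightarrow> complex" where
  "trig_sum N c t = (\<Sum>n\<in>{- int N..int N}. c n * t powi n)"

text \<open>Values are prescribed on the circle only and sums are allowed freely, so closure under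
  products is a double induction down to monomials; \<open>trig_imp_trig_sum\<close> recovers the
  coefficients.\<close>

inductive trig :: "(complex \<Rightarrow> complex) \<Rightarrow> bool" where
  monom: "(\<And>t. norm t = 1 \<Longrightarrow> g t = c * t powi n) \<Longrightarrow> trig g"
| add: "trig g \<Longrightarrow> trig h \<Longrightarrow> (\<And>t. norm t = 1 \<Longrightarrow> k t = g t + h t) \<Longrightarrow> trig k"

lemma trig_mult: "trig g \<Longrightarrow> trig h \<Longrightarrow> trig (\<lambda>t. g t * h t)"
proof (induct g rule: trig.induct)
  case (monom g c n)
  from monom(2,1) show ?case
  proof (induct h rule: trig.induct)
    case (monom h d m)
    show ?case
    proof (rule trig.monom)
      fix t :: complex assume t: "norm t = 1"
      hence "t \<noteq> 0" by auto
      thus "g t * h t = (c * d) * t powi (n + m)"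
        using monom t by (simp add: power_int_add)
    qed
  next
    case (add h k l)
    show ?case by (rule trig.add[OF add(2)[OF add(6)] add(4)[OF add(6)]]) (simp_all add: add(5) algebra_simps)
  qed
next
  case (add g h k)
  show ?case by (rule trig.add[OF add(2)[OF add(6)] add(4)[OF add(6)]]) (simp_all add: add(5) algebra_simps)
qed

lemma trig_sum_pad:
  assumes "N \<le> M"
  shows "trig_sum N c t = trig_sum M (\<lambda>n. if \<bar>n\<bar> \<le> int N then c n else 0) t"
  unfolding trig_sum_def using assms
  by (intro sum.mono_neutral_cong_left) auto

lemma trig_imp_trig_sum:
  assumes "trig g"
  obtains N c where "\<And>t. norm t = 1 \<Longrightarrow> g t = trig_sum N c t"
proof -
  have "\<exists>N c. \<forall>t. norm t = 1 \<longrightarrow> g t = trig_sum N c t"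
    using assms
  proof induct
    case (monom g c n)
    show ?case
    proof (intro exI allI impI)
      fix t :: complex assume "norm t = 1"
      have "trig_sum (nat \<bar>n\<bar>) (\<lambda>m. if m = n then c else 0) t = (\<Sum>m\<in>{- \<bar>n\<bar>..\<bar>n\<bar>}. if m = n then c * t powi n else 0)"
        unfolding trig_sum_def by (intro sum.cong) auto
      also have "\<dots> = c * t powi n" by (subst sum.delta) auto
      finally show "g t = trig_sum (nat \<bar>n\<bar>) (\<lambda>m. if m = n then c else 0) t"
        using monom[OF \<open>norm t = 1\<close>] by simp
    qed
  next
    case (add g h k)
    then obtain N c M d where g: "\<forall>t. norm t = 1 \<longrightarrow> g t = trig_sum N c t"
      and h: "\<forall>t. norm t = 1 \<longrightarrow> h t = trig_sum M d t" by blast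
    define L where "L = max N M"
    have "k t = trig_sum L (\<lambda>n. (if \<bar>n\<bar> \<le> int N then c n else 0) + (if \<bar>n\<bar> \<le> int M then d n else 0)) t"
      if "norm t = 1" for t
      using that g h add(5)[OF that] trig_sum_pad[of N L c t] trig_sum_pad[of M L d t]
      by (simp add: L_def trig_sum_def distrib_right sum.distrib)
    thus ?case by blast
  qed
  thus ?thesis using that by blast
qed

text \<open>On the circle a real linear functional is a combination of \<open>t\<close> and
  \<open>1 / t\<close>, and the other polynomial constructors preserve \<open>trig\<close>. This
  links the Stone-Weierstrass theorem in the plane to trigonometric polynomials.\<close>

lemma trig_real_polynomial_function:
  fixes g :: "complex \<Rightarrow> real"
  assumes "real_polynomial_function g"
  shows "trig (\<lambda>t. of_real (g t))"
  using assms
proof (induct g rule: real_polynomial_function.induct)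
  case (linear f)
  have lin: "f t = Re t * f 1 + Im t * f \<i>" for t
  proof -
    interpret bounded_linear f by (rule linear)
    have "t = Re t *\<^sub>R 1 + Im t *\<^sub>R \<i>" by (simp add: complex_eq_iff)
    hence "f t = f (Re t *\<^sub>R 1 + Im t *\<^sub>R \<i>)" by simp
    thus ?thesis by (simp only: add scaleR) simp
  qed
  \<comment> \<open>The coefficients come from \<open>Re t = (t + 1 / t) / 2\<close> and
    \<open>Im t = (t - 1 / t) / (2 * \<i>)\<close>.\<close>
  show ?case
  proof (rule trig.add[of "\<lambda>t. (f 1 - \<i> * f \<i>) / 2 * t powi 1" "\<lambda>t. (f 1 + \<i> * f \<i>) / 2 * t powi (- 1)"])
    fix t :: complex assume t: "norm t = 1"
    have "t powi (- 1) = cnj t"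
      using t by (simp add: power_int_minus inverse_eq_divide complex_div_cnj[of 1 t])
    thus "complex_of_real (f t) = (f 1 - \<i> * f \<i>) / 2 * t powi 1 + (f 1 + \<i> * f \<i>) / 2 * t powi (- 1)"
      by (subst lin[of t]) (simp only:, simp add: complex_eq_iff field_simps)
  qed (rule trig.monom[of _ "(f 1 - \<i> * f \<i>) / 2" 1] trig.monom[of _ "(f 1 + \<i> * f \<i>) / 2" "- 1"], simp)+
next
  case (const c)
  show ?case by (rule trig.monom[of _ "of_real c" 0]) simp
next
  case (add f g)
  show ?case by (rule trig.add[OF add(2,4)]) simp
next
  case (mult f g)
  show ?case using trig_mult[OF mult(2,4)] by simp
qed

lemma trig_approximation:
  fixes g :: "complex \<Rightarrow> real"
  assumes "continuous_on (sphere 0 1) g" "e > 0"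
  obtains h N c where "\<And>t. norm t = 1 \<Longrightarrow> \<bar>g t - h t\<bar> < e"
    "\<And>t. norm t = 1 \<Longrightarrow> complex_of_real (h t) = trig_sum N c t"
proof -
  obtain h where h: "real_polynomial_function h" "\<And>t. t \<in> sphere 0 1 \<Longrightarrow> \<bar>g t - h t\<bar> < e"
    using Stone_Weierstrass_real_polynomial_function[OF compact_sphere assms] by blast
  from trig_real_polynomial_function[OF h(1)] obtain N c where
    "\<And>t. norm t = 1 \<Longrightarrow> complex_of_real (h t) = trig_sum N c t" using trig_imp_trig_sum by blast
  thus ?thesis using that h(2) by auto
qed

lemma integral_powi: "(LINT t|circ_measure. t powi m) = (if m = 0 then 1 else 0)"
proof -
  have "(LINT t|circ_measure. t powi m) = fourier (tpow m) 0"
    by transfer simp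
  thus ?thesis by (simp add: fourier_tpow)
qed

lemma positive_measure_compact_subset:
  assumes "B \<in> sets borel" "emeasure circ_measure B > 0"
  obtains K where "compact K" "K \<subseteq> B" "measure circ_measure K > 0"
proof -
  have "emeasure circ_measure B = (SUP K \<in> {K. K \<subseteq> B \<and> compact K}. emeasure circ_measure K)"
    by (rule inner_regular) (use assms circ.emeasure_finite in auto)
  with assms(2) obtain K where "compact K" "K \<subseteq> B" "emeasure circ_measure K > 0"
    by (auto simp: less_SUP_iff)
  thus ?thesis using that by (simp add: circ.emeasure_eq_measure)
qed

text \<open>Continuous cut-offs that decrease to the indicator of a nonempty compact
  \<open>K\<close>. For empty \<open>K\<close>, \<open>infdist\<close> is 0 and the value is
  constantly 1, whence the nonemptiness assumptions below.\<close>

definition bump :: "complex set \<Rightarrow> nat \<Rightarrow> complex \<Rightarrow> real" where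
  "bump K k t = max 0 (1 - real k * infdist t K)"

lemma continuous_bump: "continuous_on A (bump K k)"
  unfolding bump_def[abs_def] by (intro continuous_intros)

lemma bump_measurable [measurable]: "bump K k \<in> borel_measurable borel"
  by (intro borel_measurable_continuous_onI continuous_bump)

lemma bump_bounds: "0 \<le> bump K k t" "bump K k t \<le> 1"
  by (auto simp: bump_def infdist_nonneg)

lemma tendsto_bump:
  assumes "compact K" "K \<noteq> {}"
  shows "(\<lambda>k. bump K k t) \<longlonglongrightarrow> indicator K t"
proof (cases "t \<in> K")
  case True
  thus ?thesis by (simp add: bump_def)
next
  case False
  hence "infdist t K > 0"
    using in_closed_iff_infdist_zero[of K t] assms infdist_nonneg[of t K]
    by (auto simp: compact_imp_closed less_le)
  then obtain N where N: "1 < real N * infdist t K" using reals_Archimedean3 by blast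
  have "bump K k t = 0" if "k \<ge> N" for k
  proof -
    have "real N * infdist t K \<le> real k * infdist t K" using that by (intro mult_right_mono infdist_nonneg) auto
    thus ?thesis using N by (simp add: bump_def)
  qed
  hence "\<forall>\<^sub>F k in sequentially. bump K k t = 0" by (auto simp: eventually_sequentially)
  thus ?thesis using False by (simp add: tendsto_eventually)
qed

text \<open>Otherwise inner regularity puts a compact set of positive measure into the set where
  \<open>h > 0\<close>, and the integral over it would be positive.\<close>

lemma compact_integrals_zero_imp_nonpos:
  fixes h :: "complex \<Rightarrow> real"
  assumes h: "integrable circ_measure h"
    and zero: "\<And>K. compact K \<Longrightarrow> K \<noteq> {} \<Longrightarrow> (LINT t|circ_measure. h t * indicator K t) = 0"
  shows "AE t in circ_measure. h t \<le> 0"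
proof (rule ccontr)
  assume neg: "\<not> (AE t in circ_measure. h t \<le> 0)"
  have hm [measurable]: "h \<in> borel_measurable borel"
    using borel_measurable_integrable[OF h] by simp
  have B: "{t. h t > 0} \<in> sets borel" by measurable
  have "emeasure circ_measure {t. h t > 0} \<noteq> 0"
    using neg AE_iff_measurable[of "{t. h t > 0}" circ_measure "\<lambda>t. h t \<le> 0"] B by (auto simp: not_le)
  then obtain K where K: "compact K" "K \<subseteq> {t. h t > 0}" "measure circ_measure K > 0"
    using positive_measure_compact_subset[OF B] by (auto simp: zero_less_iff_neq_zero)
  have Km: "K \<in> sets borel" using K(1) by (simp add: compact_imp_closed)
  have "K \<noteq> {}" using K(3) by auto
  have i: "integrable circ_measure (\<lambda>t. h t * indicator K t)"
    using h Km by (intro integrable_real_mult_indicator) auto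
  have "AE t in circ_measure. 0 \<le> h t * indicator K t"
    using K(2) by (intro AE_I2) (auto simp: indicator_def less_imp_le)
  hence "AE t in circ_measure. h t * indicator K t = 0"
    using zero[OF K(1) \<open>K \<noteq> {}\<close>] integral_nonneg_eq_0_iff_AE[OF i] by blast
  hence "AE t in circ_measure. t \<notin> K"
    by eventually_elim (use K(2) in \<open>auto simp: indicator_def split: if_splits\<close>)
  hence "measure circ_measure K = 0"
    using Km by (subst (asm) AE_iff_measurable[of K]) (auto simp: measure_def)
  thus False using K(3) by simp
qed

lemma integral_mult_trig_sum:
  assumes f: "integrable circ_measure f" and zero: "\<And>n. (LINT t|circ_measure. f t * t powi n) = 0"
  shows "(LINT t|circ_measure. f t * trig_sum N c t) = 0"
proof -
  have [measurable]: "f \<in> borel_measurable borel" using borel_measurable_integrable[OF f] by simp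
  have i: "integrable circ_measure (\<lambda>t. f t * t powi n)" for n
    using f by (simp add: integrable_powi)
  have "(LINT t|circ_measure. f t * trig_sum N c t) = (LINT t|circ_measure. (\<Sum>n\<in>{- int N..int N}. c n * (f t * t powi n)))"
    by (simp add: trig_sum_def sum_distrib_left ac_simps)
  also have "\<dots> = (\<Sum>n\<in>{- int N..int N}. LINT t|circ_measure. c n * (f t * t powi n))"
    by (rule Bochner_Integration.integral_sum) (use i in auto)
  finally show ?thesis by (simp add: zero)
qed

text \<open>The class of test functions is enlarged from trigonometric polynomials to continuous
  functions by uniform approximation, and then to indicators of compact sets as limits of
  \<open>bump\<close>.\<close>

lemma fourier_coefficients_zero:
  fixes f :: "complex \<Rightarrow> complex"
  assumes f: "integrable circ_measure f" and zero: "\<And>n. (LINT t|circ_measure. f t * t powi n) = 0"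
  shows "AE t in circ_measure. f t = 0"
proof -
  have fm [measurable]: "f \<in> borel_measurable borel" using borel_measurable_integrable[OF f] by simp
  have cont: "(LINT t|circ_measure. f t * of_real (g t)) = 0"
    if g: "continuous_on UNIV g" "\<And>t. \<bar>g t\<bar> \<le> 1" for g :: "complex \<Rightarrow> real"
  proof -
    have gm [measurable]: "g \<in> borel_measurable borel"
      by (intro borel_measurable_continuous_onI g)
    have ig: "integrable circ_measure (\<lambda>t. f t * of_real (g t))"
      by (rule Bochner_Integration.integrable_bound[OF f])
        (use g(2) in \<open>auto simp: norm_mult mult_left_le\<close>)
    have bound: "norm (LINT t|circ_measure. f t * of_real (g t)) \<le> e * (LINT t|circ_measure. norm (f t))" if e: "e > 0" for e
    proof -
      obtain h N c where h: "\<And>t. norm t = 1 \<Longrightarrow> \<bar>g t - h t\<bar> < e"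
        "\<And>t. norm t = 1 \<Longrightarrow> complex_of_real (h t) = trig_sum N c t"
        using trig_approximation[OF continuous_on_subset[OF g(1)] e] by auto
      have tm [measurable]: "trig_sum N c \<in> borel_measurable borel"
        unfolding trig_sum_def[abs_def] by measurable
      have i: "integrable circ_measure (\<lambda>t. f t * t powi n)" for n
        using f by (simp add: integrable_powi)
      have it: "integrable circ_measure (\<lambda>t. f t * trig_sum N c t)"
      proof -
        have "integrable circ_measure (\<lambda>t. (\<Sum>n\<in>{- int N..int N}. c n * (f t * t powi n)))"
          using i by (intro Bochner_Integration.integrable_sum integrable_mult_right)
        thus ?thesis by (simp add: trig_sum_def sum_distrib_left ac_simps)
      qed
      have "(LINT t|circ_measure. f t * of_real (g t)) = (LINT t|circ_measure. f t * of_real (g t) - f t * trig_sum N c t)"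
        using ig it integral_mult_trig_sum[OF f zero, of N c] by simp
      also have "norm \<dots> \<le> (LINT t|circ_measure. norm (f t * of_real (g t) - f t * trig_sum N c t))"
        by (rule integral_norm_bound)
      also have "\<dots> \<le> (LINT t|circ_measure. e * norm (f t))"
      proof (rule integral_mono_AE)
        show "AE t in circ_measure. norm (f t * of_real (g t) - f t * trig_sum N c t) \<le> e * norm (f t)"
          using AE_circ_norm
        proof eventually_elim
          case (elim t)
          have "f t * of_real (g t) - f t * trig_sum N c t = f t * of_real (g t - h t)"
            using h(2)[OF elim] by (simp add: algebra_simps)
          hence "norm (f t * of_real (g t) - f t * trig_sum N c t) = norm (f t) * \<bar>g t - h t\<bar>"
            by (simp only: norm_mult norm_of_real)
          also have "\<dots> \<le> norm (f t) * e" using h(1)[OF elim] by (intro mult_left_mono) auto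
          finally show ?case by (simp add: mult.commute)
        qed
      qed (use f ig it in auto)
      finally show ?thesis by simp
    qed
    have "norm (LINT t|circ_measure. f t * of_real (g t)) \<le> 0 + e" if e: "e > 0" for e
    proof -
      define J where "J = (LINT t|circ_measure. norm (f t))"
      have J: "J \<ge> 0" unfolding J_def by simp
      have "norm (LINT t|circ_measure. f t * of_real (g t)) \<le> e / (J + 1) * J"
      proof -
        have "e / (J + 1) > 0" using e J by simp
        from bound[OF this] show ?thesis unfolding J_def .
      qed
      also have "\<dots> \<le> e" using e J by (simp add: field_simps)
      finally show ?thesis by simp
    qed
    hence "norm (LINT t|circ_measure. f t * of_real (g t)) \<le> 0" by (rule field_le_epsilon)
    thus ?thesis by simp
  qed
  have comp: "(LINT t|circ_measure. f t * of_real (indicator K t)) = 0" if K: "compact K" "K \<noteq> {}" for K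
  proof -
    have Km [measurable]: "K \<in> sets borel" using K by (simp add: compact_imp_closed)
    have "(\<lambda>k. LINT t|circ_measure. f t * of_real (bump K k t)) \<longlonglongrightarrow> (LINT t|circ_measure. f t * of_real (indicator K t))"
    proof (rule integral_dominated_convergence[of _ _ _ "\<lambda>t. norm (f t)"])
      show "AE t in circ_measure. (\<lambda>k. f t * of_real (bump K k t)) \<longlonglongrightarrow> f t * of_real (indicator K t)"
        by (intro AE_I2 tendsto_mult tendsto_const tendsto_of_real tendsto_bump K)
      show "AE t in circ_measure. norm (f t * of_real (bump K k t)) \<le> norm (f t)" for k
        by (intro AE_I2) (simp add: norm_mult mult_left_le bump_bounds)
    qed (use f in auto)
    moreover have "(LINT t|circ_measure. f t * of_real (bump K k t)) = 0" for k
      by (rule cont[OF continuous_bump]) (use bump_bounds[of K k] in \<open>simp add: abs_of_nonneg\<close>)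
    ultimately show ?thesis by (simp add: LIMSEQ_const_iff)
  qed
  \<comment> \<open>Four rotations \<open>z\<close> of \<open>f\<close> will control both signs of
    the real and of the imaginary part.\<close>
  have nonpos: "AE t in circ_measure. Re (z * f t) \<le> 0" for z
  proof (rule compact_integrals_zero_imp_nonpos)
    show "integrable circ_measure (\<lambda>t. Re (z * f t))" using f by (intro integrable_Re) auto
    fix K :: "complex set" assume K: "compact K" "K \<noteq> {}"
    have Km [measurable]: "K \<in> sets borel" using K by (simp add: compact_imp_closed)
    have iK: "integrable circ_measure (\<lambda>t. z * (f t * of_real (indicator K t)))"
      by (rule integrable_mult_right, rule Bochner_Integration.integrable_bound[OF f])
        (auto simp: norm_mult indicator_def)
    have "(LINT t|circ_measure. Re (z * (f t * of_real (indicator K t)))) = Re (z * (LINT t|circ_measure. f t * of_real (indicator K t)))"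
      using integral_Re[OF iK] by simp
    also have "\<dots> = 0" using comp[OF K] by simp
    also have "(\<lambda>t. Re (z * (f t * of_real (indicator K t)))) = (\<lambda>t. Re (z * f t) * indicator K t)"
      by (auto simp: indicator_def)
    finally show "(LINT t|circ_measure. Re (z * f t) * indicator K t) = 0" .
  qed
  show ?thesis
    using nonpos[of 1] nonpos[of "- 1"] nonpos[of \<i>] nonpos[of "- \<i>"]
    by eventually_elim (auto simp: complex_eq_iff)
qed

lemma fourier_unique_0:
  assumes "f \<in> Lp 1" "\<And>n. fourier f n = 0"
  shows "f = 0"
proof -
  obtain F where F [measurable]: "F \<in> borel_measurable borel" and fF: "f = abs_circ_fun F" by (rule circ_fun_cases)
  have i: "integrable circ_measure F" using assms(1) by (simp add: fF LpD in_Lp_1)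
  have "(LINT t|circ_measure. F t * t powi n) = 0" for n
    using assms(2)[of "- n"] by (simp add: fF fourier.abs_eq)
  from fourier_coefficients_zero[OF i this] have "circ_eq F (\<lambda>_. 0)" by (simp add: circ_eq_def)
  thus ?thesis unfolding fF zero_circ_fun_def
    using Quotient3_rel_abs[OF Quotient3_circ_fun] by blast
qed

lemma fourier_unique:
  assumes "f \<in> Lp 1" "g \<in> Lp 1" "\<And>n. fourier f n = fourier g n"
  shows "f = g"
proof -
  have "f - g = 0"
    by (rule fourier_unique_0) (use assms in \<open>auto simp: fourier_diff Lp_diff\<close>)
  thus ?thesis by simp
qed

section \<open>Zeros of boundary values\<close>

text \<open>The integral against \<open>t powi n\<close> with \<open>n > 0\<close> is the
  coefficient of index \<open>- n\<close>, so the hypothesis says that \<open>F\<close> is analytic;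
  only the constant term of \<open>q\<close> survives.\<close>

lemma integral_mult_poly:
  assumes F: "integrable circ_measure F" and zero: "\<And>n. n > 0 \<Longrightarrow> (LINT t|circ_measure. F t * t powi n) = 0"
  shows "integrable circ_measure (\<lambda>t. F t * poly q t)"
    "(LINT t|circ_measure. F t * poly q t) = (LINT t|circ_measure. F t) * poly q 0"
proof -
  have [measurable]: "F \<in> borel_measurable borel" using borel_measurable_integrable[OF F] by simp
  have i: "integrable circ_measure (\<lambda>t. coeff q k * (F t * t ^ k))" for k
    using F integrable_powi[of F "int k"] by simp
  have eq: "F t * poly q t = (\<Sum>k\<le>degree q. coeff q k * (F t * t ^ k))" for t
    by (simp add: poly_altdef sum_distrib_left ac_simps)
  show "integrable circ_measure (\<lambda>t. F t * poly q t)"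
    unfolding eq using i by (intro Bochner_Integration.integrable_sum)
  have "(LINT t|circ_measure. F t * poly q t) = (\<Sum>k\<le>degree q. coeff q k * (LINT t|circ_measure. F t * t ^ k))"
    unfolding eq using i by (subst Bochner_Integration.integral_sum) auto
  also have "\<dots> = (\<Sum>k\<le>degree q. if k = 0 then coeff q 0 * (LINT t|circ_measure. F t) else 0)"
  proof (rule sum.cong[OF refl])
    fix k
    show "coeff q k * (LINT t|circ_measure. F t * t ^ k) = (if k = 0 then coeff q 0 * (LINT t|circ_measure. F t) else 0)"
      using zero[of "int k"] by auto
  qed
  also have "\<dots> = (LINT t|circ_measure. F t) * poly q 0"
    by (simp add: poly_0_coeff_0)
  finally show "(LINT t|circ_measure. F t * poly q t) = (LINT t|circ_measure. F t) * poly q 0" .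
qed

lemma poly_bounded_on_circle:
  fixes q :: "complex poly"
  obtains M where "\<And>t. norm t = 1 \<Longrightarrow> norm (poly q t) \<le> M"
proof -
  have "compact (poly q ` sphere 0 1)"
    by (intro compact_continuous_image continuous_intros) auto
  hence "bounded (poly q ` sphere 0 1)" by (rule compact_imp_bounded)
  then obtain M where "\<forall>x\<in>poly q ` sphere 0 1. norm x \<le> M" by (auto simp: bounded_iff)
  hence "norm (poly q t) \<le> M" if "norm t = 1" for t using that by simp
  thus ?thesis by (rule that)
qed

text \<open>The partial sums of the exponential series, evaluated at a polynomial, are polynomials,
  and on the circle they are dominated by \<open>exp M\<close>.\<close>

lemma exp_poly_mean:
  assumes F: "integrable circ_measure F" and zero: "\<And>n. n > 0 \<Longrightarrow> (LINT t|circ_measure. F t * t powi n) = 0"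
  shows "(LINT t|circ_measure. F t * exp (poly q t)) = (LINT t|circ_measure. F t) * exp (poly q 0)"
proof -
  have Fm [measurable]: "F \<in> borel_measurable borel" using borel_measurable_integrable[OF F] by simp
  have [measurable]: "poly q \<in> borel_measurable borel"
    by (intro borel_measurable_continuous_onI continuous_intros)
  obtain M where M: "\<And>t. norm t = 1 \<Longrightarrow> norm (poly q t) \<le> M" using poly_bounded_on_circle[of q] by blast
  define S where "S n z = (\<Sum>k<n. z ^ k /\<^sub>R fact k)" for n and z :: complex
  have S: "(\<lambda>n. S n z) \<longlonglongrightarrow> exp z" for z
    using exp_converges[of z] unfolding sums_def S_def .
  have Sb: "norm (S n z) \<le> exp (norm z)" for n z
  proof -
    have "norm (S n z) \<le> (\<Sum>k<n. norm z ^ k /\<^sub>R fact k)"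
      unfolding S_def by (rule order_trans[OF norm_sum]) (simp add: norm_power)
    also have "\<dots> \<le> exp (norm z)"
      unfolding exp_def by (rule sum_le_suminf[OF sums_summable[OF exp_converges]]) auto
    finally show ?thesis .
  qed
  have Sp: "S n (poly q t) = poly (\<Sum>k<n. smult (1 / fact k) (q ^ k)) t" for n t
    by (simp add: S_def poly_sum scaleR_conv_of_real divide_inverse)
  have [measurable]: "(\<lambda>t. S n (poly q t)) \<in> borel_measurable borel" for n
    unfolding Sp by (intro borel_measurable_continuous_onI continuous_intros)
  have "(\<lambda>n. LINT t|circ_measure. F t * S n (poly q t)) \<longlonglongrightarrow> (LINT t|circ_measure. F t * exp (poly q t))"
  proof (rule integral_dominated_convergence[of _ _ _ "\<lambda>t. norm (F t) * exp M"])
    show "AE t in circ_measure. norm (F t * S n (poly q t)) \<le> norm (F t) * exp M" for n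
      using AE_circ_norm
    proof eventually_elim
      case (elim t)
      have "norm (S n (poly q t)) \<le> exp M"
        using Sb[of n "poly q t"] M[OF elim] by (meson exp_le_cancel_iff order_trans)
      thus ?case by (simp add: norm_mult mult_left_mono)
    qed
    show "AE t in circ_measure. (\<lambda>n. F t * S n (poly q t)) \<longlonglongrightarrow> F t * exp (poly q t)"
      by (intro AE_I2 tendsto_mult tendsto_const S)
  qed (use F in auto)
  moreover have "(LINT t|circ_measure. F t * S n (poly q t)) = (LINT t|circ_measure. F t) * S n (poly q 0)" for n
    unfolding Sp by (rule integral_mult_poly(2)[OF F zero])
  ultimately have "(\<lambda>n. (LINT t|circ_measure. F t) * S n (poly q 0)) \<longlonglongrightarrow> (LINT t|circ_measure. F t * exp (poly q t))"
    by simp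
  moreover have "(\<lambda>n. (LINT t|circ_measure. F t) * S n (poly q 0)) \<longlonglongrightarrow> (LINT t|circ_measure. F t) * exp (poly q 0)"
    by (intro tendsto_mult tendsto_const S)
  ultimately show ?thesis by (rule LIMSEQ_unique)
qed

text \<open>On the circle \<open>t powi (- n)\<close> is the conjugate of \<open>t ^ n\<close>, so a
  negative power becomes a positive one with conjugated coefficient when only the real part
  counts.\<close>

lemma trig_eq_Re_poly:
  assumes "trig g"
  obtains q where "\<And>t. norm t = 1 \<Longrightarrow> Re (g t) = Re (poly q t)"
proof -
  have "\<exists>q. \<forall>t. norm t = 1 \<longrightarrow> Re (g t) = Re (poly q t)"
    using assms
  proof induct
    case (monom g c n)
    show ?case
    proof (cases "n \<ge> 0")
      case True
      thus ?thesis using monom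
        by (intro exI[of _ "Polynomial.monom c (nat n)"]) (auto simp: poly_monom power_int_def)
    next
      case False
      have "Re (g t) = Re (poly (Polynomial.monom (cnj c) (nat (- n))) t)" if t: "norm t = 1" for t
      proof -
        have "inverse t = cnj t" using t by (simp add: inverse_eq_divide complex_div_cnj[of 1 t])
        hence "t powi n = cnj (t ^ nat (- n))" using False by (simp add: power_int_def)
        hence "g t = cnj (cnj c * t ^ nat (- n))" using monom[OF t] by simp
        thus ?thesis by (simp only: poly_monom cnj.simps)
      qed
      thus ?thesis by blast
    qed
  next
    case (add g h k)
    then obtain q r where "\<forall>t. norm t = 1 \<longrightarrow> Re (g t) = Re (poly q t)" "\<forall>t. norm t = 1 \<longrightarrow> Re (h t) = Re (poly r t)"
      by blast
    thus ?case using add(5) by (intro exI[of _ "q + r"]) auto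
  qed
  thus ?thesis using that by blast
qed

text \<open>A weak form of Jensen's inequality: \<open>f\<close> is multiplied by the outer function \<open>exp G\<close> with
  \<open>Re G\<close> close to \<open>g\<close> on the circle, which leaves the mean value computable.\<close>

lemma mean_exp_le:
  fixes g :: "complex \<Rightarrow> real"
  assumes F: "integrable circ_measure F" and zero: "\<And>n. n > 0 \<Longrightarrow> (LINT t|circ_measure. F t * t powi n) = 0"
    and g: "continuous_on UNIV g" and gb: "\<And>t. \<bar>g t\<bar> \<le> B"
  shows "norm (LINT t|circ_measure. F t) * exp (LINT t|circ_measure. g t) \<le> (LINT t|circ_measure. norm (F t) * exp (g t))"
proof -
  have Fm [measurable]: "F \<in> borel_measurable borel" using borel_measurable_integrable[OF F] by simp
  have gm [measurable]: "g \<in> borel_measurable borel"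
    by (intro borel_measurable_continuous_onI g)
  have ig: "integrable circ_measure g"
    by (rule circ.integrable_const_bound[of _ B]) (use gb in auto)
  have iFg: "integrable circ_measure (\<lambda>t. norm (F t) * exp (g t + e))" for e
  proof (rule Bochner_Integration.integrable_bound[of _ "\<lambda>t. norm (F t) * exp (B + e)"])
    have "g t \<le> B" for t using gb[of t] by linarith
    thus "AE t in circ_measure. norm (norm (F t) * exp (g t + e)) \<le> norm (norm (F t) * exp (B + e))"
      by (intro AE_I2) (simp add: mult_left_mono)
  qed (use F in auto)
  have main: "norm (LINT t|circ_measure. F t) * exp ((LINT t|circ_measure. g t) - e) \<le> (LINT t|circ_measure. norm (F t) * exp (g t + e))"
    if e: "e > 0" for e
  proof -
    obtain h where h: "real_polynomial_function h" "\<And>t. t \<in> sphere 0 1 \<Longrightarrow> \<bar>g t - h t\<bar> < e"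
      using Stone_Weierstrass_real_polynomial_function[OF compact_sphere continuous_on_subset[OF g] e] by blast
    obtain q where q: "\<And>t. norm t = 1 \<Longrightarrow> h t = Re (poly q t)"
      using trig_eq_Re_poly[OF trig_real_polynomial_function[OF h(1)]] by (metis Re_complex_of_real)
    have close: "\<bar>g t - Re (poly q t)\<bar> < e" if "norm t = 1" for t
      using h(2)[of t] q[OF that] that by simp
    have pm [measurable]: "poly q \<in> borel_measurable borel"
      by (intro borel_measurable_continuous_onI continuous_intros)
    have one: "(LINT t|circ_measure. 1 * t powi n) = 0" if "n > 0" for n
      using that by (simp add: integral_powi)
    have ip: "integrable circ_measure (poly q)" "(LINT t|circ_measure. poly q t) = poly q 0"
      using integral_mult_poly[of "\<lambda>_. 1" q] one by (auto simp: circ.prob_space[simplified])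
    have "(LINT t|circ_measure. g t) - e = (LINT t|circ_measure. g t - e)"
      using ig by (simp add: circ.prob_space[simplified])
    also have "\<dots> \<le> (LINT t|circ_measure. Re (poly q t))"
    proof (rule integral_mono_AE)
      show "AE t in circ_measure. g t - e \<le> Re (poly q t)"
        using AE_circ_norm by eventually_elim (use close in force)
    qed (use ig ip in auto)
    also have "\<dots> = Re (poly q 0)" using ip by simp
    finally have lower: "(LINT t|circ_measure. g t) - e \<le> Re (poly q 0)" .
    have "norm (LINT t|circ_measure. F t) * exp ((LINT t|circ_measure. g t) - e) \<le> norm (LINT t|circ_measure. F t) * exp (Re (poly q 0))"
      using lower by (intro mult_left_mono) auto
    also have "\<dots> = norm (LINT t|circ_measure. F t * exp (poly q t))"
      by (simp add: exp_poly_mean[OF F zero] norm_mult)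
    also have "\<dots> \<le> (LINT t|circ_measure. norm (F t * exp (poly q t)))"
      by (rule integral_norm_bound)
    also have "\<dots> \<le> (LINT t|circ_measure. norm (F t) * exp (g t + e))"
    proof (rule integral_mono_AE')
      show "AE t in circ_measure. norm (F t * exp (poly q t)) \<le> norm (F t) * exp (g t + e)"
        using AE_circ_norm
      proof eventually_elim
        case (elim t)
        have "Re (poly q t) \<le> g t + e" using close[OF elim] by linarith
        thus ?case by (simp add: norm_mult mult_left_mono)
      qed
    qed (use iFg in auto)
    finally show ?thesis .
  qed
  \<comment> \<open>One factor \<open>exp e\<close> stems from the mean of \<open>g\<close>, the
    other from the bound on the modulus of \<open>exp (poly q t)\<close>.\<close>
  have "norm (LINT t|circ_measure. F t) * exp (LINT t|circ_measure. g t) \<le> (LINT t|circ_measure. norm (F t) * exp (g t)) * exp (2 * e)"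
    if e: "e > 0" for e
  proof -
    have "norm (LINT t|circ_measure. F t) * exp (LINT t|circ_measure. g t) =
       (norm (LINT t|circ_measure. F t) * exp ((LINT t|circ_measure. g t) - e)) * exp e"
      by (simp add: exp_diff)
    also have "\<dots> \<le> (LINT t|circ_measure. norm (F t) * exp (g t + e)) * exp e"
      using main[OF e] by (intro mult_right_mono) auto
    also have "(LINT t|circ_measure. norm (F t) * exp (g t + e)) = (LINT t|circ_measure. norm (F t) * exp (g t)) * exp e"
      by (simp only: exp_add mult.assoc[symmetric] integral_mult_left_zero)
    finally show ?thesis by (simp only: mult.assoc exp_add[symmetric] mult_2)
  qed
  note * = this
  have "(\<lambda>n. (LINT t|circ_measure. norm (F t) * exp (g t)) * exp (2 * (1 / real (Suc n)))) \<longlonglongrightarrow>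
        (LINT t|circ_measure. norm (F t) * exp (g t)) * exp (2 * 0)"
    by (intro tendsto_intros LIMSEQ_Suc[OF lim_1_over_n])
  hence "(\<lambda>n. (LINT t|circ_measure. norm (F t) * exp (g t)) * exp (2 * (1 / real (Suc n)))) \<longlonglongrightarrow>
        (LINT t|circ_measure. norm (F t) * exp (g t))" by simp
  thus ?thesis
    by (rule LIMSEQ_le_const) (use *[of "1 / real (Suc _)"] in auto)
qed

text \<open>The weight \<open>exp g\<close> with \<open>g\<close> close to \<open>n\<close> on
  \<open>K\<close> and to \<open>0\<close> elsewhere is free on the right side of
  \<open>mean_exp_le\<close>, because \<open>F\<close> vanishes on \<open>K\<close>, while the left
  side grows exponentially in \<open>n\<close> unless the mean of \<open>F\<close> is zero.\<close>

lemma zero_mean_if_zero_on_compact: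
  assumes F: "integrable circ_measure F" and zero: "\<And>n. n > 0 \<Longrightarrow> (LINT t|circ_measure. F t * t powi n) = 0"
    and K: "compact K" "measure circ_measure K > 0" and FK: "AE t in circ_measure. t \<in> K \<longrightarrow> F t = 0"
  shows "(LINT t|circ_measure. F t) = 0"
proof -
  have Fm [measurable]: "F \<in> borel_measurable borel" using borel_measurable_integrable[OF F] by simp
  have Km [measurable]: "K \<in> sets borel" using K by (simp add: compact_imp_closed)
  have ne: "K \<noteq> {}" using K(2) by auto
  define J where "J = (LINT t|circ_measure. norm (F t))"
  have main: "norm (LINT t|circ_measure. F t) * exp (real n * measure circ_measure K) \<le> J" for n
  proof -
    have b: "\<bar>real n * bump K k t\<bar> \<le> real n" for k t
      using bump_bounds[of K k t] by (simp add: mult_left_le)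
    have le: "norm (LINT t|circ_measure. F t) * exp (LINT t|circ_measure. real n * bump K k t) \<le>
          (LINT t|circ_measure. norm (F t) * exp (real n * bump K k t))" for k
    proof (rule mean_exp_le[OF F _ _ b])
      show "continuous_on UNIV (\<lambda>t. real n * bump K k t)"
        by (intro continuous_intros continuous_bump)
    qed (use zero in simp)
    have lim1: "(\<lambda>k. LINT t|circ_measure. real n * bump K k t) \<longlonglongrightarrow> (LINT t|circ_measure. real n * indicator K t)"
    proof (rule integral_dominated_convergence[of _ _ _ "\<lambda>_. real n"])
      show "AE t in circ_measure. (\<lambda>k. real n * bump K k t) \<longlonglongrightarrow> real n * indicator K t"
        by (intro AE_I2 tendsto_mult tendsto_const tendsto_bump K ne)
    qed (use b in auto)
    have lim2: "(\<lambda>k. LINT t|circ_measure. norm (F t) * exp (real n * bump K k t)) \<longlonglongrightarrow>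
        (LINT t|circ_measure. norm (F t) * exp (real n * indicator K t))"
    proof (rule integral_dominated_convergence[of _ _ _ "\<lambda>t. norm (F t) * exp (real n)"])
      show "AE t in circ_measure. (\<lambda>k. norm (F t) * exp (real n * bump K k t)) \<longlonglongrightarrow> norm (F t) * exp (real n * indicator K t)"
        by (intro AE_I2 tendsto_mult tendsto_const tendsto_exp tendsto_bump K ne)
      have "real n * bump K k t \<le> real n" for k t using b[of k t] by linarith
      thus "AE t in circ_measure. norm (norm (F t) * exp (real n * bump K k t)) \<le> norm (F t) * exp (real n)" for k
        by (intro AE_I2) (simp add: mult_left_mono)
    qed (use F in auto)
    have "norm (LINT t|circ_measure. F t) * exp (LINT t|circ_measure. real n * indicator K t) \<le>
       (LINT t|circ_measure. norm (F t) * exp (real n * indicator K t))"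
      by (rule LIMSEQ_le[OF tendsto_mult[OF tendsto_const tendsto_exp[OF lim1]] lim2]) (use le in auto)
    also have "\<dots> = J"
      unfolding J_def
    proof (rule integral_cong_AE)
      show "AE t in circ_measure. norm (F t) * exp (real n * indicator K t) = norm (F t)"
        using FK by eventually_elim (auto simp: indicator_def)
    qed measurable
    finally show ?thesis by simp
  qed
  show ?thesis
  proof (rule ccontr)
    assume "(LINT t|circ_measure. F t) \<noteq> 0"
    hence a: "norm (LINT t|circ_measure. F t) > 0" (is "?a > 0") by simp
    obtain n where n: "J / (?a * measure circ_measure K) < real n" using reals_Archimedean2 by blast
    have "J < ?a * (real n * measure circ_measure K)"
      using n a K(2) by (simp add: field_simps)
    also have "\<dots> \<le> ?a * exp (real n * measure circ_measure K)"
    proof (rule mult_left_mono)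
      show "real n * measure circ_measure K \<le> exp (real n * measure circ_measure K)"
        using exp_ge_add_one_self[of "real n * measure circ_measure K"] by linarith
    qed (use a in simp)
    finally show False using main[of n] by simp
  qed
qed

text \<open>After division by the lowest power of \<open>t\<close> that occurs, \<open>f\<close> is
  analytic with nonzero mean. It vanishes wherever \<open>g\<close> does not, hence on a compact set
  of positive measure, against \<open>zero_mean_if_zero_on_compact\<close>.\<close>

lemma analytic_mult_eq_0:
  assumes f: "f \<in> Lp 1" "\<And>n. n < 0 \<Longrightarrow> fourier f n = 0" and fg: "f * g = 0" and g: "g \<noteq> 0"
  shows "f = 0"
proof (rule ccontr)
  assume "f \<noteq> 0"
  then obtain n0 where n0: "fourier f n0 \<noteq> 0" using fourier_unique_0[OF f(1)] by blast
  hence "n0 \<ge> 0" using f(2)[of n0] by force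
  define k where "k = (LEAST k::nat. fourier f (int k) \<noteq> 0)"
  have k: "fourier f (int k) \<noteq> 0"
    unfolding k_def by (rule LeastI[of _ "nat n0"]) (use n0 \<open>n0 \<ge> 0\<close> in simp)
  have less: "fourier f n = 0" if "n < int k" for n
  proof (cases "n < 0")
    case False
    thus ?thesis using not_less_Least[of "nat n" "\<lambda>k. fourier f (int k) \<noteq> 0"] that by (simp add: k_def)
  qed (use f in auto)
  define h where "h = tpow (- int k) * f"
  have hL: "h \<in> Lp 1" unfolding h_def by (intro Lp_tpow_mult f) simp
  obtain H where H [measurable]: "H \<in> borel_measurable borel" and hH: "h = abs_circ_fun H" by (rule circ_fun_cases)
  obtain G where G [measurable]: "G \<in> borel_measurable borel" and gG: "g = abs_circ_fun G" by (rule circ_fun_cases)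
  have iH: "integrable circ_measure H" using hL by (simp add: hH LpD in_Lp_1)
  have coef: "(LINT t|circ_measure. H t * t powi n) = fourier f (int k - n)" for n
  proof -
    have "(LINT t|circ_measure. H t * t powi n) = fourier h (- n)" by (simp add: hH fourier.abs_eq)
    moreover have "- n - - int k = int k - n" by simp
    ultimately show ?thesis by (simp only: h_def fourier_tpow_mult)
  qed
  have "h * g = 0" using fg by (simp add: h_def mult.assoc)
  hence "circ_eq (\<lambda>t. H t * G t) (\<lambda>_. 0)"
    unfolding hH gG zero_circ_fun_def
    by (simp add: times_circ_fun.abs_eq Quotient3_rel[OF Quotient3_circ_fun, symmetric])
  hence AE: "AE t in circ_measure. H t * G t = 0" by (simp add: circ_eq_def)
  have B: "{t. G t \<noteq> 0} \<in> sets borel" by measurable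
  have "emeasure circ_measure {t. G t \<noteq> 0} \<noteq> 0"
  proof
    assume "emeasure circ_measure {t. G t \<noteq> 0} = 0"
    hence "AE t in circ_measure. G t = 0"
      using AE_iff_measurable[of "{t. G t \<noteq> 0}" circ_measure "\<lambda>t. G t = 0"] B by auto
    hence "circ_eq G (\<lambda>_. 0)" by (simp add: circ_eq_def)
    hence "g = 0" unfolding gG zero_circ_fun_def
      using Quotient3_rel_abs[OF Quotient3_circ_fun] by blast
    thus False using g by simp
  qed
  then obtain K where K: "compact K" "K \<subseteq> {t. G t \<noteq> 0}" "measure circ_measure K > 0"
    using positive_measure_compact_subset[OF B] by (auto simp: zero_less_iff_neq_zero)
  have "(LINT t|circ_measure. H t) = 0"
  proof (rule zero_mean_if_zero_on_compact[OF iH _ K(1,3)])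
    show "(LINT t|circ_measure. H t * t powi n) = 0" if "n > 0" for n
      unfolding coef by (rule less) (use that in simp)
    show "AE t in circ_measure. t \<in> K \<longrightarrow> H t = 0"
      using AE by eventually_elim (use K(2) in auto)
  qed
  thus False using coef[of 0] k by simp
qed

section \<open>Density of trigonometric polynomials\<close>

definition Lp_closure :: "real \<Rightarrow> circ_fun set \<Rightarrow> circ_fun set" where
  "Lp_closure p S = {h \<in> Lp p. \<forall>e>0. \<exists>T\<in>S. Lp_norm p (h - T) < e}"

lemma subset_Lp_closure: "S \<subseteq> Lp p \<Longrightarrow> S \<subseteq> Lp_closure p S"
proof
  fix f assume "S \<subseteq> Lp p" "f \<in> S"
  moreover have "Lp_norm p (f - f) < e" if "e > 0" for e using that by simp
  ultimately show "f \<in> Lp_closure p S" unfolding Lp_closure_def by blast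
qed

lemma closed_subspace_Lp_closure:
  assumes p: "1 < p" and S: "S \<subseteq> Lp p" "cvs.subspace S"
  shows "closed_subspace p (Lp_closure p S)"
  unfolding closed_subspace_def
proof (intro conjI allI impI)
  show "Lp_closure p S \<subseteq> Lp p" unfolding Lp_closure_def by blast
  show "cvs.subspace (Lp_closure p S)"
    unfolding cvs.subspace_def
  proof (intro conjI ballI allI)
    show "0 \<in> Lp_closure p S" using subset_Lp_closure[OF S(1)] cvs.subspace_0[OF S(2)] by blast
  next
    fix f g assume fg: "f \<in> Lp_closure p S" "g \<in> Lp_closure p S"
    hence L: "f \<in> Lp p" "g \<in> Lp p" by (auto simp: Lp_closure_def)
    show "f + g \<in> Lp_closure p S"
      unfolding Lp_closure_def
    proof (intro CollectI conjI allI impI)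
      show "f + g \<in> Lp p" using L p by (simp add: Lp_add)
      fix e :: real assume "e > 0"
      then obtain T U where T: "T \<in> S" "Lp_norm p (f - T) < e / 2" and U: "U \<in> S" "Lp_norm p (g - U) < e / 2"
        using fg half_gt_zero[OF \<open>e > 0\<close>] unfolding Lp_closure_def by blast
      have "(f + g) - (T + U) = (f - T) + (g - U)" by simp
      moreover have "Lp_norm p ((f - T) + (g - U)) \<le> Lp_norm p (f - T) + Lp_norm p (g - U)"
        using p L T U S by (intro Lp_norm_triangle Lp_diff) auto
      ultimately have "Lp_norm p ((f + g) - (T + U)) \<le> Lp_norm p (f - T) + Lp_norm p (g - U)"
        by (simp only:)
      also have "\<dots> < e / 2 + e / 2" using T U by (intro add_strict_mono) auto
      finally show "\<exists>T\<in>S. Lp_norm p (f + g - T) < e"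
        using cvs.subspace_add[OF S(2) T(1) U(1)] by auto
    qed
  next
    fix z f assume f: "f \<in> Lp_closure p S"
    show "cscale z f \<in> Lp_closure p S"
      unfolding Lp_closure_def
    proof (intro CollectI conjI allI impI)
      show "cscale z f \<in> Lp p" using f by (simp add: Lp_closure_def Lp_cscale)
      fix e :: real assume e: "e > 0"
      hence "e / (norm z + 1) > 0" by (intro divide_pos_pos) (auto simp: add_nonneg_pos)
      then obtain T where T: "T \<in> S" "Lp_norm p (f - T) < e / (norm z + 1)"
        using f unfolding Lp_closure_def by blast
      have "Lp_norm p (cscale z f - cscale z T) = norm z * Lp_norm p (f - T)"
        using p by (simp add: cscale_diff_right[symmetric] Lp_norm_cscale)
      also have "\<dots> \<le> norm z * (e / (norm z + 1))" using T by (intro mult_left_mono) auto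
      also have "\<dots> < e"
      proof -
        have "norm z + 1 > 0" by (simp add: add_nonneg_pos)
        thus ?thesis using e by (simp add: pos_divide_less_eq)
      qed
      finally show "\<exists>T\<in>S. Lp_norm p (cscale z f - T) < e"
        using cvs.subspace_scale[OF S(2) T(1), of z] by blast
    qed
  qed
next
  fix u g
  assume u: "(\<forall>n::nat. u n \<in> Lp_closure p S) \<and> g \<in> Lp p \<and> (\<lambda>n. Lp_norm p (u n - g)) \<longlonglongrightarrow> 0"
  show "g \<in> Lp_closure p S"
    unfolding Lp_closure_def
  proof (intro CollectI conjI allI impI)
    show "g \<in> Lp p" using u by simp
    fix e :: real assume e: "e > 0"
    have "\<forall>\<^sub>F n in sequentially. Lp_norm p (u n - g) < e / 2"
      using u e by (intro order_tendstoD(2)[of _ 0]) auto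
    then obtain n where n: "Lp_norm p (u n - g) < e / 2" by (auto simp: eventually_sequentially)
    obtain T where T: "T \<in> S" "Lp_norm p (u n - T) < e / 2"
      using u half_gt_zero[OF e] unfolding Lp_closure_def by blast
    have "Lp_norm p (g - T) \<le> Lp_norm p (g - u n) + Lp_norm p (u n - T)"
      using u T S p by (intro Lp_norm_triangle_mid) (auto simp: Lp_closure_def)
    also have "\<dots> < e / 2 + e / 2" using n T by (intro add_strict_mono) (auto simp: Lp_norm_minus_commute)
    finally show "\<exists>T\<in>S. Lp_norm p (g - T) < e" using T(1) by auto
  qed
qed

lemma trig_sum_measurable [measurable]: "trig_sum N c \<in> borel_measurable borel"
  unfolding trig_sum_def[abs_def] by measurable

definition Trig :: "circ_fun set" where
  "Trig = {f. \<exists>N c. f = abs_circ_fun (trig_sum N c)}"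

lemma abs_circ_fun_eq_iff:
  "f \<in> borel_measurable borel \<Longrightarrow> g \<in> borel_measurable borel \<Longrightarrow>
    abs_circ_fun f = abs_circ_fun g \<longleftrightarrow> (AE t in circ_measure. f t = g t)"
  using Quotient3_rel[OF Quotient3_circ_fun, of f g] by (simp add: circ_eq_def)

lemma abs_trig_Trig:
  assumes "trig g" "g \<in> borel_measurable borel"
  shows "abs_circ_fun g \<in> Trig"
proof -
  obtain N c where c: "\<And>t. norm t = 1 \<Longrightarrow> g t = trig_sum N c t"
    using trig_imp_trig_sum[OF assms(1)] by blast
  have "AE t in circ_measure. g t = trig_sum N c t"
    using AE_circ_norm by eventually_elim (rule c)
  hence "abs_circ_fun g = abs_circ_fun (trig_sum N c)"
    using assms(2) by (simp add: abs_circ_fun_eq_iff)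
  thus ?thesis unfolding Trig_def by blast
qed

lemma tpow_abs: "tpow n = abs_circ_fun (\<lambda>t. t powi n)"
  unfolding tpow_def by simp

lemma abs_trig_sum: "abs_circ_fun (trig_sum N c) = (\<Sum>n\<in>{- int N..int N}. cscale (c n) (tpow n))"
proof -
  have "(\<Sum>n\<in>S. cscale (c n) (tpow n)) = abs_circ_fun (\<lambda>t. \<Sum>n\<in>S. c n * t powi n)" if "finite S" for S
    using that
  proof induct
    case (insert m S)
    have [measurable]: "(\<lambda>t. \<Sum>n\<in>S. c n * t powi n) \<in> borel_measurable borel" by measurable
    show ?case
      using insert by (simp add: tpow_abs cscale.abs_eq plus_circ_fun.abs_eq)
  qed (simp add: zero_circ_fun_def)
  thus ?thesis by (simp add: trig_sum_def[abs_def])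
qed

lemma trig_trig_sum: "trig (trig_sum N c)"
proof -
  have "trig (\<lambda>t. \<Sum>n\<in>S. c n * t powi n)" if "finite S" for S
    using that
  proof induct
    case empty
    show ?case by (rule trig.monom[of _ 0 0]) simp
  next
    case (insert m S)
    show ?case
      by (rule trig.add[OF trig.monom[of "\<lambda>t. c m * t powi m" "c m" m] insert(3)])
        (use insert in auto)
  qed
  thus ?thesis by (simp add: trig_sum_def[abs_def])
qed

lemma trig_cscale: "trig g \<Longrightarrow> trig (\<lambda>t. z * g t)"
  by (rule trig_mult[OF trig.monom[of "\<lambda>_. z" z 0]]) auto

lemma Trig_subspace: "cvs.subspace Trig"
  unfolding cvs.subspace_def
proof (intro conjI ballI allI)
  show "0 \<in> Trig" unfolding zero_circ_fun_def
    by (rule abs_trig_Trig) (auto intro: trig.monom[of _ 0 0])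
next
  fix f g assume "f \<in> Trig" "g \<in> Trig"
  then obtain N c M d where f: "f = abs_circ_fun (trig_sum N c)" and g: "g = abs_circ_fun (trig_sum M d)"
    by (auto simp: Trig_def)
  have "abs_circ_fun (\<lambda>t. trig_sum N c t + trig_sum M d t) \<in> Trig"
    by (rule abs_trig_Trig) (auto intro: trig.add[OF trig_trig_sum trig_trig_sum])
  thus "f + g \<in> Trig" by (simp add: f g plus_circ_fun.abs_eq)
next
  fix z f assume "f \<in> Trig"
  then obtain N c where f: "f = abs_circ_fun (trig_sum N c)" by (auto simp: Trig_def)
  have "abs_circ_fun (\<lambda>t. z * trig_sum N c t) \<in> Trig"
    by (rule abs_trig_Trig) (auto intro: trig_cscale[OF trig_trig_sum])
  thus "cscale z f \<in> Trig" by (simp add: f cscale.abs_eq)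
qed

lemma tpow_Trig: "tpow n \<in> Trig"
  unfolding tpow_abs by (rule abs_trig_Trig) (auto intro: trig.monom[of _ 1 n])

lemma Trig_Lp: "p > 0 \<Longrightarrow> f \<in> Trig \<Longrightarrow> f \<in> Lp p"
  by (auto simp: Trig_def abs_trig_sum intro!: Lp_sum Lp_cscale)

lemma fourier_trig_sum: "fourier (abs_circ_fun (trig_sum N c)) n = (if \<bar>n\<bar> \<le> int N then c n else 0)"
proof -
  have "fourier (abs_circ_fun (trig_sum N c)) n = (\<Sum>m\<in>{- int N..int N}. c m * (if n = m then 1 else 0))"
    unfolding abs_trig_sum
    by (subst fourier_sum) (simp_all add: Lp_cscale fourier_cscale fourier_tpow)
  also have "\<dots> = (if \<bar>n\<bar> \<le> int N then c n else 0)"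
    by (simp add: if_distrib[of "\<lambda>x. _ * x"] sum.delta abs_le_iff cong: if_cong)
  finally show ?thesis .
qed

lemma Trig_expansion:
  assumes "f \<in> Trig"
  obtains N where "f = abs_circ_fun (trig_sum N (fourier f))" "f = (\<Sum>n\<in>{- int N..int N}. cscale (fourier f n) (tpow n))"
    "\<And>n. \<bar>n\<bar> > int N \<Longrightarrow> fourier f n = 0"
proof -
  obtain N c where f: "f = abs_circ_fun (trig_sum N c)" using assms by (auto simp: Trig_def)
  have "f = abs_circ_fun (trig_sum N (fourier f))"
    unfolding f fourier_trig_sum by (intro arg_cong[where f = abs_circ_fun]) (auto simp: trig_sum_def abs_le_iff intro!: ext sum.cong)
  moreover have "\<And>n. \<bar>n\<bar> > int N \<Longrightarrow> fourier f n = 0" by (simp add: f fourier_trig_sum)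
  moreover have "f = (\<Sum>n\<in>{- int N..int N}. cscale (fourier f n) (tpow n))"
    by (rule trans[OF calculation(1) abs_trig_sum])
  ultimately show ?thesis using that by blast
qed

text \<open>A function separating \<open>f\<close> from the closure would annihilate every power of
  \<open>t\<close>, so all its Fourier coefficients would vanish.\<close>

lemma Trig_dense:
  assumes p: "1 < p" and f: "f \<in> Lp p" and e: "e > 0"
  obtains T where "T \<in> Trig" "Lp_norm p (f - T) < e"
proof -
  have TL: "Trig \<subseteq> Lp p" using Trig_Lp p by auto
  have "f \<in> Lp_closure p Trig"
  proof (rule ccontr)
    assume "f \<notin> Lp_closure p Trig"
    then obtain w where w: "w \<in> Lp (dual_exponent p)" "\<And>y. y \<in> Lp_closure p Trig \<Longrightarrow> fourier (w * y) 0 = 0" "fourier (w * f) 0 \<noteq> 0"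
      using separation[OF p closed_subspace_Lp_closure[OF p TL Trig_subspace] f] by blast
    have "fourier w n = 0" for n
    proof -
      have "fourier (w * tpow (- n)) 0 = 0"
        using w(2) subset_Lp_closure[OF TL] tpow_Trig by blast
      thus ?thesis by (simp add: mult.commute[of w] fourier_tpow_mult)
    qed
    hence "w = 0" using fourier_unique_0 Lp_norm_1_le(1)[OF dual_exponent(1)[OF p] w(1)] by blast
    thus False using w(3) by simp
  qed
  thus ?thesis using that e unfolding Lp_closure_def by blast
qed

lemma fourier_Trig_mult:
  assumes "u \<in> Trig" "v \<in> Lp 1" "\<And>n. fourier u n * fourier v (- n) = 0"
  shows "fourier (u * v) 0 = 0"
proof -
  obtain N where u: "u = (\<Sum>n\<in>{- int N..int N}. cscale (fourier u n) (tpow n))"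
    using Trig_expansion[OF assms(1)] by blast
  have "u * v = (\<Sum>n\<in>{- int N..int N}. cscale (fourier u n) (tpow n * v))"
    by (subst u) (simp add: sum_distrib_right cscale_mult_left)
  hence "fourier (u * v) 0 = (\<Sum>n\<in>{- int N..int N}. fourier u n * fourier v (- n))"
    by (simp add: fourier_sum Lp_cscale Lp_tpow_mult assms fourier_cscale fourier_tpow_mult)
  also have "\<dots> = 0" by (intro sum.neutral ballI assms(3))
  finally show ?thesis .
qed

section \<open>The theorem of M. Riesz\<close>

text \<open>The Riesz projection as a relation on \<open>Lp 1\<close>. It can be handled before
  existence is known, whereas the definite description \<open>riesz\<close> yields nothing until
  then.\<close>

definition analytic_part :: "circ_fun \<Rightarrow> circ_fun \<Rightarrow> bool" where
  "analytic_part f g \<longleftrightarrow> f \<in> Lp 1 \<and> g \<in> Lp 1 \<and> (\<forall>n. fourier g n = (if n \<ge> 0 then fourier f n else 0))"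

lemma analytic_part_unique: "analytic_part f g \<Longrightarrow> analytic_part f h \<Longrightarrow> g = h"
  unfolding analytic_part_def by (intro fourier_unique) auto

lemma analytic_part_add: "analytic_part f g \<Longrightarrow> analytic_part f' g' \<Longrightarrow> analytic_part (f + f') (g + g')"
  by (auto simp: analytic_part_def fourier_add Lp_add)

lemma analytic_part_cscale: "analytic_part f g \<Longrightarrow> analytic_part (cscale z f) (cscale z g)"
  by (auto simp: analytic_part_def fourier_cscale Lp_cscale)

lemma analytic_part_diff: "analytic_part f g \<Longrightarrow> analytic_part f' g' \<Longrightarrow> analytic_part (f - f') (g - g')"
  by (auto simp: analytic_part_def fourier_diff Lp_diff)

lemma Trig_analytic_part:
  assumes "f \<in> Trig"
  obtains g where "g \<in> Trig" "analytic_part f g"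
proof -
  obtain N c where f: "f = abs_circ_fun (trig_sum N c)" using assms by (auto simp: Trig_def)
  define g where "g = abs_circ_fun (trig_sum N (\<lambda>n. if n \<ge> 0 then c n else 0))"
  have "g \<in> Trig" unfolding g_def Trig_def by blast
  moreover have "analytic_part f g"
    using \<open>g \<in> Trig\<close> assms Trig_Lp[of 1] unfolding analytic_part_def by (auto simp: f g_def fourier_trig_sum)
  ultimately show ?thesis using that by blast
qed

lemma Parseval_finite:
  assumes "finite S"
  shows "(LINT t|circ_measure. (norm (\<Sum>n\<in>S. c n * t powi n))\<^sup>2) = (\<Sum>n\<in>S. (norm (c n))\<^sup>2)"
proof -
  have i: "integrable circ_measure (\<lambda>t. z * t powi m)" for z :: complex and m
    using integrable_powi[of "\<lambda>_. z" m] by simp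
  have "complex_of_real (LINT t|circ_measure. (norm (\<Sum>n\<in>S. c n * t powi n))\<^sup>2) =
     (LINT t|circ_measure. of_real ((norm (\<Sum>n\<in>S. c n * t powi n))\<^sup>2))"
    by (rule integral_complex_of_real[symmetric])
  also have "\<dots> = (LINT t|circ_measure. (\<Sum>n\<in>S. \<Sum>m\<in>S. (c n * cnj (c m)) * t powi (n - m)))"
  proof (rule integral_cong_AE)
    show "AE t in circ_measure. of_real ((norm (\<Sum>n\<in>S. c n * t powi n))\<^sup>2) = (\<Sum>n\<in>S. \<Sum>m\<in>S. (c n * cnj (c m)) * t powi (n - m))"
      using AE_circ_norm
    proof eventually_elim
      case (elim t)
      hence t0: "t \<noteq> 0" by auto
      have inv: "cnj t = inverse t" using elim by (simp add: inverse_eq_divide complex_div_cnj[of 1 t])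
      have "of_real ((norm (\<Sum>n\<in>S. c n * t powi n))\<^sup>2) = (\<Sum>n\<in>S. c n * t powi n) * cnj (\<Sum>n\<in>S. c n * t powi n)"
        by (rule complex_norm_square)
      also have "cnj (\<Sum>n\<in>S. c n * t powi n) = (\<Sum>m\<in>S. cnj (c m) * t powi (- m))"
        by (simp add: power_int_minus inv power_int_inverse)
      also have "(\<Sum>n\<in>S. c n * t powi n) * (\<Sum>m\<in>S. cnj (c m) * t powi (- m)) =
          (\<Sum>n\<in>S. \<Sum>m\<in>S. (c n * cnj (c m)) * t powi (n - m))"
        unfolding sum_product using t0 by (intro sum.cong refl) (simp add: power_int_diff power_int_minus field_simps)
      finally show ?case .
    qed
  qed measurable
  also have "\<dots> = (\<Sum>n\<in>S. \<Sum>m\<in>S. (c n * cnj (c m)) * (if n - m = 0 then 1 else 0))"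
    by (subst Bochner_Integration.integral_sum, intro Bochner_Integration.integrable_sum i,
        intro sum.cong refl, subst Bochner_Integration.integral_sum, intro i)
      (simp add: integral_powi)
  also have "\<dots> = (\<Sum>n\<in>S. c n * cnj (c n))"
    using assms by (intro sum.cong refl) (simp add: if_distrib[of "\<lambda>x. _ * x"] sum.delta cong: if_cong)
  also have "\<dots> = (\<Sum>n\<in>S. of_real ((norm (c n))\<^sup>2))"
    by (intro sum.cong refl complex_norm_square[symmetric])
  finally have "complex_of_real (LINT t|circ_measure. (norm (\<Sum>n\<in>S. c n * t powi n))\<^sup>2) = of_real (\<Sum>n\<in>S. (norm (c n))\<^sup>2)"
    by simp
  thus ?thesis by (simp only: of_real_eq_iff)
qed

text \<open>By Parseval, discarding coefficients cannot increase the \<open>L^2\<close> norm. This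
  controls the approximation error in \<open>riesz_bound_le_2\<close>, which is uniformly small but
  has no sign.\<close>

lemma Lp_norm_2_Trig:
  assumes f: "f \<in> Trig" and fg: "analytic_part f g"
  shows "Lp_norm 2 g \<le> Lp_norm 2 f"
proof -
  obtain N c where fc: "f = abs_circ_fun (trig_sum N c)" using f by (auto simp: Trig_def)
  define d where "d n = (if n \<ge> 0 then c n else 0)" for n
  have "g = abs_circ_fun (trig_sum N d)"
  proof (rule analytic_part_unique[OF fg])
    have "abs_circ_fun (trig_sum N d) \<in> Trig" unfolding Trig_def by blast
    thus "analytic_part f (abs_circ_fun (trig_sum N d))"
      using f Trig_Lp[of 1] unfolding analytic_part_def by (auto simp: fc fourier_trig_sum d_def)
  qed
  have 2: "Lp_norm 2 (abs_circ_fun (trig_sum N c)) = sqrt (\<Sum>n\<in>{- int N..int N}. (norm (c n))\<^sup>2)" for c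
  proof -
    have "(LINT t|circ_measure. norm (trig_sum N c t) powr 2) = (LINT t|circ_measure. (norm (trig_sum N c t))\<^sup>2)"
      by (intro Bochner_Integration.integral_cong refl) (auto simp: powr_numeral)
    also have "\<dots> = (\<Sum>n\<in>{- int N..int N}. (norm (c n))\<^sup>2)"
      unfolding trig_sum_def by (rule Parseval_finite) simp
    finally show ?thesis by (simp add: Lp_norm.abs_eq powr_half_sqrt sum_nonneg)
  qed
  show ?thesis
    unfolding fc \<open>g = _\<close> 2 by (intro real_sqrt_le_mono sum_mono) (auto simp: d_def)
qed

text \<open>The factor 2 comes from \<open>x powr p \<le> 1 + x powr 2\<close> at
  \<open>x = |f t| / l\<close>, together with \<open>2 \<le> 2 powr p\<close>.\<close>

lemma Lp_norm_le_2:
  assumes p: "1 < p" "p \<le> 2" and f: "f \<in> Lp p" "f \<in> Lp 2"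
  shows "Lp_norm p f \<le> 2 * Lp_norm 2 f"
proof (cases "f = 0")
  case False
  define l where "l = Lp_norm 2 f"
  have l: "l > 0" unfolding l_def using False f by (intro Lp_norm_pos) auto
  have "Lp_int p f \<le> l powr p * (1 + Lp_int 2 f / l powr 2)"
    using f unfolding LpD
  proof (transfer fixing: p l)
    fix f :: "complex \<Rightarrow> complex"
    assume i: "integrable circ_measure (\<lambda>t. cmod (f t) powr p)" "integrable circ_measure (\<lambda>t. cmod (f t) powr 2)"
    have pw: "cmod (f t) powr p \<le> l powr p * (1 + cmod (f t) powr 2 / l powr 2)" for t
    proof -
      define x where "x = cmod (f t) / l"
      have x: "x \<ge> 0" using l by (simp add: x_def)
      have "x powr p \<le> 1 + x powr 2"
      proof (cases "x \<le> 1")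
        case True
        hence "x powr p \<le> 1" using powr_mono2[of p x 1] x p by simp
        thus ?thesis by (simp add: add_increasing2)
      next
        case False
        hence "x powr p \<le> x powr 2" using p by (intro powr_mono) auto
        thus ?thesis by simp
      qed
      hence "l powr p * x powr p \<le> l powr p * (1 + x powr 2)" using l by (intro mult_left_mono) auto
      thus ?thesis using l by (simp add: x_def powr_divide)
    qed
    have "(LINT t|circ_measure. cmod (f t) powr p) \<le> (LINT t|circ_measure. l powr p * (1 + cmod (f t) powr 2 / l powr 2))"
      by (intro integral_mono i pw integrable_mult_right Bochner_Integration.integrable_add integrable_divide) simp
    also have "\<dots> = l powr p * (1 + (LINT t|circ_measure. cmod (f t) powr 2) / l powr 2)"
      using i by (simp add: circ.prob_space[simplified])
    finally show "(LINT t|circ_measure. cmod (f t) powr p) \<le> l powr p * (1 + (LINT t|circ_measure. cmod (f t) powr 2) / l powr 2)" .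
  qed
  also have "Lp_int 2 f / l powr 2 = 1" using l by (simp add: Lp_int_Lp_norm l_def[symmetric])
  also have "l powr p * (1 + 1) \<le> l powr p * 2 powr p"
    using powr_mono[of 1 p "2::real"] p by (intro mult_left_mono) auto
  also have "\<dots> = (2 * l) powr p" using l by (simp add: powr_mult)
  finally have "Lp_norm p f powr p \<le> (2 * l) powr p" using p by (simp add: Lp_int_Lp_norm)
  thus ?thesis
    using powr_less_mono2[of p "2 * l" "Lp_norm p f"] p l unfolding l_def by (smt (verit))
qed simp

text \<open>Near \<open>pi / 2\<close> the cosine degenerates and the term
  \<open>- B * cos (p * \<theta>)\<close> carries the estimate: there \<open>p * \<theta>\<close>
  lies beyond \<open>pi / 2\<close>, and \<open>p \<le> 2\<close> keeps it below \<open>pi\<close>.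
  Away from \<open>pi / 2\<close> a large \<open>A\<close> suffices.\<close>

lemma cos_power_inequality:
  fixes p :: real
  assumes p: "1 < p" "p \<le> 2"
  obtains A B where "A \<ge> 0" "B \<ge> 0"
    "\<And>\<theta>. \<bar>\<theta>\<bar> < pi / 2 \<Longrightarrow> 1 \<le> A * cos \<theta> powr p - B * cos (p * \<theta>)"
proof -
  \<comment> \<open>The midpoint of \<open>pi / (2 * p)\<close> and \<open>pi / 2\<close>, so that
    \<open>cos a > 0\<close> and \<open>cos (p * a) < 0\<close> hold simultaneously.\<close>
  define a where "a = (pi / (2 * p) + pi / 2) / 2"
  have a1: "pi / (2 * p) < pi / 2" using p by (simp add: field_simps)
  have "x < (x + y) / 2 \<and> (x + y) / 2 < y" if "x < y" for x y :: real
    using that by (simp add: field_simps)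
  from this[OF a1] have a: "pi / (2 * p) < a" "a < pi / 2" by (auto simp: a_def)
  have a0: "a > 0" using a(1) p pi_gt_zero by (smt (verit) divide_pos_pos mult_pos_pos)
  have pa: "pi / 2 < p * a" "p * a < pi"
  proof -
    have "p * (pi / (2 * p)) < p * a" using a p by (intro mult_strict_left_mono) auto
    thus "pi / 2 < p * a" using p by simp
    have "p * a < p * (pi / 2)" using a p by (intro mult_strict_left_mono) auto
    also have "\<dots> \<le> 2 * (pi / 2)" using p by (intro mult_right_mono) auto
    finally show "p * a < pi" by simp
  qed
  have cpa: "cos (p * a) < 0"
    using cos_monotone_0_pi[of "pi / 2" "p * a"] pa by simp
  have ca: "cos a > 0" using a a0 by (intro cos_gt_zero_pi) auto
  define B where "B = 1 / (- cos (p * a))"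
  define A where "A = (1 + B) / cos a powr p"
  have B: "B > 0" using cpa by (simp add: B_def)
  have A: "A > 0" using B ca by (simp add: A_def)
  have main: "1 \<le> A * cos t powr p - B * cos (p * t)" if t: "0 \<le> t" "t < pi / 2" for t
  proof (cases "t \<ge> a")
    case True
    have "cos (p * t) \<le> cos (p * a)"
    proof (rule cos_monotone_0_pi_le)
      show "p * a \<le> p * t" using True p by simp
      have "p * t \<le> 2 * (pi / 2)" using t p by (intro mult_mono) auto
      thus "p * t \<le> pi" by simp
    qed (use p a0 in simp)
    hence "B * (- cos (p * t)) \<ge> B * (- cos (p * a))" using B by (intro mult_left_mono) auto
    moreover have "B * (- cos (p * a)) = 1" using cpa by (simp add: B_def)
    moreover have "A * cos t powr p \<ge> 0" using A by simp
    ultimately show ?thesis by simp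
  next
    case False
    have "cos a \<le> cos t" using False t a by (intro cos_monotone_0_pi_le) auto
    hence "A * cos a powr p \<le> A * cos t powr p" using ca A p by (intro mult_left_mono powr_mono2) auto
    moreover have "A * cos a powr p = 1 + B" using ca by (simp add: A_def)
    moreover have "B * cos (p * t) \<le> B * 1" using B by (intro mult_left_mono) auto
    ultimately show ?thesis by linarith
  qed
  show ?thesis
  proof (rule that[of A B])
    fix t :: real assume "\<bar>t\<bar> < pi / 2"
    thus "1 \<le> A * cos t powr p - B * cos (p * t)"
      using main[of "\<bar>t\<bar>"] by (cases "t \<ge> 0") auto
  qed (use A B in auto)
qed

text \<open>Both sides scale by \<open>r powr p\<close> under \<open>z\<close> to
  \<open>r * z\<close> with \<open>r > 0\<close>, so only the argument of \<open>z\<close> matters,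
  and its absolute value is below \<open>pi / 2\<close>.\<close>

lemma norm_powr_le_Re:
  fixes p :: real
  assumes p: "1 < p" "p \<le> 2"
  obtains A B where "A \<ge> 0" "B \<ge> 0"
    "\<And>z. Re z > 0 \<Longrightarrow> norm z powr p \<le> A * Re z powr p - B * Re (z powr of_real p)"
proof -
  obtain A B where AB: "A \<ge> 0" "B \<ge> 0"
    "\<And>\<theta>. \<bar>\<theta>\<bar> < pi / 2 \<Longrightarrow> 1 \<le> A * cos \<theta> powr p - B * cos (p * \<theta>)"
    using cos_power_inequality[OF p] by blast
  show ?thesis
  proof (rule that[OF AB(1,2)])
    fix z :: complex assume z: "Re z > 0"
    hence z0: "z \<noteq> 0" by auto
    define t where "t = Im (Ln z)"
    have t: "\<bar>t\<bar> < pi / 2" using Re_Ln_pos_lt[OF z0] z unfolding t_def by blast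
    have cost: "cos t \<ge> 0" using t by (intro cos_ge_zero) auto
    have "Re z = Re (exp (Ln z))" using z0 by simp
    also have "\<dots> = norm z * cos t"
      using z0 by (simp only: Re_exp t_def Re_Ln) simp
    finally have "Re z powr p = norm z powr p * cos t powr p"
      using cost by (simp add: powr_mult)
    moreover have "Re (z powr of_real p) = norm z powr p * cos (p * t)"
      using z0 by (simp add: powr_def Re_exp t_def)
    moreover have "norm z powr p * 1 \<le> norm z powr p * (A * cos t powr p - B * cos (p * t))"
      by (intro mult_left_mono AB(3) t) auto
    ultimately show "norm z powr p \<le> A * Re z powr p - B * Re (z powr of_real p)"
      by (simp add: algebra_simps)
  qed
qed

text \<open>The maximum modulus principle for \<open>exp (- poly q z)\<close>, whose modulus is
  \<open>exp (- Re (poly q z))\<close>, acts as a minimum principle for the real part.\<close>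

lemma Re_poly_pos_in_disc:
  fixes q :: "complex poly"
  assumes pos: "\<And>t. norm t = 1 \<Longrightarrow> Re (poly q t) > 0" and z: "norm z \<le> 1"
  shows "Re (poly q z) > 0"
proof -
  have c: "continuous_on (sphere 0 1) (\<lambda>t. Re (poly q t))" by (intro continuous_intros)
  have ne: "sphere (0::complex) 1 \<noteq> {}" by (auto intro: exI[of _ 1])
  obtain t0 :: complex where t0: "t0 \<in> sphere 0 1" "\<And>t. t \<in> sphere 0 1 \<Longrightarrow> Re (poly q t0) \<le> Re (poly q t)"
    using continuous_attains_inf[OF compact_sphere ne c] by blast
  define m where "m = Re (poly q t0)"
  have m: "m > 0" unfolding m_def by (rule pos) (use t0 in simp)
  have "norm (exp (- poly q z)) \<le> exp (- m)"
  proof (rule maximum_modulus_frontier[of "\<lambda>z. exp (- poly q z)" "cball 0 1"])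
    show "(\<lambda>z. exp (- poly q z)) holomorphic_on interior (cball 0 1)"
      by (intro holomorphic_intros)
    show "continuous_on (closure (cball 0 1)) (\<lambda>z. exp (- poly q z))"
      by (intro continuous_intros)
    show "norm (exp (- poly q t)) \<le> exp (- m)" if "t \<in> frontier (cball 0 1)" for t
      using t0(2)[of t] that by (simp add: m_def)
  qed (use z in auto)
  thus ?thesis using m by simp
qed

text \<open>Since \<open>R > 1\<close>, the Taylor coefficients are absolutely summable. The partial
  sums are therefore bounded by a constant on the circle and can be integrated term by term.\<close>

lemma mean_of_holomorphic:
  assumes R: "R > 1" and h: "h holomorphic_on ball 0 R" and meas: "h \<in> borel_measurable borel"
  shows "integrable circ_measure h" "(LINT t|circ_measure. h t) = h 0"
proof -
  define a where "a n = (deriv ^^ n) h 0 / fact n" for n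
  have sums: "(\<lambda>n. a n * z ^ n) sums h z" if "norm z < R" for z
  proof -
    have "z \<in> ball 0 R" using that by simp
    from holomorphic_power_series[OF h this] show ?thesis unfolding a_def by (simp only: diff_zero)
  qed
  define r where "r = (1 + R) / 2"
  have r: "1 < r" "r < R" using R by (auto simp: r_def)
  have "summable (\<lambda>n. a n * (of_real r) ^ n)"
    by (rule sums_summable[OF sums]) (use r in simp)
  hence sm: "summable (\<lambda>n. norm (a n))"
    using powser_insidea[of a "of_real r" 1] r by (simp only: power_one mult_1_right norm_one norm_of_real)
  have a0: "h 0 = a 0" by (rule sums_unique2[OF sums powser_sums_zero]) (use R in simp)
  have ip: "integrable circ_measure (\<lambda>t. z * t ^ n)" for z :: complex and n
    using integrable_powi[of "\<lambda>_. z" "int n"] by simp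
  define S where "S N t = (\<Sum>n<N. a n * t ^ n)" for N t
  define M where "M = (\<Sum>n. norm (a n))"
  have Sb: "norm (S N t) \<le> M" if "norm t = 1" for N t
  proof -
    have "norm (S N t) \<le> (\<Sum>n<N. norm (a n))"
      unfolding S_def by (rule order_trans[OF norm_sum]) (simp add: norm_mult norm_power that)
    also have "\<dots> \<le> M" unfolding M_def by (rule sum_le_suminf[OF sm]) auto
    finally show ?thesis .
  qed
  have lim: "(\<lambda>N. S N t) \<longlonglongrightarrow> h t" if "norm t = 1" for t
    using sums[of t] that R by (simp add: sums_def S_def)
  have "AE t in circ_measure. norm (h t) \<le> M"
    using AE_circ_norm
  proof eventually_elim
    case (elim t)
    show ?case by (rule LIMSEQ_le_const2[OF tendsto_norm[OF lim[OF elim]]]) (use Sb[OF elim] in auto)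
  qed
  thus "integrable circ_measure h"
    by (intro circ.integrable_const_bound[of _ M]) (use meas in auto)
  have "(\<lambda>N. LINT t|circ_measure. S N t) \<longlonglongrightarrow> (LINT t|circ_measure. h t)"
  proof (rule integral_dominated_convergence[of _ _ _ "\<lambda>_. M"])
    show "AE t in circ_measure. (\<lambda>N. S N t) \<longlonglongrightarrow> h t"
      using AE_circ_norm by eventually_elim (rule lim)
    show "AE t in circ_measure. norm (S N t) \<le> M" for N
      using AE_circ_norm by eventually_elim (rule Sb)
    show "h \<in> borel_measurable circ_measure" using meas by simp
    show "S N \<in> borel_measurable circ_measure" for N unfolding S_def by measurable
  qed auto
  moreover have "(LINT t|circ_measure. S N t) = a 0" if "N \<ge> 1" for N
  proof -
    have "(LINT t|circ_measure. S N t) = (\<Sum>n<N. a n * (LINT t|circ_measure. t powi int n))"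
      unfolding S_def using ip by (subst Bochner_Integration.integral_sum) auto
    also have "\<dots> = (\<Sum>n<N. a n * (if n = 0 then 1 else 0))" by (simp only: integral_powi) simp
    also have "\<dots> = a 0" using that by (simp add: if_distrib[of "\<lambda>x. _ * x"] sum.delta cong: if_cong)
    finally show ?thesis .
  qed
  hence "(\<lambda>N. LINT t|circ_measure. S N t) \<longlonglongrightarrow> a 0"
    by (intro tendsto_eventually) (auto simp: eventually_sequentially intro!: exI[of _ 1])
  ultimately show "(LINT t|circ_measure. h t) = h 0" unfolding a0 by (rule LIMSEQ_unique)
qed

lemma integral_norm_powr_poly_le:
  fixes q :: "complex poly"
  assumes p: "p > 0" and AB: "A \<ge> 0" "B \<ge> 0"
    "\<And>z. Re z > 0 \<Longrightarrow> norm z powr p \<le> A * Re z powr p - B * Re (z powr of_real p)"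
    and pos: "\<And>t. norm t = 1 \<Longrightarrow> Re (poly q t) > 0" and q0: "Im (poly q 0) = 0"
  shows "(LINT t|circ_measure. norm (poly q t) powr p) \<le> A * (LINT t|circ_measure. \<bar>Re (poly q t)\<bar> powr p)"
proof -
  define U where "U = {z. Re (poly q z) > 0}"
  have Uo: "open U" unfolding U_def by (intro open_Collect_less continuous_intros)
  have sub: "cball 0 1 \<subseteq> U"
    using Re_poly_pos_in_disc[OF pos] by (auto simp: U_def)
  \<comment> \<open>The mean value property asks for holomorphy on a disc of radius larger than 1,
    so the positivity of the real part is extended to a margin around the closed disc.\<close>
  obtain d where d: "d > 0" "(\<Union>x\<in>cball 0 1. ball x d) \<subseteq> U"
    using compact_subset_open_imp_ball_epsilon_subset[OF compact_cball Uo sub] by blast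
  define R where "R = 1 + d"
  have R: "R > 1" using d by (simp add: R_def)
  have RU: "ball 0 R \<subseteq> U"
  proof
    fix z :: complex assume z: "z \<in> ball 0 R"
    show "z \<in> U"
    proof (cases "norm z \<le> 1")
      case True thus ?thesis using sub by auto
    next
      case False
      define x where "x = z /\<^sub>R norm z"
      have nz: "norm z > 0" using False by linarith
      hence "norm x = 1" by (simp add: x_def)
      have "z - x = (1 - 1 / norm z) *\<^sub>R z" by (simp add: x_def scaleR_diff_left divide_inverse)
      hence "norm (z - x) = \<bar>1 - 1 / norm z\<bar> * norm z" by (simp only: norm_scaleR)
      also have "\<bar>1 - 1 / norm z\<bar> = 1 - 1 / norm z" using False nz by (simp add: field_simps)
      also have "(1 - 1 / norm z) * norm z = norm z - 1" using nz by (simp add: field_simps)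
      finally have "norm (z - x) = norm z - 1" .
      hence "z \<in> ball x d" using z by (simp add: R_def dist_norm norm_minus_commute)
      moreover have "x \<in> cball 0 1" using \<open>norm x = 1\<close> by simp
      ultimately show ?thesis using d(2) by blast
    qed
  qed
  \<comment> \<open>Cut off outside the disc, which gives a Borel function on the whole plane and
    leaves the values on the circle unchanged.\<close>
  define h where "h z = (if z \<in> ball 0 R then poly q z powr of_real p else 0)" for z
  have hol: "(\<lambda>z. poly q z powr of_real p) holomorphic_on ball 0 R"
    using RU by (intro holomorphic_intros) (auto simp: U_def complex_nonpos_Reals_iff)
  have hh: "h holomorphic_on ball 0 R"
    using hol by (rule holomorphic_transform) (simp add: h_def)
  have hm [measurable]: "h \<in> borel_measurable borel"
    unfolding h_def[abs_def] by (rule borel_measurable_continuous_on_if[OF _ holomorphic_on_imp_continuous_on[OF hol]]) auto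
  note mean = mean_of_holomorphic[OF R hh hm]
  have pm [measurable]: "poly q \<in> borel_measurable borel"
    by (intro borel_measurable_continuous_onI continuous_intros)
  obtain M where M: "\<And>t. norm t = 1 \<Longrightarrow> norm (poly q t) \<le> M" using poly_bounded_on_circle[of q] by blast
  have i1: "integrable circ_measure (\<lambda>t. norm (poly q t) powr p)"
  proof (rule circ.integrable_const_bound[of _ "M powr p"])
    show "AE t in circ_measure. norm (norm (poly q t) powr p) \<le> M powr p"
      using AE_circ_norm by eventually_elim (use M p in \<open>auto intro!: powr_mono2\<close>)
  qed measurable
  have i2: "integrable circ_measure (\<lambda>t. \<bar>Re (poly q t)\<bar> powr p)"
  proof (rule Bochner_Integration.integrable_bound[OF i1])
    show "AE t in circ_measure. norm (\<bar>Re (poly q t)\<bar> powr p) \<le> norm (norm (poly q t) powr p)"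
      using p by (intro AE_I2) (auto intro!: powr_mono2 abs_Re_le_cmod)
  qed measurable
  have "(LINT t|circ_measure. norm (poly q t) powr p) \<le> (LINT t|circ_measure. A * \<bar>Re (poly q t)\<bar> powr p - B * Re (h t))"
  proof (rule integral_mono_AE)
    show "AE t in circ_measure. norm (poly q t) powr p \<le> A * \<bar>Re (poly q t)\<bar> powr p - B * Re (h t)"
      using AE_circ_norm
    proof eventually_elim
      case (elim t)
      have "h t = poly q t powr of_real p" using elim R by (simp add: h_def)
      thus ?case using AB(3)[OF pos[OF elim]] pos[OF elim] by simp
    qed
  qed (use i1 i2 mean in auto)
  also have "\<dots> = A * (LINT t|circ_measure. \<bar>Re (poly q t)\<bar> powr p) - B * Re (LINT t|circ_measure. h t)"
    using i2 mean by simp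
  also have "(LINT t|circ_measure. h t) = poly q 0 powr of_real p"
    unfolding mean(2) using R by (simp add: h_def)
  also have "poly q 0 powr of_real p = of_real (Re (poly q 0) powr p)"
  proof -
    have "poly q 0 = of_real (Re (poly q 0))" using q0 by (simp add: complex_eq_iff)
    moreover have "Re (poly q 0) \<ge> 0" using Re_poly_pos_in_disc[OF pos, of 0] by simp
    ultimately show ?thesis by (metis powr_of_real)
  qed
  also have "A * (LINT t|circ_measure. \<bar>Re (poly q t)\<bar> powr p) - B * Re (of_real (Re (poly q 0) powr p)) \<le> A * (LINT t|circ_measure. \<bar>Re (poly q t)\<bar> powr p)"
    using AB(2) by simp
  finally show ?thesis .
qed

lemma fourier_poly: "fourier (abs_circ_fun (poly q)) n = (if n \<ge> 0 then coeff q (nat n) else 0)"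
proof -
  have [measurable]: "poly q \<in> borel_measurable borel"
    by (intro borel_measurable_continuous_onI continuous_intros)
  have ip: "integrable circ_measure (\<lambda>t. z * t powi m)" for z :: complex and m
    using integrable_powi[of "\<lambda>_. z" m] by simp
  have "fourier (abs_circ_fun (poly q)) n = (LINT t|circ_measure. poly q t * t powi - n)"
    by (simp add: fourier.abs_eq)
  also have "\<dots> = (LINT t|circ_measure. (\<Sum>k\<le>degree q. coeff q k * t powi (int k - n)))"
  proof (rule integral_cong_AE)
    show "AE t in circ_measure. poly q t * t powi - n = (\<Sum>k\<le>degree q. coeff q k * t powi (int k - n))"
      using AE_circ_nonzero
      by eventually_elim (simp add: poly_altdef sum_distrib_right power_int_diff power_int_minus divide_inverse mult.assoc)
  qed measurable
  also have "\<dots> = (\<Sum>k\<le>degree q. coeff q k * (if int k - n = 0 then 1 else 0))"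
    using ip by (subst Bochner_Integration.integral_sum) (auto simp: integral_powi)
  also have "\<dots> = (if n \<ge> 0 then coeff q (nat n) else 0)"
  proof (cases "n \<ge> 0")
    case True
    hence "(int k - n = 0) = (k = nat n)" for k by auto
    hence "(\<Sum>k\<le>degree q. coeff q k * (if int k - n = 0 then 1 else 0)) = (\<Sum>k\<le>degree q. if k = nat n then coeff q k else 0)"
      by (intro sum.cong) auto
    also have "\<dots> = coeff q (nat n)" by (subst sum.delta) (auto simp: coeff_eq_0)
    finally show ?thesis using True by simp
  next
    case False
    thus ?thesis by (intro trans[OF sum.neutral]) auto
  qed
  finally show ?thesis .
qed

text \<open>On the circle a positive trigonometric polynomial is the real part of an analytic
  polynomial \<open>q\<close> with real \<open>q(0)\<close>, and its analytic part is
  \<open>(q + q(0)) / 2\<close>; so it remains to bound \<open>q\<close> and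
  \<open>q(0)\<close>.\<close>

lemma riesz_bound_positive:
  assumes p: "1 < p" "p \<le> 2"
  obtains C where "C \<ge> 0"
    "\<And>N c g. (\<And>t. norm t = 1 \<Longrightarrow> Im (trig_sum N c t) = 0 \<and> Re (trig_sum N c t) > 0) \<Longrightarrow>
       analytic_part (abs_circ_fun (trig_sum N c)) g \<Longrightarrow> Lp_norm p g \<le> C * Lp_norm p (abs_circ_fun (trig_sum N c))"
proof -
  obtain A B where AB: "A \<ge> 0" "B \<ge> 0"
    "\<And>z. Re z > 0 \<Longrightarrow> norm z powr p \<le> A * Re z powr p - B * Re (z powr of_real p)"
    using norm_powr_le_Re[OF p] by blast
  define C where "C = A powr (1 / p) + 1"
  show ?thesis
  proof (rule that[of C])
    show "C \<ge> 0" by (simp add: C_def)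
    fix N c g
    assume pos: "\<And>t. norm t = 1 \<Longrightarrow> Im (trig_sum N c t) = 0 \<and> Re (trig_sum N c t) > 0"
      and g: "analytic_part (abs_circ_fun (trig_sum N c)) g"
    define f where "f = abs_circ_fun (trig_sum N c)"
    have fT: "f \<in> Trig" unfolding f_def Trig_def by blast
    have fL: "f \<in> Lp p" "f \<in> Lp 1" using fT p Trig_Lp by auto
    obtain q0 where q0: "\<And>t. norm t = 1 \<Longrightarrow> Re (trig_sum N c t) = Re (poly q0 t)"
      using trig_eq_Re_poly[OF trig_trig_sum] by blast
    \<comment> \<open>Subtracting an imaginary constant keeps the real part and makes the value at 0
      real.\<close>
    define q where "q = q0 - [:\<i> * Im (poly q0 0):]"
    have q: "\<And>t. norm t = 1 \<Longrightarrow> Re (trig_sum N c t) = Re (poly q t)" "Im (poly q 0) = 0"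
      using q0 by (auto simp: q_def)
    have qm [measurable]: "poly q \<in> borel_measurable borel"
      by (intro borel_measurable_continuous_onI continuous_intros)
    define F where "F = abs_circ_fun (poly q)"
    have fq: "trig_sum N c t = (poly q t + cnj (poly q t)) / 2" if "norm t = 1" for t
      using pos[OF that] q(1)[OF that] by (simp add: complex_eq_iff)
    have FT: "F \<in> Trig"
    proof -
      have "trig (\<lambda>t. \<Sum>k\<in>S. coeff q k * t powi int k)" if "finite S" for S
        using that
      proof induct
        case empty
        show ?case by (rule trig.monom[of _ 0 0]) simp
      next
        case (insert m S)
        show ?case
          by (rule trig.add[OF trig.monom[of "\<lambda>t. coeff q m * t powi int m" "coeff q m" "int m"] insert(3)])
            (use insert in auto)
      qed
      from this[of "{..degree q}"] have "trig (poly q)" by (simp add: poly_altdef[abs_def])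
      thus ?thesis unfolding F_def by (rule abs_trig_Trig) measurable
    qed
    have FL: "F \<in> Lp p" "F \<in> Lp 1" using FT p Trig_Lp by auto
    have fhat: "fourier f n = (fourier F n + cnj (fourier F (- n))) / 2" for n
    proof -
      have iF: "integrable circ_measure (\<lambda>t. poly q t * t powi m)" for m
      proof -
        have "integrable circ_measure (poly q)"
          using FL(2) by (simp add: F_def LpD in_Lp_1)
        thus ?thesis by (simp add: integrable_powi)
      qed
      have "fourier f n = (LINT t|circ_measure. trig_sum N c t * t powi - n)"
        by (simp add: f_def fourier.abs_eq)
      also have "\<dots> = (LINT t|circ_measure. (poly q t * t powi - n + cnj (poly q t * t powi n)) / 2)"
      proof (rule integral_cong_AE)
        show "AE t in circ_measure. trig_sum N c t * t powi - n = (poly q t * t powi - n + cnj (poly q t * t powi n)) / 2"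
          using AE_circ_norm
        proof eventually_elim
          case (elim t)
          have "cnj t = inverse t" using elim by (simp add: inverse_eq_divide complex_div_cnj[of 1 t])
          hence "cnj (t powi n) = t powi - n" by (simp add: power_int_minus power_int_inverse)
          thus ?case by (simp add: fq[OF elim] algebra_simps add_divide_distrib)
        qed
      qed measurable
      also have "\<dots> = ((LINT t|circ_measure. poly q t * t powi - n) + cnj (LINT t|circ_measure. poly q t * t powi n)) / 2"
        using iF[of "- n"] iF[of n] by (simp add: integral_cnj[symmetric] del: complex_cnj_mult)
      finally show ?thesis by (simp add: F_def fourier.abs_eq)
    qed
    have gF: "g = cscale (1/2) (F + cscale (poly q 0) 1)"
    proof (rule analytic_part_unique[OF g[folded f_def]])
      have "cnj (poly q 0) = poly q 0" using q(2) by (simp add: complex_eq_iff)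
      moreover have "coeff q 0 = poly q 0" by (simp add: poly_0_coeff_0)
      ultimately show "analytic_part f (cscale (1/2) (F + cscale (poly q 0) 1))"
        unfolding analytic_part_def
        using FL fL by (auto simp: fhat fourier_cscale fourier_add Lp_cscale Lp_add fourier_1 F_def[symmetric]
          fourier_poly[of q, folded F_def])
    qed
    have nF: "Lp_norm p F \<le> A powr (1 / p) * Lp_norm p f"
    proof -
      have "Lp_int p F = (LINT t|circ_measure. norm (poly q t) powr p)" by (simp add: F_def Lp_int.abs_eq)
      also have "\<dots> \<le> A * (LINT t|circ_measure. \<bar>Re (poly q t)\<bar> powr p)"
        by (rule integral_norm_powr_poly_le[OF _ AB _ q(2)]) (use p pos q in auto)
      also have "(LINT t|circ_measure. \<bar>Re (poly q t)\<bar> powr p) = Lp_int p f"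
        unfolding f_def Lp_int.abs_eq[OF circ_eq_refl[THEN iffD2, OF trig_sum_measurable]]
      proof (rule integral_cong_AE)
        show "AE t in circ_measure. \<bar>Re (poly q t)\<bar> powr p = cmod (trig_sum N c t) powr p"
          using AE_circ_norm
        proof eventually_elim
          case (elim t)
          have "trig_sum N c t = of_real (Re (poly q t))"
            using pos[OF elim] q(1)[OF elim] by (simp add: complex_eq_iff)
          thus ?case by (simp only: norm_of_real)
        qed
      qed measurable
      finally have "Lp_int p F powr (1 / p) \<le> (A * Lp_int p f) powr (1 / p)"
        using p by (intro powr_mono2) auto
      thus ?thesis using AB by (simp add: Lp_norm_Lp_int powr_mult)
    qed
    have "norm (poly q 0) = norm (fourier f 0)"
    proof -
      have "cnj (poly q 0) = poly q 0" using q(2) by (simp add: complex_eq_iff)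
      thus ?thesis unfolding fhat by (simp add: fourier_poly[of q, folded F_def] poly_0_coeff_0)
    qed
    also have "\<dots> \<le> Lp_norm p f"
      using norm_fourier_le[of f 0] Lp_norm_1_le(2)[OF p(1) fL(1)] by linarith
    finally have nq: "norm (poly q 0) \<le> Lp_norm p f" .
    have "Lp_norm p g = norm (1/2 :: complex) * Lp_norm p (F + cscale (poly q 0) 1)"
      unfolding gF using p by (intro Lp_norm_cscale) simp
    also have "\<dots> \<le> 1 * Lp_norm p (F + cscale (poly q 0) 1)"
      by (intro mult_right_mono) auto
    also have "\<dots> \<le> Lp_norm p F + Lp_norm p (cscale (poly q 0) 1)"
      using Lp_norm_triangle[of p F "cscale (poly q 0) 1"] p FL by (simp add: Lp_cscale)
    also have "\<dots> \<le> A powr (1 / p) * Lp_norm p f + Lp_norm p f"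
      using nF nq p by (simp add: Lp_norm_cscale Lp_norm_one)
    finally show "Lp_norm p g \<le> C * Lp_norm p (abs_circ_fun (trig_sum N c))"
      by (simp add: C_def f_def algebra_simps)
  qed
qed

lemma Lp_norm_mono_AE:
  assumes p: "p > 0" and [measurable]: "F \<in> borel_measurable borel" "G \<in> borel_measurable borel"
    and G: "abs_circ_fun G \<in> Lp p" and le: "AE t in circ_measure. norm (F t) \<le> norm (G t)"
  shows "Lp_norm p (abs_circ_fun F) \<le> Lp_norm p (abs_circ_fun G)"
proof -
  have iG: "integrable circ_measure (\<lambda>t. norm (G t) powr p)" using G by (simp add: LpD in_Lp.abs_eq)
  have le': "AE t in circ_measure. norm (F t) powr p \<le> norm (G t) powr p"
    using le by eventually_elim (use p in \<open>auto intro!: powr_mono2\<close>)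
  have iF: "integrable circ_measure (\<lambda>t. norm (F t) powr p)"
    by (rule Bochner_Integration.integrable_bound[OF iG]) (use le' in auto)
  have "Lp_int p (abs_circ_fun F) \<le> Lp_int p (abs_circ_fun G)"
    using integral_mono_AE[OF iF iG le'] by (simp add: Lp_int.abs_eq)
  thus ?thesis unfolding Lp_norm_Lp_int using p by (intro powr_mono2) auto
qed

lemma continuous_trig_sum: "continuous_on (sphere 0 1) (trig_sum N c)"
  unfolding trig_sum_def[abs_def] by (intro continuous_intros) auto

lemma Lp_norm_bounded_perturbation:
  assumes p: "p \<ge> 1" and [measurable]: "F \<in> borel_measurable borel" "G \<in> borel_measurable borel"
    and G: "abs_circ_fun G \<in> Lp p" and e: "e \<ge> 0"
    and le: "AE t in circ_measure. norm (F t) \<le> norm (G t) + e"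
  shows "Lp_norm p (abs_circ_fun F) \<le> Lp_norm p (abs_circ_fun G) + e"
proof -
  let ?A = "abs_circ_fun (\<lambda>t. of_real (norm (G t)))"
  have A: "?A \<in> Lp p" "Lp_norm p ?A = Lp_norm p (abs_circ_fun G)"
    using G by (simp_all add: LpD in_Lp.abs_eq Lp_norm.abs_eq)
  have c: "abs_circ_fun (\<lambda>t. of_real e) = cscale (of_real e) 1"
    by (simp add: one_circ_fun_def cscale.abs_eq)
  have cL: "cscale (of_real e) 1 \<in> Lp p" by (simp add: Lp_cscale)
  have s: "abs_circ_fun (\<lambda>t. of_real (norm (G t)) + of_real e) = ?A + cscale (of_real e) 1"
    by (simp add: plus_circ_fun.abs_eq c[symmetric])
  have "Lp_norm p (abs_circ_fun F) \<le> Lp_norm p (abs_circ_fun (\<lambda>t. of_real (norm (G t)) + of_real e))"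
  proof (rule Lp_norm_mono_AE)
    show "abs_circ_fun (\<lambda>t. of_real (norm (G t)) + of_real e) \<in> Lp p"
      unfolding s using p A cL by (intro Lp_add) auto
    show "AE t in circ_measure. norm (F t) \<le> norm (complex_of_real (norm (G t)) + complex_of_real e)"
      using le
    proof eventually_elim
      case (elim t)
      have "norm (complex_of_real (norm (G t)) + complex_of_real e) = norm (G t) + e"
        unfolding of_real_add[symmetric] norm_of_real using e by simp
      thus ?case using elim by simp
    qed
  qed (use p in auto)
  also have "\<dots> \<le> Lp_norm p ?A + Lp_norm p (cscale (of_real e) 1)"
    unfolding s by (rule Lp_norm_triangle[OF p A(1) cL])
  also have "\<dots> = Lp_norm p (abs_circ_fun G) + e"
    using p e by (simp add: A Lp_norm_cscale Lp_norm_one)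
  finally show ?thesis .
qed

lemma reflect_sum: "reflect (\<Sum>i\<in>I. f i) = (\<Sum>i\<in>I. reflect (f i))"
  by (induct I rule: infinite_finite_induct) (simp_all add: reflect_add)

lemma Lp_norm_reflect: "Lp_norm p (reflect f) = Lp_norm p f"
proof (transfer fixing: p)
  fix f :: "complex \<Rightarrow> complex" assume "circ_eq f f"
  hence [measurable]: "f \<in> borel_measurable borel" by simp
  have "(LINT t|circ_measure. cmod (f (1 / t)) powr p) = (LINT t|circ_measure. cmod (f (cnj t)) powr p)"
    by (rule integral_cong_AE) (use AE_circ_inverse in auto)
  thus "(LINT t|circ_measure. cmod (f (1 / t)) powr p) powr (1 / p) = (LINT t|circ_measure. cmod (f t) powr p) powr (1 / p)"
    by (simp add: integral_circ_reflect[where f = "\<lambda>t. cmod (f t) powr p"])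
qed

text \<open>The positive and negative parts of \<open>Re f\<close> and \<open>Im f\<close> are
  continuous but in general not trigonometric polynomials. Each is raised by \<open>e\<close> and
  approximated within \<open>e\<close> by a positive trigonometric polynomial \<open>h k\<close>;
  what remains of \<open>f\<close> is uniformly small and is estimated in
  \<open>L^2\<close>.\<close>

lemma riesz_bound_le_2:
  assumes p: "1 < p" "p \<le> 2"
  obtains C where "C \<ge> 0" "\<And>f g. f \<in> Trig \<Longrightarrow> analytic_part f g \<Longrightarrow> Lp_norm p g \<le> C * Lp_norm p f"
proof -
  obtain C where C: "C \<ge> 0"
    "\<And>N c g. (\<And>t. norm t = 1 \<Longrightarrow> Im (trig_sum N c t) = 0 \<and> Re (trig_sum N c t) > 0) \<Longrightarrow>
       analytic_part (abs_circ_fun (trig_sum N c)) g \<Longrightarrow> Lp_norm p g \<le> C * Lp_norm p (abs_circ_fun (trig_sum N c))"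
    using riesz_bound_positive[OF p] by blast
  show ?thesis
  proof (rule that[of "4 * C"])
    show "4 * C \<ge> 0" using C by simp
    fix f g assume f: "f \<in> Trig" and g: "analytic_part f g"
    have TL: "Trig \<subseteq> Lp p" using p Trig_Lp by auto
    have gT: "g \<in> Trig" using Trig_analytic_part[OF f] analytic_part_unique[OF g] by blast
    obtain N c where fc: "f = abs_circ_fun (trig_sum N c)" using f by (auto simp: Trig_def)
    \<comment> \<open>\<open>2 * e\<close> bounds the excess of each approximant over the modulus of
      \<open>f\<close>, and \<open>8 * e\<close> is the factor 2 of \<open>Lp_norm_le_2\<close>
      times the uniform error \<open>4 * e\<close>.\<close>
    have main: "Lp_norm p g \<le> 4 * C * (Lp_norm p f + 2 * e) + 8 * e" if e: "e > 0" for e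
    proof -
      have approx: "\<exists>h v \<phi>. h = abs_circ_fun \<phi> \<and> h \<in> Trig \<and> v \<in> Trig \<and> analytic_part h v \<and>
          \<phi> \<in> borel_measurable borel \<and> (\<forall>t. norm t = 1 \<longrightarrow> norm (\<phi> t - of_real (u t) - of_real e) \<le> e) \<and>
          Lp_norm p v \<le> C * (Lp_norm p f + 2 * e)"
        if u: "continuous_on (sphere 0 1) u" "\<And>t. norm t = 1 \<Longrightarrow> 0 \<le> u t \<and> u t \<le> norm (trig_sum N c t)"
        for u :: "complex \<Rightarrow> real"
      proof -
        have "continuous_on (sphere 0 1) (\<lambda>t. u t + e)" using u(1) by (intro continuous_intros)
        then obtain r M d where r: "\<And>t. norm t = 1 \<Longrightarrow> \<bar>u t + e - r t\<bar> < e"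
          "\<And>t. norm t = 1 \<Longrightarrow> complex_of_real (r t) = trig_sum M d t"
          using trig_approximation[of "\<lambda>t. u t + e" e] e by blast
        define h where "h = abs_circ_fun (trig_sum M d)"
        have hT: "h \<in> Trig" unfolding h_def Trig_def by blast
        obtain v where v: "v \<in> Trig" "analytic_part h v" using Trig_analytic_part[OF hT] by blast
        have pos: "Im (trig_sum M d t) = 0 \<and> Re (trig_sum M d t) > 0" if t: "norm t = 1" for t
        proof -
          have "r t > 0" using r(1)[OF t] u(2)[OF t] by linarith
          thus ?thesis by (simp add: r(2)[OF t, symmetric])
        qed
        have "Lp_norm p v \<le> C * Lp_norm p h"
          unfolding h_def by (rule C(2)[OF pos]) (use v in \<open>auto simp: h_def\<close>)
        also have "Lp_norm p h \<le> Lp_norm p f + 2 * e"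
          unfolding h_def fc
        proof (rule Lp_norm_bounded_perturbation)
          show "AE t in circ_measure. norm (trig_sum M d t) \<le> norm (trig_sum N c t) + 2 * e"
            using AE_circ_norm
          proof eventually_elim
            case (elim t)
            have "norm (trig_sum M d t) = \<bar>r t\<bar>" unfolding r(2)[OF elim, symmetric] by simp
            thus ?case using r(1)[OF elim] u(2)[OF elim] by linarith
          qed
        qed (use p e f fc TL in auto)
        finally have "Lp_norm p v \<le> C * (Lp_norm p f + 2 * e)" using C(1) by (simp add: mult_left_mono)
        moreover have "norm (trig_sum M d t - of_real (u t) - of_real e) \<le> e" if t: "norm t = 1" for t
        proof -
          have "trig_sum M d t - of_real (u t) - of_real e = of_real (r t - u t - e)"
            by (simp add: r(2)[OF t, symmetric])
          hence "norm (trig_sum M d t - of_real (u t) - of_real e) = \<bar>r t - u t - e\<bar>"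
            by (simp only: norm_of_real)
          thus ?thesis using r(1)[OF t] by linarith
        qed
        ultimately show ?thesis using hT v h_def by (intro exI[of _ h] exI[of _ v] exI[of _ "trig_sum M d"]) auto
      qed
      \<comment> \<open>\<open>u 0\<close> and \<open>u 2\<close> are the positive and negative part
        of the real part, \<open>u 3\<close> and \<open>u 1\<close> those of the imaginary
        part.\<close>
      define u where "u k t = max 0 (Re (\<i> ^ k * trig_sum N c t))" for k :: nat and t
      have uc: "continuous_on (sphere 0 1) (u k)" for k
        unfolding u_def[abs_def] by (intro continuous_intros continuous_trig_sum)
      have ub: "0 \<le> u k t \<and> u k t \<le> norm (trig_sum N c t)" for k t
        using complex_Re_le_cmod[of "\<i> ^ k * trig_sum N c t"] by (auto simp: u_def norm_mult norm_power)
      have "\<exists>h v \<phi>. h = abs_circ_fun \<phi> \<and> h \<in> Trig \<and> v \<in> Trig \<and> analytic_part h v \<and>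
          \<phi> \<in> borel_measurable borel \<and> (\<forall>t. norm t = 1 \<longrightarrow> norm (\<phi> t - of_real (u k t) - of_real e) \<le> e) \<and>
          Lp_norm p v \<le> C * (Lp_norm p f + 2 * e)" for k
        by (rule approx[OF uc ub])
      hence "\<forall>k. \<exists>x. (\<lambda>(h, v, \<phi>). h = abs_circ_fun \<phi> \<and> h \<in> Trig \<and> v \<in> Trig \<and> analytic_part h v \<and>
          \<phi> \<in> borel_measurable borel \<and> (\<forall>t. norm t = 1 \<longrightarrow> norm (\<phi> t - of_real (u k t) - of_real e) \<le> e) \<and>
          Lp_norm p v \<le> C * (Lp_norm p f + 2 * e)) x" by (simp add: split_paired_Ex)
      from choice[OF this] obtain X where X: "\<And>k. (\<lambda>(h, v, \<phi>). h = abs_circ_fun \<phi> \<and> h \<in> Trig \<and> v \<in> Trig \<and> analytic_part h v \<and>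
          \<phi> \<in> borel_measurable borel \<and> (\<forall>t. norm t = 1 \<longrightarrow> norm (\<phi> t - of_real (u k t) - of_real e) \<le> e) \<and>
          Lp_norm p v \<le> C * (Lp_norm p f + 2 * e)) (X k)" by blast
      define h where "h k = fst (X k)" for k
      define v where "v k = fst (snd (X k))" for k
      define \<phi> where "\<phi> k = snd (snd (X k))" for k
      have hv: "\<And>k. h k = abs_circ_fun (\<phi> k)" "\<And>k. h k \<in> Trig" "\<And>k. v k \<in> Trig"
        "\<And>k. analytic_part (h k) (v k)" "\<And>k. \<phi> k \<in> borel_measurable borel"
        "\<And>k t. norm t = 1 \<Longrightarrow> norm (\<phi> k t - of_real (u k t) - of_real e) \<le> e"
        "\<And>k. Lp_norm p (v k) \<le> C * (Lp_norm p f + 2 * e)"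
        using X unfolding h_def v_def \<phi>_def case_prod_beta by blast+
      note [measurable] = hv(5)
      define H where "H = (h 0 - h 2) + cscale \<i> (h 3 - h 1)"
      define V where "V = (v 0 - v 2) + cscale \<i> (v 3 - v 1)"
      have HT: "H \<in> Trig" and VT: "V \<in> Trig" unfolding H_def V_def
        by (intro cvs.subspace_add[OF Trig_subspace] cvs.subspace_diff[OF Trig_subspace] cvs.subspace_scale[OF Trig_subspace] hv)+
      have HV: "analytic_part H V" unfolding H_def V_def
        by (intro analytic_part_add analytic_part_diff analytic_part_cscale hv)
      have fH: "f - H \<in> Trig" and gV: "g - V \<in> Trig"
        using cvs.subspace_diff[OF Trig_subspace] f HT gT VT by auto
      have diff: "f - H = abs_circ_fun (\<lambda>t. trig_sum N c t - ((\<phi> 0 t - \<phi> 2 t) + \<i> * (\<phi> 3 t - \<phi> 1 t)))"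
        unfolding H_def fc hv(1) by (simp add: plus_circ_fun.abs_eq minus_circ_fun.abs_eq cscale.abs_eq)
      have "Lp_norm 2 (f - H) \<le> Lp_norm 2 0 + 4 * e"
        unfolding diff zero_circ_fun_def
      proof (rule Lp_norm_bounded_perturbation)
        show "AE t in circ_measure. norm (trig_sum N c t - ((\<phi> 0 t - \<phi> 2 t) + \<i> * (\<phi> 3 t - \<phi> 1 t))) \<le> norm (0::complex) + 4 * e"
          using AE_circ_norm
        proof eventually_elim
          case (elim t)
          define d where "d k = \<phi> k t - of_real (u k t) - of_real e" for k
          have d: "norm (d k) \<le> e" for k unfolding d_def by (rule hv(6)[OF elim])
          have "trig_sum N c t = (of_real (u 0 t) - of_real (u 2 t)) + \<i> * (of_real (u 3 t) - of_real (u 1 t))"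
            by (simp add: u_def complex_eq_iff power2_eq_square power3_eq_cube max_def)
          \<comment> \<open>The upward shifts by \<open>e\<close> cancel in the two differences, so
            only the four approximation errors \<open>d k\<close> remain.\<close>
          hence "trig_sum N c t - ((\<phi> 0 t - \<phi> 2 t) + \<i> * (\<phi> 3 t - \<phi> 1 t)) = (d 2 - d 0) + \<i> * (d 1 - d 3)"
            by (simp add: d_def algebra_simps)
          also have "norm \<dots> \<le> norm (d 2 - d 0) + norm (\<i> * (d 1 - d 3))" by (rule norm_triangle_ineq)
          also have "\<dots> = norm (d 2 - d 0) + norm (d 1 - d 3)" by (simp add: norm_mult)
          also have "\<dots> \<le> (norm (d 2) + norm (d 0)) + (norm (d 1) + norm (d 3))"
            by (intro add_mono norm_triangle_ineq4)
          also have "\<dots> \<le> norm (0::complex) + 4 * e" using d[of 0] d[of 1] d[of 2] d[of 3] by simp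
          finally show ?case .
        qed
        show "abs_circ_fun (\<lambda>_. 0) \<in> Lp 2" unfolding zero_circ_fun_def[symmetric] by simp
      qed (use e in auto)
      hence fH2: "Lp_norm 2 (f - H) \<le> 4 * e" by simp
      have "Lp_norm p (g - V) \<le> 2 * Lp_norm 2 (g - V)"
        using p gV Trig_Lp by (intro Lp_norm_le_2) auto
      also have "\<dots> \<le> 2 * Lp_norm 2 (f - H)"
        using Lp_norm_2_Trig[OF fH analytic_part_diff[OF g HV]] by simp
      also have "\<dots> \<le> 8 * e" using fH2 by simp
      finally have gV8: "Lp_norm p (g - V) \<le> 8 * e" .
      have vL: "v k \<in> Lp p" for k using hv(3) TL by auto
      have "Lp_norm p V \<le> Lp_norm p (v 0 - v 2) + Lp_norm p (cscale \<i> (v 3 - v 1))"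
        unfolding V_def using p vL by (intro Lp_norm_triangle Lp_cscale Lp_diff) auto
      also have "\<dots> = Lp_norm p (v 0 - v 2) + Lp_norm p (v 3 - v 1)" using p by (simp add: Lp_norm_cscale)
      also have "\<dots> \<le> (Lp_norm p (v 0) + Lp_norm p (v 2)) + (Lp_norm p (v 3) + Lp_norm p (v 1))"
        using p vL by (intro add_mono Lp_norm_triangle_diff) auto
      also have "\<dots> \<le> 4 * C * (Lp_norm p f + 2 * e)"
        using hv(7)[of 0] hv(7)[of 1] hv(7)[of 2] hv(7)[of 3] by simp
      finally have V4: "Lp_norm p V \<le> 4 * C * (Lp_norm p f + 2 * e)" .
      have "Lp_norm p g \<le> Lp_norm p V + Lp_norm p (g - V)"
        using p gT VT TL by (intro Lp_norm_diff_le) auto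
      thus ?thesis using V4 gV8 by simp
    qed
    have "Lp_norm p g \<le> 4 * C * Lp_norm p f + d" if d: "d > 0" for d
    proof -
      have C8: "8 * C + 8 > 0" using C(1) by simp
      have "4 * C * (x + 2 * y) + 8 * y = 4 * C * x + (8 * C + 8) * y" for x y
        by (simp add: algebra_simps)
      hence "4 * C * (Lp_norm p f + 2 * (d / (8 * C + 8))) + 8 * (d / (8 * C + 8)) =
         4 * C * Lp_norm p f + (8 * C + 8) * (d / (8 * C + 8))" .
      also have "\<dots> = 4 * C * Lp_norm p f + d" using C8 by simp
      finally show ?thesis using main[of "d / (8 * C + 8)"] C8 d by simp
    qed
    thus "Lp_norm p g \<le> 4 * C * Lp_norm p f" by (rule field_le_epsilon)
  qed
qed

text \<open>Transposition: \<open>g\<close> is tested against its dual function \<open>w\<close>,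
  for which the pairing is \<open>Lp_int p g\<close>. Pairing with \<open>g\<close> sees only the
  coanalytic part of the test function, and against that part \<open>g\<close> may be replaced by
  \<open>f\<close>, so that the bound for the exponent \<open>q\<close> applies after a
  reflection.\<close>

lemma riesz_bound_dual:
  assumes p: "1 < p" and q: "q = dual_exponent p" and C: "C \<ge> 0"
    and bound: "\<And>f g. f \<in> Trig \<Longrightarrow> analytic_part f g \<Longrightarrow> Lp_norm q g \<le> C * Lp_norm q f"
    and f: "f \<in> Trig" and g: "analytic_part f g"
  shows "Lp_norm p g \<le> C * Lp_norm p f"
proof (cases "g = 0")
  case True thus ?thesis using C by simp
next
  case False
  note q' = dual_exponent[OF p, folded q]
  have gT: "g \<in> Trig" using Trig_analytic_part[OF f] analytic_part_unique[OF g] by blast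
  have fL: "f \<in> Lp p" and gL: "g \<in> Lp p" using f gT p Trig_Lp by auto
  define w where "w = dual_map p g"
  have wL: "w \<in> Lp q" unfolding w_def q by (rule dual_map_Lp[OF p gL])
  have main: "Lp_int p g \<le> C * Lp_norm p f * (Lp_norm q w + e) + e * Lp_norm p g" if e: "e > 0" for e
  proof -
    \<comment> \<open>The bound is available for trigonometric polynomials only, so \<open>w\<close>
      is replaced by a nearby one.\<close>
    obtain T where T: "T \<in> Trig" "Lp_norm q (w - T) < e" using Trig_dense[OF q'(1) wL e] by blast
    have TL: "T \<in> Lp q" using T q' Trig_Lp by auto
    have refT: "reflect T \<in> Trig"
    proof -
      obtain N where "T = (\<Sum>n\<in>{- int N..int N}. cscale (fourier T n) (tpow n))"
        using Trig_expansion[OF T(1)] by blast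
      hence "reflect T = reflect (\<Sum>n\<in>{- int N..int N}. cscale (fourier T n) (tpow n))" by simp
      also have "\<dots> = (\<Sum>n\<in>{- int N..int N}. cscale (fourier T n) (tpow (- n)))"
        by (simp add: reflect_sum reflect_cscale reflect_tpow)
      also have "\<dots> \<in> Trig"
        by (intro cvs.subspace_sum[OF Trig_subspace] cvs.subspace_scale[OF Trig_subspace] tpow_Trig)
      finally show ?thesis .
    qed
    obtain S where S: "S \<in> Trig" "analytic_part (reflect T) S" using Trig_analytic_part[OF refT] by blast
    \<comment> \<open>The coanalytic part of \<open>T\<close>, constant term included; reflection
      turns it into an analytic part.\<close>
    define U where "U = reflect S"
    have UL: "U \<in> Lp q" unfolding U_def using S q' Trig_Lp by (intro reflect_Lp) auto
    have nU: "Lp_norm q U \<le> C * Lp_norm q T"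
      using bound[OF refT S(2)] by (simp add: U_def Lp_norm_reflect)
    have Uhat: "fourier U n = (if n \<le> 0 then fourier T n else 0)" for n
      using S(2) by (simp add: U_def fourier_reflect analytic_part_def)
    have ghat: "fourier g n = (if n \<ge> 0 then fourier f n else 0)" for n
      using g by (simp add: analytic_part_def)
    have L1: "f \<in> Lp 1" "g \<in> Lp 1" "T \<in> Lp 1" "U \<in> Lp 1"
      using Lp_norm_1_le(1)[OF p] Lp_norm_1_le(1)[OF q'(1)] fL gL TL UL by auto
    have "fourier (g * (T - U)) 0 = 0"
      by (rule fourier_Trig_mult[OF gT]) (auto simp: L1 Lp_diff fourier_diff Uhat ghat)
    moreover have "fourier ((f - g) * U) 0 = 0"
      by (rule fourier_Trig_mult) (auto simp: L1 Lp_diff fourier_diff Uhat ghat cvs.subspace_diff[OF Trig_subspace] f gT)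
    moreover have "g * T - f * U = g * (T - U) - (f - g) * U" by (simp add: algebra_simps)
    moreover have prodL: "x * y \<in> Lp 1" if "x \<in> Lp p" "y \<in> Lp q" for x y
      using Holder_Lp_int(1)[OF p that(1)] that(2) q by simp
    ultimately have "fourier (g * T) 0 = fourier (f * U) 0"
      using fourier_diff[of "g * T" "f * U" 0] fourier_diff[of "g * (T - U)" "(f - g) * U" 0]
      using fL gL TL UL p q' by (simp add: Lp_diff)
    hence "norm (fourier (g * T) 0) \<le> Lp_norm p f * Lp_norm q U"
      using norm_fourier_le[of "f * U" 0] Holder_Lp_int(2)[OF p fL, of U] UL q by simp
    also have "\<dots> \<le> Lp_norm p f * (C * Lp_norm q T)" using nU by (intro mult_left_mono) auto
    also have "\<dots> \<le> Lp_norm p f * (C * (Lp_norm q w + e))"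
    proof -
      have "Lp_norm q T \<le> Lp_norm q w + Lp_norm q (T - w)"
        using q' TL wL by (intro Lp_norm_diff_le) auto
      thus ?thesis using T(2) C by (intro mult_left_mono) (auto simp: Lp_norm_minus_commute)
    qed
    finally have 1: "norm (fourier (g * T) 0) \<le> C * Lp_norm p f * (Lp_norm q w + e)" by (simp add: mult_ac)
    have "norm (fourier (g * (w - T)) 0) \<le> Lp_norm p g * Lp_norm q (w - T)"
      using norm_fourier_le[of "g * (w - T)" 0] Holder_Lp_int(2)[OF p gL, of "w - T"] wL TL q q' by (simp add: Lp_diff)
    also have "\<dots> \<le> Lp_norm p g * e" using T(2) by (intro mult_left_mono) auto
    finally have 2: "norm (fourier (g * (w - T)) 0) \<le> e * Lp_norm p g" by (simp add: mult.commute)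
    have "complex_of_real (Lp_int p g) = fourier (w * g) 0"
      by (simp add: w_def dual_map_mult_self[OF p])
    also have "w * g = g * T + g * (w - T)" by (simp add: algebra_simps)
    also have "fourier (g * T + g * (w - T)) 0 = fourier (g * T) 0 + fourier (g * (w - T)) 0"
      using gL TL wL q' by (intro fourier_add prodL Lp_diff) auto
    finally have "Lp_int p g = norm (fourier (g * T) 0 + fourier (g * (w - T)) 0)"
      by (metis Lp_int_nonneg abs_of_nonneg norm_of_real)
    also have "\<dots> \<le> norm (fourier (g * T) 0) + norm (fourier (g * (w - T)) 0)" by (rule norm_triangle_ineq)
    finally show ?thesis using 1 2 by simp
  qed
  have "Lp_int p g \<le> C * Lp_norm p f * Lp_norm q w + d" if d: "d > 0" for d
  proof -
    define K where "K = C * Lp_norm p f + Lp_norm p g + 1"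
    have K: "K > 0" using C by (simp add: K_def add_nonneg_pos)
    have "Lp_int p g \<le> C * Lp_norm p f * Lp_norm q w + (K - 1) * (d / K)"
      using main[of "d / K"] d K by (simp add: K_def algebra_simps add_divide_distrib)
    also have "(K - 1) * (d / K) \<le> d" using d K by (simp add: field_simps)
    finally show ?thesis by simp
  qed
  hence 3: "Lp_int p g \<le> C * Lp_norm p f * Lp_norm q w" by (rule field_le_epsilon)
  have pos: "Lp_norm p g > 0" using p gL False by (intro Lp_norm_pos) auto
  have "Lp_int q w = Lp_int p g"
  proof -
    obtain G where G: "G \<in> borel_measurable borel" "g = abs_circ_fun G" by (rule circ_fun_cases)
    have "cmod (of_real (cmod z powr (p - 2)) * cnj z) powr q = cmod z powr p" for z
      unfolding norm_dual_map by (simp add: powr_powr q')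
    thus ?thesis using G(1) by (simp add: w_def G(2) dual_map.abs_eq Lp_int.abs_eq)
  qed
  hence "Lp_norm q w = (Lp_norm p g powr p) powr (1 / q)"
    using p by (simp add: Lp_norm_Lp_int[of q] Lp_int_Lp_norm)
  also have "\<dots> = Lp_norm p g powr (p - 1)" using q' by (simp add: powr_powr)
  finally have wn: "Lp_norm q w = Lp_norm p g powr (p - 1)" .
  have "Lp_norm p g * Lp_norm p g powr (p - 1) = Lp_norm p g powr 1 * Lp_norm p g powr (p - 1)"
    using pos by simp
  also have "\<dots> = Lp_int p g" using p by (subst powr_add[symmetric]) (simp add: Lp_int_Lp_norm)
  finally have "Lp_norm p g * Lp_norm p g powr (p - 1) \<le> C * Lp_norm p f * Lp_norm p g powr (p - 1)"
    using 3 by (simp add: wn)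
  thus ?thesis using pos by simp
qed

lemma riesz_bound_Trig:
  assumes p: "1 < p"
  obtains C where "C \<ge> 0" "\<And>f g. f \<in> Trig \<Longrightarrow> analytic_part f g \<Longrightarrow> Lp_norm p g \<le> C * Lp_norm p f"
proof (cases "p \<le> 2")
  case True
  thus ?thesis using riesz_bound_le_2[OF p] that by blast
next
  case False
  hence "dual_exponent p \<le> 2" using p by (simp add: dual_exponent_def field_simps)
  then obtain C where C: "C \<ge> 0"
    "\<And>f g. f \<in> Trig \<Longrightarrow> analytic_part f g \<Longrightarrow> Lp_norm (dual_exponent p) g \<le> C * Lp_norm (dual_exponent p) f"
    using riesz_bound_le_2[OF dual_exponent(1)[OF p]] by blast
  show ?thesis by (rule that[OF C(1)], rule riesz_bound_dual[OF p refl C])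
qed

lemma fourier_tendsto:
  assumes p: "1 < p" and u: "\<And>n. u n \<in> Lp p" and f: "f \<in> Lp p"
    and lim: "(\<lambda>n. Lp_norm p (u n - f)) \<longlonglongrightarrow> 0"
  shows "(\<lambda>n. fourier (u n) k) \<longlonglongrightarrow> fourier f k"
proof -
  have "norm (fourier (u n) k - fourier f k) \<le> Lp_norm p (u n - f)" for n
  proof -
    have "fourier (u n) k - fourier f k = fourier (u n - f) k"
      using Lp_norm_1_le(1)[OF p] u f by (simp add: fourier_diff)
    also have "norm \<dots> \<le> Lp_norm 1 (u n - f)" by (rule norm_fourier_le)
    also have "\<dots> \<le> Lp_norm p (u n - f)" using p u f by (intro Lp_norm_1_le Lp_diff) auto
    finally show ?thesis .
  qed
  hence "(\<lambda>n. fourier (u n) k - fourier f k) \<longlonglongrightarrow> 0"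
    by (intro Lim_null_comparison[OF _ lim]) auto
  thus ?thesis by (simp add: LIM_zero_iff)
qed

lemma Lp_norm_tendsto:
  assumes p: "1 < p" and u: "\<And>n. u n \<in> Lp p" and f: "f \<in> Lp p"
    and lim: "(\<lambda>n. Lp_norm p (u n - f)) \<longlonglongrightarrow> 0"
  shows "(\<lambda>n. Lp_norm p (u n)) \<longlonglongrightarrow> Lp_norm p f"
proof -
  have "norm (Lp_norm p (u n) - Lp_norm p f) \<le> Lp_norm p (u n - f)" for n
    using Lp_norm_diff_le[of p "u n" f] Lp_norm_diff_le[of p f "u n"] p u f
    by (simp add: Lp_norm_minus_commute[of p f] abs_le_iff)
  hence "(\<lambda>n. Lp_norm p (u n) - Lp_norm p f) \<longlonglongrightarrow> 0"
    by (intro Lim_null_comparison[OF _ lim]) auto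
  thus ?thesis by (simp add: LIM_zero_iff)
qed

lemma Lp_limit_of_Trig:
  assumes p: "1 < p" and f: "f \<in> Lp p"
  obtains T where "\<And>n::nat. T n \<in> Trig" "(\<lambda>n. Lp_norm p (T n - f)) \<longlonglongrightarrow> 0"
proof -
  have "\<exists>T\<in>Trig. Lp_norm p (f - T) < 1 / real (Suc n)" for n
    by (rule Trig_dense[OF p f, of "1 / real (Suc n)"]) auto
  then obtain T where T: "\<And>n. T n \<in> Trig" "\<And>n. Lp_norm p (f - T n) < 1 / real (Suc n)" by metis
  have "norm (Lp_norm p (T n - f)) \<le> 1 / real (Suc n)" for n
    using T(2)[of n] by (simp only: Lp_norm_minus_commute[of p "T n"] real_norm_def abs_of_nonneg[OF Lp_norm_nonneg]) 
  hence "(\<lambda>n. Lp_norm p (T n - f)) \<longlonglongrightarrow> 0"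
    by (intro Lim_null_comparison[OF _ LIMSEQ_Suc[OF lim_1_over_n]] always_eventually allI)
  thus ?thesis using that T(1) by blast
qed

text \<open>Extension by density: the analytic parts of approximating trigonometric polynomials form
  a Cauchy sequence by the uniform bound, and coefficients and norms pass to the limit.\<close>

lemma M_Riesz:
  assumes p: "1 < p"
  obtains C where "C \<ge> 0"
    "\<And>f. f \<in> Lp p \<Longrightarrow> \<exists>g\<in>Lp p. analytic_part f g \<and> Lp_norm p g \<le> C * Lp_norm p f"
proof -
  obtain C where C: "C \<ge> 0" "\<And>f g. f \<in> Trig \<Longrightarrow> analytic_part f g \<Longrightarrow> Lp_norm p g \<le> C * Lp_norm p f"
    using riesz_bound_Trig[OF p] by blast
  show ?thesis
  proof (rule that[OF C(1)])
    fix f assume f: "f \<in> Lp p"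
    obtain T where T: "\<And>n::nat. T n \<in> Trig" "(\<lambda>n. Lp_norm p (T n - f)) \<longlonglongrightarrow> 0"
      using Lp_limit_of_Trig[OF p f] by blast
    have TL: "T n \<in> Lp p" for n using T(1) p Trig_Lp by auto
    have "\<exists>g\<in>Trig. analytic_part (T n) g" for n by (rule Trig_analytic_part[OF T(1)[of n]]) blast
    then obtain u where u: "\<And>n. u n \<in> Trig" "\<And>n. analytic_part (T n) (u n)" by metis
    have uL: "u n \<in> Lp p" for n using u(1) p Trig_Lp by auto
    obtain g where g: "g \<in> Lp p" "(\<lambda>n. Lp_norm p (u n - g)) \<longlonglongrightarrow> 0"
    proof (rule Lp_complete[OF p uL])
      fix e :: real assume e: "e > 0"
      have "e / (2 * C + 1) > 0" using e C(1) by simp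
      with T(2) have "\<forall>\<^sub>F n in sequentially. Lp_norm p (T n - f) < e / (2 * C + 1)"
        by (rule order_tendstoD(2))
      then obtain N where N: "\<And>n. n \<ge> N \<Longrightarrow> Lp_norm p (T n - f) < e / (2 * C + 1)"
        by (auto simp: eventually_sequentially)
      show "\<exists>N. \<forall>m\<ge>N. \<forall>n\<ge>N. Lp_norm p (u m - u n) < e"
      proof (intro exI allI impI)
        fix m n assume mn: "m \<ge> N" "n \<ge> N"
        have "Lp_norm p (u m - u n) \<le> C * Lp_norm p (T m - T n)"
          by (rule C(2)[OF cvs.subspace_diff[OF Trig_subspace T(1) T(1)] analytic_part_diff[OF u(2) u(2)]])
        also have "\<dots> \<le> C * (Lp_norm p (T m - f) + Lp_norm p (T n - f))"
          using Lp_norm_triangle_mid[of p "T m" f "T n"] p TL f C(1)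
          by (intro mult_left_mono) (auto simp: Lp_norm_minus_commute[of p f])
        also have "\<dots> \<le> C * (e / (2 * C + 1) + e / (2 * C + 1))"
          using N[OF mn(1)] N[OF mn(2)] C(1) by (intro mult_left_mono add_mono) auto
        also have "\<dots> = 2 * C * (e / (2 * C + 1))" by simp
        also have "\<dots> < (2 * C + 1) * (e / (2 * C + 1))"
          using \<open>e / (2 * C + 1) > 0\<close> by (intro mult_strict_right_mono) auto
        also have "\<dots> = e" using C(1) by simp
        finally show "Lp_norm p (u m - u n) < e" .
      qed
    qed
    have "analytic_part f g"
      unfolding analytic_part_def
    proof (intro conjI allI)
      show "f \<in> Lp 1" "g \<in> Lp 1" using Lp_norm_1_le(1)[OF p] f g by auto
      fix n
      have 1: "(\<lambda>k. fourier (u k) n) \<longlonglongrightarrow> fourier g n" by (rule fourier_tendsto[OF p uL g])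
      have "(\<lambda>k. fourier (T k) n) \<longlonglongrightarrow> fourier f n" by (rule fourier_tendsto[OF p TL f T(2)])
      hence "(\<lambda>k. if n \<ge> 0 then fourier (T k) n else 0) \<longlonglongrightarrow> (if n \<ge> 0 then fourier f n else 0)"
        by simp
      moreover have "fourier (u k) n = (if n \<ge> 0 then fourier (T k) n else 0)" for k
        using u(2)[of k] by (simp add: analytic_part_def)
      ultimately have "(\<lambda>k. fourier (u k) n) \<longlonglongrightarrow> (if n \<ge> 0 then fourier f n else 0)" by simp
      thus "fourier g n = (if n \<ge> 0 then fourier f n else 0)" by (rule LIMSEQ_unique[OF 1])
    qed
    moreover have "Lp_norm p g \<le> C * Lp_norm p f"
      by (rule LIMSEQ_le[OF Lp_norm_tendsto[OF p uL g] tendsto_mult[OF tendsto_const Lp_norm_tendsto[OF p TL f T(2)]]])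
        (use C(2)[OF T(1) u(2)] in auto)
    ultimately show "\<exists>g\<in>Lp p. analytic_part f g \<and> Lp_norm p g \<le> C * Lp_norm p f" using g(1) by blast
  qed
qed

section \<open>Hardy spaces\<close>

lemma HardyD: "f \<in> Hardy p \<Longrightarrow> f \<in> Lp p" "f \<in> Hardy p \<Longrightarrow> n < 0 \<Longrightarrow> fourier f n = 0"
  by (simp_all add: Hardy_def)

lemma conj_HardyD: "f \<in> conj_Hardy p \<Longrightarrow> f \<in> Lp p" "f \<in> conj_Hardy p \<Longrightarrow> n > 0 \<Longrightarrow> fourier f n = 0"
  by (simp_all add: conj_Hardy_def)

lemma Hardy_L1: "1 < p \<Longrightarrow> f \<in> Hardy p \<Longrightarrow> f \<in> Lp 1"
  by (rule Lp_norm_1_le(1)[OF _ HardyD(1)])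

lemma reflect_Hardy: "f \<in> Hardy p \<Longrightarrow> reflect f \<in> conj_Hardy p"
  and reflect_conj_Hardy: "f \<in> conj_Hardy p \<Longrightarrow> reflect f \<in> Hardy p"
  by (simp_all add: Hardy_def conj_Hardy_def reflect_Lp fourier_reflect)

text \<open>Uniqueness of Fourier coefficients discharges the definite description in
  \<open>riesz\<close>; identities for the projection become comparisons of coefficients.\<close>

lemma riesz_eqI:
  assumes p: "1 < p" and f: "f \<in> Lp p" and g: "g \<in> Lp p"
    and n: "\<And>n. n \<ge> 0 \<Longrightarrow> fourier g n = fourier f n" "\<And>n. n < 0 \<Longrightarrow> fourier g n = 0"
  shows "riesz p f = g"
  unfolding riesz_def
proof (rule the_equality)
  show "g \<in> Hardy p \<and> (\<forall>n\<ge>0. fourier g n = fourier f n)" using g n by (simp add: Hardy_def)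
  fix h assume h: "h \<in> Hardy p \<and> (\<forall>n\<ge>0. fourier h n = fourier f n)"
  show "h = g"
  proof (rule fourier_unique)
    show "h \<in> Lp 1" using Hardy_L1[OF p] h by blast
    show "g \<in> Lp 1" by (rule Lp_norm_1_le(1)[OF p g])
    show "fourier h k = fourier g k" for k
    proof (cases "k \<ge> 0")
      case True
      thus ?thesis using h n(1)[of k] by simp
    next
      case False
      thus ?thesis using h n(2)[of k] HardyD(2)[of h p k] by simp
    qed
  qed
qed

lemma riesz_bounded:
  assumes p: "1 < p"
  obtains C where "C \<ge> 0" "\<And>f. f \<in> Lp p \<Longrightarrow> Lp_norm p (riesz p f) \<le> C * Lp_norm p f"
proof -
  obtain C where C: "C \<ge> 0" "\<And>f. f \<in> Lp p \<Longrightarrow> \<exists>g\<in>Lp p. analytic_part f g \<and> Lp_norm p g \<le> C * Lp_norm p f"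
    using M_Riesz[OF p] by blast
  show ?thesis
  proof (rule that[OF C(1)])
    fix f assume f: "f \<in> Lp p"
    then obtain g where g: "g \<in> Lp p" "analytic_part f g" "Lp_norm p g \<le> C * Lp_norm p f" using C(2) by blast
    have "riesz p f = g" by (rule riesz_eqI[OF p f g(1)]) (use g(2) in \<open>auto simp: analytic_part_def\<close>)
    thus "Lp_norm p (riesz p f) \<le> C * Lp_norm p f" using g by simp
  qed
qed

lemma riesz_Lp:
  assumes p: "1 < p" and f: "f \<in> Lp p"
  shows "riesz p f \<in> Lp p" "fourier (riesz p f) n = (if n \<ge> 0 then fourier f n else 0)"
proof -
  obtain C where "\<And>f. f \<in> Lp p \<Longrightarrow> \<exists>g\<in>Lp p. analytic_part f g \<and> Lp_norm p g \<le> C * Lp_norm p f"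
    using M_Riesz[OF p] by blast
  then obtain g where g: "g \<in> Lp p" "analytic_part f g" using f by blast
  have "riesz p f = g" by (rule riesz_eqI[OF p f g(1)]) (use g(2) in \<open>auto simp: analytic_part_def\<close>)
  thus "riesz p f \<in> Lp p" "fourier (riesz p f) n = (if n \<ge> 0 then fourier f n else 0)"
    using g by (auto simp: analytic_part_def)
qed

lemma riesz_Hardy: "1 < p \<Longrightarrow> f \<in> Lp p \<Longrightarrow> riesz p f \<in> Hardy p"
  by (simp add: Hardy_def riesz_Lp)

lemma riesz_add: 
  assumes "1 < p" "f \<in> Lp p" "g \<in> Lp p"
  shows "riesz p (f + g) = riesz p f + riesz p g"
  using assms Lp_norm_1_le(1)[OF assms(1)]
  by (intro riesz_eqI) (auto simp: Lp_add riesz_Lp fourier_add)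

lemma riesz_cscale:
  assumes "1 < p" "f \<in> Lp p"
  shows "riesz p (cscale z f) = cscale z (riesz p f)"
  using assms by (intro riesz_eqI) (auto simp: Lp_cscale riesz_Lp fourier_cscale)

text \<open>Projecting approximating polynomials keeps them polynomials and makes them analytic;
  they still converge, because the projection is bounded and fixes \<open>g\<close>.\<close>

lemma Hardy_limit_of_Trig:
  assumes p: "1 < p" and g: "g \<in> Hardy p"
  obtains G where "\<And>n::nat. G n \<in> Trig" "\<And>n. G n \<in> Hardy p" "(\<lambda>n. Lp_norm p (G n - g)) \<longlonglongrightarrow> 0"
proof -
  obtain C where C: "C \<ge> 0" "\<And>f. f \<in> Lp p \<Longrightarrow> Lp_norm p (riesz p f) \<le> C * Lp_norm p f"
    using riesz_bounded[OF p] by blast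
  have gL: "g \<in> Lp p" using g by (rule HardyD)
  obtain T where T: "\<And>n::nat. T n \<in> Trig" "(\<lambda>n. Lp_norm p (T n - g)) \<longlonglongrightarrow> 0"
    using Lp_limit_of_Trig[OF p gL] by blast
  have TL: "T n \<in> Lp p" for n using T(1) p Trig_Lp by auto
  define G where "G n = riesz p (T n)" for n
  have "riesz p g = g" by (rule riesz_eqI[OF p gL gL]) (use g HardyD in auto)
  have le: "Lp_norm p (G n - g) \<le> C * Lp_norm p (T n - g)" for n
  proof -
    have "riesz p (T n - g) = G n - g"
      using riesz_add[OF p, of "T n - g" g] TL gL p by (simp add: Lp_diff G_def \<open>riesz p g = g\<close>)
    thus ?thesis using C(2)[of "T n - g"] TL gL p by (simp add: Lp_diff)
  qed
  have GT: "G n \<in> Trig" for n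
  proof -
    obtain u where u: "u \<in> Trig" "analytic_part (T n) u" using Trig_analytic_part[OF T(1)] by blast
    have "G n = u" unfolding G_def
      by (rule riesz_eqI[OF p TL]) (use u p Trig_Lp in \<open>auto simp: analytic_part_def\<close>)
    thus ?thesis using u by simp
  qed
  have "(\<lambda>n. C * Lp_norm p (T n - g)) \<longlonglongrightarrow> 0" using tendsto_mult[OF tendsto_const T(2), of C] by simp
  hence "(\<lambda>n. Lp_norm p (G n - g)) \<longlonglongrightarrow> 0"
    by (rule Lim_null_comparison[rotated]) (use le in auto)
  thus ?thesis using that[of G] GT riesz_Hardy[OF p TL] by (simp add: G_def)
qed

lemma Lp_mult_dual: "1 < p \<Longrightarrow> f \<in> Lp p \<Longrightarrow> g \<in> Lp (dual_exponent p) \<Longrightarrow> f * g \<in> Lp 1"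
  by (rule Holder_Lp_int)

text \<open>With an analytic polynomial in place of \<open>g\<close>, the coefficients of the
  product are finite convolutions, in which nothing is left for \<open>n < 0\<close> and a single
  term for \<open>n = 0\<close>. Hoelder's inequality carries this to the limit.\<close>

lemma fourier_Hardy_mult:
  assumes p: "1 < p" and f: "f \<in> Hardy p" and g: "g \<in> Hardy (dual_exponent p)"
  shows "n < 0 \<Longrightarrow> fourier (f * g) n = 0" "fourier (f * g) 0 = fourier f 0 * fourier g 0"
proof -
  let ?q = "dual_exponent p"
  note q = dual_exponent[OF p]
  obtain G where G: "\<And>n::nat. G n \<in> Trig" "\<And>n. G n \<in> Hardy ?q" "(\<lambda>n. Lp_norm ?q (G n - g)) \<longlonglongrightarrow> 0"
    using Hardy_limit_of_Trig[OF q(1) g] by blast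
  have L: "f \<in> Lp p" "g \<in> Lp ?q" "\<And>n. G n \<in> Lp ?q" using HardyD(1)[OF f] HardyD(1)[OF g] HardyD(1)[OF G(2)] by blast+
  have lim: "(\<lambda>k. fourier (f * G k) n) \<longlonglongrightarrow> fourier (f * g) n" for n
  proof -
    have le: "norm (fourier (f * G k) n - fourier (f * g) n) \<le> Lp_norm p f * Lp_norm ?q (G k - g)" for k
    proof -
      have "fourier (f * G k) n - fourier (f * g) n = fourier (f * (G k - g)) n"
        using L by (subst fourier_diff[symmetric]) (auto simp: Lp_mult_dual[OF p] algebra_simps)
      also have "norm \<dots> \<le> Lp_norm 1 (f * (G k - g))" by (rule norm_fourier_le)
      also have "\<dots> \<le> Lp_norm p f * Lp_norm ?q (G k - g)" using p q L by (intro Holder_Lp_int Lp_diff) auto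
      finally show ?thesis .
    qed
    have z: "(\<lambda>k. Lp_norm p f * Lp_norm ?q (G k - g)) \<longlonglongrightarrow> 0"
      using tendsto_mult[OF tendsto_const G(3), of "Lp_norm p f"] by simp
    have "(\<lambda>k. fourier (f * G k) n - fourier (f * g) n) \<longlonglongrightarrow> 0"
      by (rule Lim_null_comparison[OF always_eventually[OF allI[OF le]] z])
    thus ?thesis by (simp add: LIM_zero_iff)
  qed
  have f1: "f \<in> Lp 1" by (rule Hardy_L1[OF p f])
  have expand: "\<exists>N. fourier (f * G k) n = (\<Sum>m\<in>{- int N..int N}. fourier (G k) m * fourier f (n - m)) \<and>
      (\<forall>m. \<bar>m\<bar> > int N \<longrightarrow> fourier (G k) m = 0)" for k n
  proof -
    obtain N where N: "G k = (\<Sum>m\<in>{- int N..int N}. cscale (fourier (G k) m) (tpow m))"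
      "\<And>m. \<bar>m\<bar> > int N \<Longrightarrow> fourier (G k) m = 0"
      using Trig_expansion[OF G(1)[of k]] by blast
    have "f * G k = (\<Sum>m\<in>{- int N..int N}. cscale (fourier (G k) m) (tpow m * f))"
      by (subst N(1)) (simp add: sum_distrib_left cscale_mult_right mult.commute)
    hence "fourier (f * G k) n = (\<Sum>m\<in>{- int N..int N}. fourier (G k) m * fourier f (n - m))"
      by (simp add: fourier_sum Lp_cscale Lp_tpow_mult f1 fourier_cscale fourier_tpow_mult)
    thus ?thesis using N(2) by blast
  qed
  show "fourier (f * g) n = 0" if n: "n < 0"
  proof -
    have "fourier (f * G k) n = 0" for k
    proof -
      obtain N where "fourier (f * G k) n = (\<Sum>m\<in>{- int N..int N}. fourier (G k) m * fourier f (n - m))"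
        using expand by blast
      also have "\<dots> = 0"
      proof (intro sum.neutral ballI)
        fix m show "fourier (G k) m * fourier f (n - m) = 0"
          using HardyD(2)[OF G(2)[of k], of m] HardyD(2)[OF f, of "n - m"] n by (cases "m < 0") auto
      qed
      finally show ?thesis .
    qed
    thus ?thesis using lim[of n] by (simp add: LIMSEQ_const_iff)
  qed
  have "fourier (f * G k) 0 = fourier f 0 * fourier (G k) 0" for k
  proof -
    obtain N where "fourier (f * G k) 0 = (\<Sum>m\<in>{- int N..int N}. fourier (G k) m * fourier f (0 - m))"
      using expand by blast
    also have "\<dots> = (\<Sum>m\<in>{- int N..int N}. if m = 0 then fourier (G k) 0 * fourier f 0 else 0)"
    proof (rule sum.cong[OF refl])
      fix m show "fourier (G k) m * fourier f (0 - m) = (if m = 0 then fourier (G k) 0 * fourier f 0 else 0)"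
        using HardyD(2)[OF G(2)[of k], of m] HardyD(2)[OF f, of "0 - m"]
        by (cases m "0::int" rule: linorder_cases) auto
    qed
    also have "\<dots> = fourier f 0 * fourier (G k) 0" by (subst sum.delta) auto
    finally show ?thesis .
  qed
  hence "(\<lambda>k. fourier f 0 * fourier (G k) 0) \<longlonglongrightarrow> fourier (f * g) 0" using lim[of 0] by simp
  moreover have "(\<lambda>k. fourier f 0 * fourier (G k) 0) \<longlonglongrightarrow> fourier f 0 * fourier g 0"
    by (intro tendsto_mult tendsto_const fourier_tendsto[OF q(1) L(3) L(2) G(3)])
  ultimately show "fourier (f * g) 0 = fourier f 0 * fourier g 0" by (rule LIMSEQ_unique)
qed

lemma fourier_conj_Hardy_mult:
  assumes p: "1 < p" and f: "f \<in> conj_Hardy p" and g: "g \<in> conj_Hardy (dual_exponent p)"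
  shows "n > 0 \<Longrightarrow> fourier (f * g) n = 0" "fourier (f * g) 0 = fourier f 0 * fourier g 0"
  using fourier_Hardy_mult(1)[OF p reflect_conj_Hardy[OF f] reflect_conj_Hardy[OF g], of "- n"]
    fourier_Hardy_mult(2)[OF p reflect_conj_Hardy[OF f] reflect_conj_Hardy[OF g]]
  unfolding reflect_mult[symmetric] fourier_reflect by auto

section \<open>Operators and functionals on Hardy spaces\<close>

lemma Hardy_subspace: 
  assumes p: "1 < p"
  shows "cvs.subspace (Hardy p)"
  unfolding cvs.subspace_def
proof (intro conjI ballI allI)
  show "0 \<in> Hardy p" by (simp add: Hardy_def)
  show "f + g \<in> Hardy p" if "f \<in> Hardy p" "g \<in> Hardy p" for f g
    using that p Hardy_L1[OF p] by (simp add: Hardy_def Lp_add fourier_add)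
  show "cscale z f \<in> Hardy p" if "f \<in> Hardy p" for f z
    using that by (simp add: Hardy_def Lp_cscale fourier_cscale)
qed

lemmas Hardy_add = cvs.subspace_add[OF Hardy_subspace]
lemmas Hardy_diff = cvs.subspace_diff[OF Hardy_subspace]
lemmas Hardy_cscale = cvs.subspace_scale[OF Hardy_subspace]
lemmas Hardy_0 = cvs.subspace_0[OF Hardy_subspace]

lemma Hardy_closed_subspace:
  assumes p: "1 < p"
  shows "closed_subspace p (Hardy p)"
  unfolding closed_subspace_def
proof (intro conjI allI impI Hardy_subspace[OF p])
  show "Hardy p \<subseteq> Lp p" by (auto simp: Hardy_def)
  fix u g assume ug: "(\<forall>n::nat. u n \<in> Hardy p) \<and> g \<in> Lp p \<and> (\<lambda>n. Lp_norm p (u n - g)) \<longlonglongrightarrow> 0"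
  have uL: "u n \<in> Lp p" for n using ug by (blast intro: HardyD(1))
  show "g \<in> Hardy p"
    unfolding Hardy_def
  proof (intro CollectI conjI allI impI)
    show "g \<in> Lp p" using ug by blast
    fix k :: int assume "k < 0"
    hence "fourier (u n) k = 0" for n using ug HardyD(2)[of "u n" p k] by blast
    moreover have "(\<lambda>n. fourier (u n) k) \<longlonglongrightarrow> fourier g k"
      by (rule fourier_tendsto[OF p uL]) (use ug in auto)
    ultimately show "fourier g k = 0" by (simp add: LIMSEQ_const_iff)
  qed
qed

lemma Hardy_limit:
  assumes "1 < p" "\<And>n::nat. u n \<in> Hardy p" "g \<in> Lp p" "(\<lambda>n. Lp_norm p (u n - g)) \<longlonglongrightarrow> 0"
  shows "g \<in> Hardy p"
  using Hardy_closed_subspace[OF assms(1)] assms(2-4) unfolding closed_subspace_def by blast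

lemma bounded_opD:
  assumes "bounded_op p A" "1 < p" "f \<in> Hardy p" "g \<in> Hardy p"
  shows "A f \<in> Hardy p" "A (f + g) = A f + A g" "A (cscale z f) = cscale z (A f)" "A (f - g) = A f - A g" "A 0 = 0"
proof -
  have *: "\<And>f. f \<in> Hardy p \<Longrightarrow> A f \<in> Hardy p" "\<And>f g. f \<in> Hardy p \<Longrightarrow> g \<in> Hardy p \<Longrightarrow> A (f + g) = A f + A g"
    "\<And>z f. f \<in> Hardy p \<Longrightarrow> A (cscale z f) = cscale z (A f)"
    using assms(1) unfolding bounded_op_def by blast+
  show "A f \<in> Hardy p" "A (f + g) = A f + A g" "A (cscale z f) = cscale z (A f)" using * assms by auto
  have "A (f - g) + A g = A f"
    using *(2)[of "f - g" g] assms Hardy_diff[of p f g] by simp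
  thus "A (f - g) = A f - A g" by (simp add: eq_diff_eq)
  show "A 0 = 0" using *(3)[OF assms(3), of 0] by simp
qed

section \<open>The open mapping theorem for \<open>Hardy p\<close>\<close>

lemma Metric_space_Hardy:
  assumes p: "1 < p"
  shows "Metric_space (Hardy p) (\<lambda>f g. Lp_norm p (f - g))"
proof
  fix f g :: circ_fun
  show "0 \<le> Lp_norm p (f - g)" by simp
  show "Lp_norm p (f - g) = Lp_norm p (g - f)" by (rule Lp_norm_minus_commute)
next
  fix f g assume "f \<in> Hardy p" "g \<in> Hardy p"
  hence "f - g \<in> Lp p" using p by (intro Lp_diff HardyD(1)) auto
  thus "Lp_norm p (f - g) = 0 \<longleftrightarrow> f = g" using p by (simp add: Lp_norm_eq_0)
next
  fix f g h assume "f \<in> Hardy p" "g \<in> Hardy p" "h \<in> Hardy p"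
  thus "Lp_norm p (f - h) \<le> Lp_norm p (f - g) + Lp_norm p (g - h)"
    using p by (intro Lp_norm_triangle_mid HardyD(1)) auto
qed

lemma mcomplete_Hardy:
  assumes p: "1 < p"
  shows "Metric_space.mcomplete (Hardy p) (\<lambda>f g. Lp_norm p (f - g))"
proof -
  interpret M: Metric_space "Hardy p" "\<lambda>f g. Lp_norm p (f - g)" by (rule Metric_space_Hardy[OF p])
  show ?thesis
    unfolding M.mcomplete_def
  proof (intro allI impI)
    fix u :: "nat \<Rightarrow> circ_fun" assume u: "M.MCauchy u"
    have uH: "u n \<in> Hardy p" for n by (rule range_subsetD[OF conjunct1[OF u[unfolded M.MCauchy_def]]])
    have uL: "u n \<in> Lp p" for n by (rule HardyD(1)[OF uH])
    obtain g where g: "g \<in> Lp p" "(\<lambda>n. Lp_norm p (u n - g)) \<longlonglongrightarrow> 0"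
    proof (rule Lp_complete[OF p uL])
      fix e :: real assume "e > 0"
      then obtain N where "\<forall>n n'. N \<le> n \<longrightarrow> N \<le> n' \<longrightarrow> Lp_norm p (u n - u n') < e"
        using conjunct2[OF u[unfolded M.MCauchy_def]] by blast
      thus "\<exists>N. \<forall>m\<ge>N. \<forall>n\<ge>N. Lp_norm p (u m - u n) < e" by blast
    qed
    have gH: "g \<in> Hardy p" by (rule Hardy_limit[OF p uH g])
    have "limitin M.mtopology u g sequentially"
      unfolding M.limitin_metric_dist_null using gH uH g(2) by auto
    thus "\<exists>x. limitin M.mtopology u x sequentially" by blast
  qed
qed

text \<open>Baire category gives approximate solutions of \<open>A x = y\<close> with norm
  controlled by that of \<open>y\<close>. Summing corrections for successively halved residuals
  gives an exact solution with twice the constant, and injectivity identifies it with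
  \<open>f\<close>.\<close>

lemma bounded_inverse:
  assumes p: "1 < p" and A: "bounded_op p A"
    and inj: "\<And>f. f \<in> Hardy p \<Longrightarrow> A f = 0 \<Longrightarrow> f = 0"
    and surj: "\<And>g. g \<in> Hardy p \<Longrightarrow> \<exists>f\<in>Hardy p. A f = g"
  obtains C where "C \<ge> 0" "\<And>f. f \<in> Hardy p \<Longrightarrow> Lp_norm p f \<le> C * Lp_norm p (A f)"
proof -
  let ?H = "Hardy p"
  let ?N = "Lp_norm p"
  interpret M: Metric_space ?H "\<lambda>f g. ?N (f - g)" by (rule Metric_space_Hardy[OF p])
  have HL: "f \<in> Lp p" if "f \<in> ?H" for f by (rule HardyD(1)[OF that])
  have H0: "0 \<in> ?H" by (rule Hardy_0[OF p])
  have AH: "A f \<in> ?H" if "f \<in> ?H" for f by (rule bounded_opD(1)[OF A p that that])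
  have Adiff: "A (f - g) = A f - A g" if "f \<in> ?H" "g \<in> ?H" for f g by (rule bounded_opD(4)[OF A p that])
  have Aadd: "A (f + g) = A f + A g" if "f \<in> ?H" "g \<in> ?H" for f g by (rule bounded_opD(2)[OF A p that])
  have Ascale: "A (cscale z f) = cscale z (A f)" if "f \<in> ?H" for f z by (rule bounded_opD(3)[OF A p that that])
  obtain L where L: "\<And>f. f \<in> ?H \<Longrightarrow> ?N (A f) \<le> L * ?N f" using A unfolding bounded_op_def by blast
  define K where "K n = M.mtopology closure_of (A ` {x \<in> ?H. ?N x \<le> real n})" for n
  have Kmem: "y \<in> K n \<longleftrightarrow> y \<in> ?H \<and> (\<forall>e>0. \<exists>x\<in>?H. ?N x \<le> real n \<and> ?N (A x - y) < e)" for y n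
  proof -
    have "y \<in> K n \<longleftrightarrow> y \<in> ?H \<and> (\<forall>e>0. \<exists>z\<in>A ` {x \<in> ?H. ?N x \<le> real n}. z \<in> M.mball y e)"
      unfolding K_def M.metric_closure_of by blast
    also have "\<dots> \<longleftrightarrow> y \<in> ?H \<and> (\<forall>e>0. \<exists>x\<in>?H. ?N x \<le> real n \<and> ?N (A x - y) < e)"
      using AH by (auto simp: M.in_mball Lp_norm_minus_commute[of p y])
    finally show ?thesis .
  qed
  have Un: "(\<Union>n. K n) = ?H"
  proof (intro equalityI subsetI)
    fix y assume y: "y \<in> ?H"
    then obtain f where f: "f \<in> ?H" "A f = y" using surj by blast
    obtain n where "?N f \<le> real n" using real_arch_simple by blast
    hence "y \<in> K n" unfolding Kmem using y f by (auto intro!: bexI[of _ f])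
    thus "y \<in> (\<Union>n. K n)" by blast
  qed (auto simp: Kmem)
  have "\<exists>n. M.mtopology interior_of (K n) \<noteq> {}"
  proof (rule ccontr)
    assume "\<not> (\<exists>n. M.mtopology interior_of (K n) \<noteq> {})"
    hence "M.mtopology interior_of (\<Union>(range K)) = {}"
      by (intro M.metric_Baire_category_alt[OF mcomplete_Hardy[OF p]]) (auto simp: K_def)
    moreover have "M.mtopology interior_of ?H = ?H"
      using interior_of_topspace[of M.mtopology] by simp
    ultimately show False using Un H0 by simp
  qed
  then obtain n y0 where y0: "y0 \<in> M.mtopology interior_of (K n)" by blast
  obtain r where r: "r > 0" "M.mball y0 r \<subseteq> K n"
  proof -
    have "openin M.mtopology (M.mtopology interior_of (K n))" by (rule openin_interior_of)
    then obtain r where r: "r > 0" "M.mball y0 r \<subseteq> M.mtopology interior_of (K n)"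
      using y0 unfolding M.openin_mtopology by blast
    show ?thesis by (rule that[OF r(1) order_trans[OF r(2) interior_of_subset]])
  qed
  have y0H: "y0 \<in> ?H" using y0 interior_of_subset[of M.mtopology "K n"] Kmem by blast
  \<comment> \<open>\<open>y\<close> will be scaled to norm \<open>r / 2\<close>, and the difference
    of two approximate preimages has norm at most \<open>2 * real n\<close>; undoing the scaling
    yields \<open>4 * real n / r\<close>.\<close>
  define m where "m = 4 * real n / r"
  have m0: "m \<ge> 0" using r by (simp add: m_def)
  have approx: "\<exists>x\<in>?H. ?N x \<le> m * ?N y \<and> ?N (A x - y) < e" if y: "y \<in> ?H" and e: "e > 0" for y e
  proof (cases "y = 0")
    case True
    thus ?thesis using H0 e bounded_opD(5)[OF A p H0 H0] by (intro bexI[of _ 0]) auto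
  next
    case False
    have ny: "?N y > 0" using False HL[OF y] p by (intro Lp_norm_pos) auto
    define s where "s = r / (2 * ?N y)"
    have s: "s > 0" using r ny by (simp add: s_def)
    define y' where "y' = cscale (of_real s) y"
    have y'H: "y' \<in> ?H" unfolding y'_def by (rule Hardy_cscale[OF p y])
    have nos: "norm (complex_of_real s) = s" using s by (simp only: norm_of_real abs_of_pos)
    have ny': "?N y' = r / 2" using s ny p by (simp add: y'_def Lp_norm_cscale nos) (simp add: s_def)
    have "y0 + y' \<in> M.mball y0 r"
      using y0H y'H ny' r Hardy_add[OF p y0H y'H] Lp_norm_minus_commute[of p y0 "y0 + y'"]
      by (simp add: M.in_mball)
    hence 1: "y0 + y' \<in> K n" using r(2) by blast
    have 2: "y0 \<in> K n" using r y0H by (intro subsetD[OF r(2)]) (simp add: M.in_mball)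
    have es: "e * s / 2 > 0" using e s by simp
    obtain x1 where x1: "x1 \<in> ?H" "?N x1 \<le> real n" "?N (A x1 - (y0 + y')) < e * s / 2" using 1 es unfolding Kmem by blast
    obtain x2 where x2: "x2 \<in> ?H" "?N x2 \<le> real n" "?N (A x2 - y0) < e * s / 2" using 2 es unfolding Kmem by blast
    define x where "x = cscale (of_real (1 / s)) (x1 - x2)"
    have x12: "x1 - x2 \<in> ?H" by (rule Hardy_diff[OF p x1(1) x2(1)])
    have xH: "x \<in> ?H" unfolding x_def by (rule Hardy_cscale[OF p x12])
    have "?N x = 1 / s * ?N (x1 - x2)" using s p by (simp add: x_def Lp_norm_cscale norm_divide)
    also have "\<dots> \<le> 1 / s * (real n + real n)"
      using Lp_norm_triangle_diff[of p x1 x2] p HL x1 x2 s by (intro mult_left_mono) auto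
    also have "\<dots> = m * ?N y" using ny r by (simp add: m_def s_def field_simps)
    finally have nx: "?N x \<le> m * ?N y" .
    have "y = cscale (of_real (1 / s)) y'" using s by (simp add: y'_def)
    hence "A x - y = cscale (of_real (1 / s)) ((A x1 - (y0 + y')) - (A x2 - y0))"
      using x12 x1(1) x2(1) by (simp add: x_def Ascale Adiff cscale_diff_right[symmetric] del: of_real_divide)
    hence "?N (A x - y) = 1 / s * ?N ((A x1 - (y0 + y')) - (A x2 - y0))"
      using s p by (simp add: Lp_norm_cscale norm_divide)
    also have "\<dots> \<le> 1 / s * (?N (A x1 - (y0 + y')) + ?N (A x2 - y0))"
      using p s x1 x2 y0H y'H AH HL by (intro mult_left_mono Lp_norm_triangle_diff Lp_diff Lp_add) auto
    also have "\<dots> < 1 / s * (e * s / 2 + e * s / 2)"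
      using s by (intro mult_strict_left_mono add_strict_mono x1 x2) auto
    also have "\<dots> = e" using s by simp
    finally show ?thesis using xH nx by blast
  qed
  show ?thesis
  proof (rule that[of "2 * m"])
    show "2 * m \<ge> 0" using m0 by simp
    fix f assume f: "f \<in> ?H"
    show "?N f \<le> 2 * m * ?N (A f)"
    proof (cases "A f = 0")
      case True thus ?thesis using inj[OF f] by simp
    next
      case False
      define y where "y = A f"
      have yH: "y \<in> ?H" unfolding y_def by (rule AH[OF f])
      have ny: "?N y > 0" using False HL[OF yH] p unfolding y_def by (intro Lp_norm_pos) auto
      define S where "S z e = (SOME x. x \<in> ?H \<and> ?N x \<le> m * ?N z \<and> ?N (A x - z) < e)" for z and e :: real
      have S: "S z e \<in> ?H \<and> ?N (S z e) \<le> m * ?N z \<and> ?N (A (S z e) - z) < e" if "z \<in> ?H" "e > 0" for z e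
        unfolding S_def by (rule someI_ex) (use approx[OF that] in blast)
      \<comment> \<open>\<open>R k\<close> is the part of \<open>y\<close> still to be solved for
        after \<open>k\<close> corrections; its norm is at most \<open>?N y / 2 ^ k\<close>.\<close>
      define R where "R = rec_nat y (\<lambda>k z. z - A (S z (?N y / 2 ^ Suc k)))"
      have R0: "R 0 = y" and RS: "R (Suc k) = R k - A (S (R k) (?N y / 2 ^ Suc k))" for k
        by (simp_all add: R_def)
      have R: "R k \<in> ?H \<and> ?N (R k) \<le> ?N y / 2 ^ k" for k
      proof (induct k)
        case 0 show ?case using yH by (simp add: R0)
      next
        case (Suc k)
        have "?N y / 2 ^ Suc k > 0" using ny by simp
        from S[OF conjunct1[OF Suc] this] have s: "S (R k) (?N y / 2 ^ Suc k) \<in> ?H"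
          "?N (A (S (R k) (?N y / 2 ^ Suc k)) - R k) < ?N y / 2 ^ Suc k" by blast+
        have "R (Suc k) \<in> ?H" unfolding RS by (rule Hardy_diff[OF p conjunct1[OF Suc] AH[OF s(1)]])
        moreover have "?N (R (Suc k)) \<le> ?N y / 2 ^ Suc k"
          unfolding RS Lp_norm_minus_commute[of p "R k"] using s(2) by (rule less_imp_le)
        ultimately show ?case by blast
      qed
      define X where "X k = S (R k) (?N y / 2 ^ Suc k)" for k
      have X: "X k \<in> ?H" "?N (X k) \<le> m * ?N y * (1/2) ^ k" for k
      proof -
        have "?N y / 2 ^ Suc k > 0" using ny by simp
        from S[OF conjunct1[OF R] this] show "X k \<in> ?H" unfolding X_def by blast
        from S[OF conjunct1[OF R[of k]] \<open>?N y / 2 ^ Suc k > 0\<close>] have "?N (X k) \<le> m * ?N (R k)" unfolding X_def by blast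
        also have "\<dots> \<le> m * (?N y / 2 ^ k)" using R m0 by (intro mult_left_mono) auto
        finally show "?N (X k) \<le> m * ?N y * (1/2) ^ k" by (simp add: power_divide)
      qed
      define s where "s n = (\<Sum>k<n. X k)" for n
      have sH: "s n \<in> ?H" for n unfolding s_def by (rule cvs.subspace_sum[OF Hardy_subspace[OF p]]) (rule X)
      have sS: "s (Suc n) = s n + X n" for n by (simp add: s_def)
      have As: "A (s n) = y - R n" for n
      proof (induct n)
        case 0 show ?case by (simp add: s_def R0 bounded_opD(5)[OF A p H0 H0])
      next
        case (Suc n)
        have "A (s (Suc n)) = A (s n) + A (X n)" unfolding sS by (rule Aadd[OF sH X(1)])
        thus ?case using Suc by (simp add: RS X_def)
      qed
      have step: "?N (s (n + j) - s n) \<le> 2 * m * ?N y * ((1/2) ^ n - (1/2) ^ (n + j))" for n j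
      proof (induct j)
        case 0 show ?case by simp
      next
        case (Suc j)
        have eq: "s (n + Suc j) - s n = (s (n + j) - s n) + X (n + j)" by (simp add: sS)
        have "?N (s (n + Suc j) - s n) \<le> ?N (s (n + j) - s n) + ?N (X (n + j))"
          unfolding eq using p by (intro Lp_norm_triangle Lp_diff HL sH X) auto
        also have "\<dots> \<le> 2 * m * ?N y * ((1/2) ^ n - (1/2) ^ (n + j)) + m * ?N y * (1/2) ^ (n + j)"
          by (intro add_mono Suc X)
        also have "\<dots> = 2 * m * ?N y * ((1/2) ^ n - (1/2) ^ (n + Suc j))"
          by (simp add: algebra_simps)
        finally show ?case .
      qed
      have step': "?N (s k - s n) \<le> 2 * m * ?N y * (1/2) ^ n" if "k \<ge> n" for k n
      proof -
        have "?N (s k - s n) \<le> 2 * m * ?N y * ((1/2) ^ n - (1/2) ^ k)"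
          using step[of n "k - n"] that by simp
        also have "\<dots> \<le> 2 * m * ?N y * (1/2) ^ n" using m0 by (intro mult_left_mono) auto
        finally show ?thesis .
      qed
      obtain x where x: "x \<in> Lp p" "(\<lambda>n. ?N (s n - x)) \<longlonglongrightarrow> 0"
      proof (rule Lp_complete[OF p HL[OF sH]])
        fix e :: real assume e: "e > 0"
        have "(\<lambda>n. 2 * m * ?N y * (1/2) ^ n) \<longlonglongrightarrow> 2 * m * ?N y * 0"
          by (intro tendsto_mult tendsto_const LIMSEQ_power_zero) simp
        hence "\<forall>\<^sub>F n in sequentially. 2 * m * ?N y * (1/2) ^ n < e"
          using e by (intro order_tendstoD(2)[of _ 0]) simp_all
        then obtain N where N: "\<And>n. n \<ge> N \<Longrightarrow> 2 * m * ?N y * (1/2) ^ n < e" by (auto simp: eventually_sequentially)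
        show "\<exists>N. \<forall>m\<ge>N. \<forall>n\<ge>N. ?N (s m - s n) < e"
        proof (intro exI allI impI)
          fix i j assume "i \<ge> N" "j \<ge> N"
          thus "?N (s i - s j) < e"
            using step'[of j i] step'[of i j] N[of i] N[of j] Lp_norm_minus_commute[of p "s i" "s j"]
            by (cases "j \<le> i") linarith+
        qed
      qed
      have xH: "x \<in> ?H" by (rule Hardy_limit[OF p sH x])
      have nx: "?N x \<le> 2 * m * ?N y"
      proof (rule LIMSEQ_le_const2[OF Lp_norm_tendsto[OF p HL[OF sH] x]])
        have "?N (s n) \<le> 2 * m * ?N y" for n using step'[of 0 n] by (simp add: s_def)
        thus "\<exists>N. \<forall>n\<ge>N. ?N (s n) \<le> 2 * m * ?N y" by blast
      qed
      have "A x = y"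
      proof -
        have le: "?N (A x - y) \<le> L * ?N (s n - x) + ?N y * (1/2) ^ n" for n
        proof -
          have "A x - y = - (A (s n - x) + R n)"
            by (simp add: Adiff[OF sH xH] As)
          hence "?N (A x - y) = ?N (A (s n - x) + R n)" by (simp only: Lp_norm_minus)
          also have "\<dots> \<le> ?N (A (s n - x)) + ?N (R n)"
            using p R by (intro Lp_norm_triangle HL AH Hardy_diff[OF p] sH xH) auto
          also have "\<dots> \<le> L * ?N (s n - x) + ?N y * (1/2) ^ n"
            using L[OF Hardy_diff[OF p sH xH]] conjunct2[OF R[of n]] by (intro add_mono) (auto simp: power_divide)
          finally show ?thesis .
        qed
        have "(\<lambda>n. L * ?N (s n - x) + ?N y * (1/2) ^ n) \<longlonglongrightarrow> L * 0 + ?N y * 0"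
          by (intro tendsto_intros x LIMSEQ_power_zero) simp
        hence "?N (A x - y) \<le> L * 0 + ?N y * 0"
          by (rule LIMSEQ_le_const) (use le in blast)
        hence "?N (A x - y) = 0" using Lp_norm_nonneg[of p "A x - y"] by simp
        thus ?thesis using Lp_norm_eq_0[of p "A x - y"] p AH[OF xH] yH HL by (simp add: Lp_diff)
      qed
      hence "A (x - f) = 0" using Adiff[OF xH f] by (simp add: y_def)
      hence "x = f" using inj[OF Hardy_diff[OF p xH f]] by simp
      thus ?thesis using nx by (simp add: y_def)
    qed
  qed
qed

section \<open>The dual space of \<open>Hardy p\<close> and closed ranges\<close>

lemma Hardy_dualD:
  assumes "\<phi> \<in> Hardy_dual p"
  shows "\<And>f g. f \<in> Hardy p \<Longrightarrow> g \<in> Hardy p \<Longrightarrow> \<phi> (f + g) = \<phi> f + \<phi> g"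
    "\<And>z f. f \<in> Hardy p \<Longrightarrow> \<phi> (cscale z f) = z * \<phi> f"
    "\<exists>C. \<forall>f\<in>Hardy p. norm (\<phi> f) \<le> C * Lp_norm p f"
    "\<And>f. f \<notin> Hardy p \<Longrightarrow> \<phi> f = 0"
  using assms unfolding Hardy_dual_def by blast+

text \<open>A bilinear pairing, without conjugation. The value off \<open>Hardy p\<close> follows
  the convention of \<open>Hardy_dual\<close>, so that functionals can be compared as
  functions.\<close>

definition pairing :: "real \<Rightarrow> circ_fun \<Rightarrow> circ_fun \<Rightarrow> complex" where
  "pairing p u f = (if f \<in> Hardy p then fourier (f * u) 0 else 0)"

lemma pairing_Hardy_dual:
  assumes p: "1 < p" and u: "u \<in> Lp (dual_exponent p)"
  shows "pairing p u \<in> Hardy_dual p"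
  unfolding Hardy_dual_def
proof (intro CollectI conjI ballI allI impI)
  fix f g assume f: "f \<in> Hardy p" and g: "g \<in> Hardy p"
  show "pairing p u (f + g) = pairing p u f + pairing p u g"
    using f g Hardy_add[OF p f g] Lp_mult_dual[OF p HardyD(1)[OF f] u] Lp_mult_dual[OF p HardyD(1)[OF g] u]
    by (simp add: pairing_def distrib_right fourier_add)
next
  fix z f assume "f \<in> Hardy p"
  thus "pairing p u (cscale z f) = z * pairing p u f"
    using Hardy_cscale[OF p, of f z] by (simp add: pairing_def cscale_mult_left fourier_cscale)
next
  have "norm (pairing p u f) \<le> Lp_norm (dual_exponent p) u * Lp_norm p f" if f: "f \<in> Hardy p" for f
  proof -
    have "norm (pairing p u f) = norm (fourier (f * u) 0)" using f by (simp add: pairing_def)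
    also have "\<dots> \<le> Lp_norm 1 (f * u)" by (rule norm_fourier_le)
    also have "\<dots> \<le> Lp_norm p f * Lp_norm (dual_exponent p) u" by (rule Holder_Lp_int(2)[OF p HardyD(1)[OF f] u])
    finally show ?thesis by (simp add: mult.commute)
  qed
  thus "\<exists>C. \<forall>f\<in>Hardy p. norm (pairing p u f) \<le> C * Lp_norm p f" by blast
qed (simp add: pairing_def)

text \<open>\<open>f - riesz p f\<close> has negative indices only and \<open>reflect w\<close> none
  that are positive, so their product has mean zero.\<close>

lemma fourier_mult_reflect_riesz:
  assumes p: "1 < p" and f: "f \<in> Lp p" and w: "w \<in> Hardy (dual_exponent p)"
  shows "fourier (riesz p f * reflect w) 0 = fourier (f * reflect w) 0"
proof -
  note q = dual_exponent[OF p]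
  have P: "riesz p f \<in> Lp p" by (rule riesz_Lp(1)[OF p f])
  have f1: "f \<in> Lp 1" "riesz p f \<in> Lp 1" using Lp_norm_1_le(1)[OF p] f P by auto
  have w': "reflect w \<in> Lp (dual_exponent p)" by (rule reflect_Lp[OF HardyD(1)[OF w]])
  have v: "f - riesz p f \<in> conj_Hardy p"
    using f P p f1 by (simp add: conj_Hardy_def Lp_diff fourier_diff riesz_Lp(2)[OF p f])
  have "fourier ((f - riesz p f) * reflect w) 0 = fourier (f - riesz p f) 0 * fourier (reflect w) 0"
    by (rule fourier_conj_Hardy_mult(2)[OF p v reflect_Hardy[OF w]])
  also have "\<dots> = 0" using f1 by (simp add: fourier_diff riesz_Lp(2)[OF p f])
  finally have "fourier (f * reflect w - riesz p f * reflect w) 0 = 0" by (simp add: left_diff_distrib)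
  thus ?thesis using Lp_mult_dual[OF p f w'] Lp_mult_dual[OF p P w'] by (simp add: fourier_diff)
qed

text \<open>The kernel of the functional is closed, and a function separating some \<open>g\<close>
  from it represents the functional up to a scalar. Only its coefficients of nonpositive index act
  on \<open>Hardy p\<close>, so it can be projected to the form \<open>reflect w\<close>.\<close>

lemma Hardy_dual_representation:
  assumes p: "1 < p" and \<phi>: "\<phi> \<in> Hardy_dual p"
  obtains w where "w \<in> Hardy (dual_exponent p)" "\<phi> = pairing p (reflect w)"
proof (cases "\<forall>f\<in>Hardy p. \<phi> f = 0")
  case True
  have "\<phi> = pairing p (reflect 0)"
    using True Hardy_dualD(4)[OF \<phi>] by (auto simp: pairing_def fun_eq_iff)
  thus ?thesis using that Hardy_0[OF dual_exponent(1)[OF p]] by blast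
next
  case False
  then obtain g where g: "g \<in> Hardy p" "\<phi> g \<noteq> 0" by blast
  note q = dual_exponent[OF p]
  obtain C where C: "\<And>f. f \<in> Hardy p \<Longrightarrow> norm (\<phi> f) \<le> C * Lp_norm p f" using Hardy_dualD(3)[OF \<phi>] by blast
  have \<phi>diff: "\<phi> (f - h) = \<phi> f - \<phi> h" if "f \<in> Hardy p" "h \<in> Hardy p" for f h
    using Hardy_dualD(1)[OF \<phi>, of "f - h" h] Hardy_diff[OF p that] that by simp
  define Y where "Y = {f \<in> Hardy p. \<phi> f = 0}"
  have \<phi>0: "\<phi> 0 = 0" using Hardy_dualD(2)[OF \<phi> g(1), of 0] by simp
  have Y: "closed_subspace p Y"
    unfolding closed_subspace_def
  proof (intro conjI allI impI)
    show "Y \<subseteq> Lp p" unfolding Y_def using HardyD(1) by blast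
    show "cvs.subspace Y"
      unfolding cvs.subspace_def Y_def
      using Hardy_0[OF p] Hardy_add[OF p] Hardy_cscale[OF p] Hardy_dualD(1,2)[OF \<phi>] \<phi>0 by simp
    fix u h assume u: "(\<forall>n::nat. u n \<in> Y) \<and> h \<in> Lp p \<and> (\<lambda>n. Lp_norm p (u n - h)) \<longlonglongrightarrow> 0"
    have uH: "u n \<in> Hardy p" "\<phi> (u n) = 0" for n using u unfolding Y_def by blast+
    have hH: "h \<in> Hardy p" using Hardy_limit[of p u h] p uH(1) u by blast
    have le: "norm (\<phi> h) \<le> C * Lp_norm p (u n - h)" for n
      using C[OF Hardy_diff[OF p uH(1) hH], of n] \<phi>diff[OF uH(1) hH, of n] uH(2)[of n] by simp
    have "(\<lambda>n. C * Lp_norm p (u n - h)) \<longlonglongrightarrow> C * 0" using u by (intro tendsto_mult tendsto_const) blast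
    hence "norm (\<phi> h) \<le> C * 0" by (rule LIMSEQ_le_const) (use le in blast)
    thus "h \<in> Y" using hH by (simp add: Y_def)
  qed
  have "g \<notin> Y" using g by (simp add: Y_def)
  then obtain w0 where w0: "w0 \<in> Lp (dual_exponent p)" "\<And>y. y \<in> Y \<Longrightarrow> fourier (w0 * y) 0 = 0" "fourier (w0 * g) 0 \<noteq> 0"
    using separation[OF p Y HardyD(1)[OF g(1)]] by blast
  define w1 where "w1 = cscale (\<phi> g / fourier (w0 * g) 0) w0"
  have w1: "w1 \<in> Lp (dual_exponent p)" unfolding w1_def by (rule Lp_cscale[OF w0(1)])
  have rep: "\<phi> f = fourier (f * w1) 0" if f: "f \<in> Hardy p" for f
  proof -
    let ?z = "\<phi> f / \<phi> g"
    have zg: "cscale ?z g \<in> Hardy p" by (rule Hardy_cscale[OF p g(1)])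
    have "\<phi> (f - cscale ?z g) = 0" using g(2) by (simp add: \<phi>diff[OF f zg] Hardy_dualD(2)[OF \<phi> g(1)])
    hence "f - cscale ?z g \<in> Y" using Hardy_diff[OF p f zg] by (simp add: Y_def)
    hence "fourier (w0 * (f - cscale ?z g)) 0 = 0" by (rule w0(2))
    hence "fourier (w0 * f) 0 = ?z * fourier (w0 * g) 0"
      using mult_Lp_dual[OF p HardyD(1)[OF f] w0(1)] mult_Lp_dual[OF p HardyD(1)[OF zg] w0(1)]
      by (simp add: right_diff_distrib fourier_diff cscale_mult_right fourier_cscale)
    thus ?thesis using w0(3) g(2) by (simp add: w1_def cscale_mult_right fourier_cscale mult.commute[of f])
  qed
  define w where "w = riesz (dual_exponent p) (reflect w1)"
  have wH: "w \<in> Hardy (dual_exponent p)" unfolding w_def by (rule riesz_Hardy[OF q(1) reflect_Lp[OF w1]])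
  have "\<phi> f = pairing p (reflect w) f" for f
  proof (cases "f \<in> Hardy p")
    case True
    have "fourier (riesz (dual_exponent p) (reflect w1) * reflect f) 0 = fourier (reflect w1 * reflect f) 0"
      by (rule fourier_mult_reflect_riesz[OF q(1) reflect_Lp[OF w1]]) (simp add: q True)
    hence "fourier (reflect (w * reflect f)) 0 = fourier (reflect (reflect w1 * reflect f)) 0"
      by (simp add: fourier_reflect w_def)
    thus ?thesis using True rep[OF True] by (simp add: reflect_mult pairing_def mult.commute)
  qed (simp add: Hardy_dualD(4)[OF \<phi>] pairing_def)
  thus ?thesis using that wH by blast
qed

text \<open>The half of the closed range theorem that turns knowledge of the cokernel into
  solvability: a point outside the closed range is separated from it, and the separating functional
  lies in the cokernel.\<close>

lemma range_annihilator:
  assumes p: "1 < p" and A: "bounded_op p A" and cl: "closed_range p A" and g: "g \<in> Hardy p"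
    and ann: "\<And>\<phi>. \<phi> \<in> coker_op p A \<Longrightarrow> \<phi> g = 0"
  shows "g \<in> A ` Hardy p"
proof (rule ccontr)
  assume ng: "g \<notin> A ` Hardy p"
  have sub: "A ` Hardy p \<subseteq> Hardy p" by (intro image_subsetI bounded_opD(1)[OF A p])
  have Y: "closed_subspace p (A ` Hardy p)"
    unfolding closed_subspace_def
  proof (intro conjI allI impI)
    show "A ` Hardy p \<subseteq> Lp p" by (rule subsetI, rule HardyD(1), rule subsetD[OF sub])
    show "cvs.subspace (A ` Hardy p)"
      unfolding cvs.subspace_def
    proof (intro conjI ballI allI)
      show "0 \<in> A ` Hardy p" 
        using imageI[OF Hardy_0[OF p], of A] by (simp only: bounded_opD(5)[OF A p Hardy_0[OF p] Hardy_0[OF p]])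
      fix x assume "x \<in> A ` Hardy p"
      then obtain f where f: "f \<in> Hardy p" "x = A f" by blast
      show "cscale z x \<in> A ` Hardy p" for z
        unfolding f(2) bounded_opD(3)[OF A p f(1) f(1), symmetric] by (rule imageI[OF Hardy_cscale[OF p f(1)]])
      fix y assume "y \<in> A ` Hardy p"
      then obtain h where h: "h \<in> Hardy p" "y = A h" by blast
      show "x + y \<in> A ` Hardy p"
        unfolding f(2) h(2) bounded_opD(2)[OF A p f(1) h(1), symmetric] by (rule imageI[OF Hardy_add[OF p f(1) h(1)]])
    qed
    fix u h assume u: "(\<forall>n::nat. u n \<in> A ` Hardy p) \<and> h \<in> Lp p \<and> (\<lambda>n. Lp_norm p (u n - h)) \<longlonglongrightarrow> 0"
    have uA: "u n \<in> A ` Hardy p" for n using u by simp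
    have hL: "h \<in> Lp p" "(\<lambda>n. Lp_norm p (u n - h)) \<longlonglongrightarrow> 0" using u by simp_all
    have "h \<in> Hardy p" by (rule Hardy_limit[OF p subsetD[OF sub uA] hL])
    thus "h \<in> A ` Hardy p" using cl u unfolding closed_range_def by blast
  qed
  obtain w where w: "w \<in> Lp (dual_exponent p)" "\<And>y. y \<in> A ` Hardy p \<Longrightarrow> fourier (w * y) 0 = 0" "fourier (w * g) 0 \<noteq> 0"
    using separation[OF p Y HardyD(1)[OF g] ng] by blast
  have "pairing p w \<in> coker_op p A"
    unfolding coker_op_def
  proof (intro CollectI conjI pairing_Hardy_dual[OF p w(1)])
    have "pairing p w (A f) = 0" if f: "f \<in> Hardy p" for f
      using w(2)[of "A f"] f bounded_opD(1)[OF A p f f] by (simp add: pairing_def mult.commute)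
    thus "adjoint_op p A (pairing p w) = 0" by (auto simp: adjoint_op_def fun_eq_iff)
  qed
  hence "pairing p w g = 0" by (rule ann)
  thus False using w(3) g by (simp add: pairing_def mult.commute)
qed

section \<open>Wiener--Hopf factorization\<close>

lemma toeplitz_bounded:
  assumes p: "1 < p" and a: "a \<in> Linf"
  shows "bounded_op p (toeplitz p a)"
proof -
  have aL: "a * f \<in> Lp p" if "f \<in> Hardy p" for f
    using Lp_mult_Linf[OF a _ HardyD(1)[OF that]] p by simp
  obtain C where C: "C \<ge> 0" "\<And>f. f \<in> Lp p \<Longrightarrow> Lp_norm p (riesz p f) \<le> C * Lp_norm p f"
    using riesz_bounded[OF p] by blast
  obtain D where D: "D \<ge> 0" "\<And>f. f \<in> Lp p \<Longrightarrow> a * f \<in> Lp p \<and> Lp_norm p (a * f) \<le> D * Lp_norm p f"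
    using Lp_mult_Linf_bound[OF a, of p] p by auto
  have "Lp_norm p (toeplitz p a f) \<le> (C * D) * Lp_norm p f" if f: "f \<in> Hardy p" for f
  proof -
    have "Lp_norm p (toeplitz p a f) \<le> C * Lp_norm p (a * f)"
      unfolding toeplitz_def by (rule C(2)[OF aL[OF f]])
    also have "\<dots> \<le> C * (D * Lp_norm p f)"
      using D(2)[OF HardyD(1)[OF f]] C(1) by (intro mult_left_mono) auto
    finally show ?thesis by (simp add: mult.assoc)
  qed
  thus ?thesis
    unfolding bounded_op_def toeplitz_def
    using aL by (auto simp: riesz_Hardy[OF p] distrib_left riesz_add[OF p] cscale_mult_right riesz_cscale[OF p])
qed

lemma fourier_mult_tpow: "fourier (f * tpow m) n = fourier f (n - m)"
  by (simp add: mult.commute[of f] fourier_tpow_mult)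

lemma tpow_Hardy: "p > 0 \<Longrightarrow> n \<ge> 0 \<Longrightarrow> tpow n \<in> Hardy p"
  by (simp add: Hardy_def fourier_tpow)

lemma tpow_mult_Hardy: "p > 0 \<Longrightarrow> n \<ge> 0 \<Longrightarrow> f \<in> Hardy p \<Longrightarrow> tpow n * f \<in> Hardy p"
  by (simp add: Hardy_def Lp_tpow_mult fourier_tpow_mult)

lemma Hardy_div_tpow:
  assumes "p > 0" "f \<in> Lp p" "\<And>n. n \<le> 0 \<Longrightarrow> fourier f n = 0"
  shows "tpow (- 1) * f \<in> Hardy p"
  using assms by (simp add: Hardy_def Lp_tpow_mult fourier_tpow_mult)

lemma analytic_coanalytic:
  assumes "f \<in> Lp 1" "\<And>n. n < 0 \<Longrightarrow> fourier f n = 0" "\<And>n. n > 0 \<Longrightarrow> fourier f n = 0"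
  shows "f = cscale (fourier f 0) 1"
proof (rule fourier_unique[OF assms(1)])
  show "cscale (fourier f 0) 1 \<in> Lp 1" by (simp add: Lp_cscale)
  show "fourier f n = fourier (cscale (fourier f 0) 1) n" for n
    using assms(2,3)[of n] by (cases n "0::int" rule: linorder_cases) (simp_all add: fourier_cscale fourier_1)
qed

text \<open>The bounded operator demanded by \<open>wiener_hopf\<close> is the inverse of
  \<open>toeplitz p g0\<close>. The power \<open>tpow \<nu>\<close> is merely carried along, since
  the remaining conditions concern \<open>gm\<close> and \<open>gp\<close>.\<close>

lemma wiener_hopf_exists:
  assumes p: "1 < p" and g0: "g0 \<in> Linf"
    and inj: "\<And>f. f \<in> Hardy p \<Longrightarrow> toeplitz p g0 f = 0 \<Longrightarrow> f = 0"
    and surj: "\<And>g. g \<in> Hardy p \<Longrightarrow> \<exists>f\<in>Hardy p. toeplitz p g0 f = g"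
  shows "\<exists>gm gp. wiener_hopf p (g0 * tpow \<nu>) gm \<nu> gp"
proof -
  let ?q = "dual_exponent p"
  note q = dual_exponent[OF p]
  have p0: "p > 0" "?q > 0" using p q by auto
  define A where "A = toeplitz p g0"
  have A: "bounded_op p A" unfolding A_def by (rule toeplitz_bounded[OF p g0])
  have AH: "A f \<in> Hardy p" if "f \<in> Hardy p" for f by (rule bounded_opD(1)[OF A p that that])
  have Aeq: "f = g" if "f \<in> Hardy p" "g \<in> Hardy p" "A f = A g" for f g
  proof -
    have "A (f - g) = 0" using bounded_opD(4)[OF A p that(1,2)] that(3) by simp
    hence "f - g = 0" using inj[OF Hardy_diff[OF p that(1,2)]] by (simp add: A_def)
    thus ?thesis by simp
  qed
  obtain C where C: "C \<ge> 0" "\<And>f. f \<in> Hardy p \<Longrightarrow> Lp_norm p f \<le> C * Lp_norm p (A f)"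
    using bounded_inverse[OF p A inj[folded A_def] surj[folded A_def]] by blast
  define R where "R g = (SOME f. f \<in> Hardy p \<and> A f = g)" for g
  have R: "R g \<in> Hardy p \<and> A (R g) = g" if "g \<in> Hardy p" for g
    unfolding R_def by (rule someI_ex) (use surj[OF that] A_def in blast)
  have RH: "R g \<in> Hardy p" and AR: "A (R g) = g" if "g \<in> Hardy p" for g using R[OF that] by auto
  have RA: "R g = f" if "f \<in> Hardy p" "A f = g" for f g
    using Aeq[OF RH[OF AH[OF that(1)]] that(1) AR[OF AH[OF that(1)]]] that(2) by simp
  have Radd: "R (f + g) = R f + R g" if "f \<in> Hardy p" "g \<in> Hardy p" for f g
    by (rule RA[OF Hardy_add[OF p RH[OF that(1)] RH[OF that(2)]]])
      (simp add: bounded_opD(2)[OF A p RH[OF that(1)] RH[OF that(2)]] AR that)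
  have Rscale: "R (cscale z f) = cscale z (R f)" if "f \<in> Hardy p" for f z
    by (rule RA[OF Hardy_cscale[OF p RH[OF that]]])
      (simp add: bounded_opD(3)[OF A p RH[OF that] RH[OF that]] AR that)
  have Rb: "Lp_norm p (R f) \<le> C * Lp_norm p f" if "f \<in> Hardy p" for f
    using C(2)[OF RH[OF that]] by (simp add: AR that)
  have Rop: "bounded_op p R"
    unfolding bounded_op_def using RH Radd Rscale Rb by blast
  have one: "1 \<in> Hardy p" using tpow_Hardy[OF p0(1), of 0] by simp
  define x where "x = R 1"
  have x: "x \<in> Hardy p" "A x = 1" using RH[OF one] AR[OF one] by (simp_all add: x_def)
  \<comment> \<open>The transpose of \<open>R\<close> applied to the mean value functional; its
    representing function plays for the adjoint the role that \<open>x\<close> plays for the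
    operator.\<close>
  define \<phi> where "\<phi> f = (if f \<in> Hardy p then fourier (R f) 0 else 0)" for f
  have "\<phi> \<in> Hardy_dual p"
    unfolding Hardy_dual_def
  proof (intro CollectI conjI ballI allI impI)
    show "\<phi> (f + g) = \<phi> f + \<phi> g" if "f \<in> Hardy p" "g \<in> Hardy p" for f g
      using that Hardy_add[OF p that] Hardy_L1[OF p RH[OF that(1)]] Hardy_L1[OF p RH[OF that(2)]]
      by (simp add: \<phi>_def Radd fourier_add)
    show "\<phi> (cscale z f) = z * \<phi> f" if "f \<in> Hardy p" for z f
      using that Hardy_cscale[OF p that] by (simp add: \<phi>_def Rscale fourier_cscale)
    have "norm (\<phi> f) \<le> C * Lp_norm p f" if f: "f \<in> Hardy p" for f
    proof -
      have "norm (\<phi> f) \<le> Lp_norm 1 (R f)" using f by (simp add: \<phi>_def norm_fourier_le)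
      also have "\<dots> \<le> Lp_norm p (R f)" by (rule Lp_norm_1_le(2)[OF p HardyD(1)[OF RH[OF f]]])
      also have "\<dots> \<le> C * Lp_norm p f" by (rule Rb[OF f])
      finally show ?thesis .
    qed
    thus "\<exists>C. \<forall>f\<in>Hardy p. norm (\<phi> f) \<le> C * Lp_norm p f" by blast
  qed (simp add: \<phi>_def)
  then obtain w where w: "w \<in> Hardy ?q" "\<phi> = pairing p (reflect w)"
    using Hardy_dual_representation[OF p] by blast
  define y where "y = reflect w"
  have yH: "y \<in> conj_Hardy ?q" unfolding y_def by (rule reflect_Hardy[OF w(1)])
  define gm where "gm = g0 * x"
  have gmL: "gm \<in> Lp p" unfolding gm_def by (rule Lp_mult_Linf[OF g0 p0(1) HardyD(1)[OF x(1)]])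
  have gmP: "riesz p gm = 1" using x(2) by (simp add: A_def toeplitz_def gm_def)
  have gmc: "fourier gm n = (if n = 0 then 1 else 0)" if "n \<ge> 0" for n
    using riesz_Lp(2)[OF p gmL, of n] that by (simp add: gmP fourier_1)
  have gmH: "gm \<in> conj_Hardy p" using gmL gmc by (simp add: conj_Hardy_def)
  define z where "z = g0 * y"
  have zL: "z \<in> Lp ?q" unfolding z_def by (rule Lp_mult_Linf[OF g0 p0(2) conj_HardyD(1)[OF yH]])
  \<comment> \<open>Testing \<open>R (A f) = f\<close> on \<open>f = tpow (- n)\<close> gives the
    coefficient of \<open>z\<close> at \<open>n\<close>.\<close>
  have zc: "fourier z n = (if n = 0 then 1 else 0)" if "n \<le> 0" for n
  proof -
    define f where "f = tpow (- n)"
    have f: "f \<in> Hardy p" unfolding f_def by (rule tpow_Hardy[OF p0(1)]) (use that in simp)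
    have "fourier f 0 = \<phi> (A f)" using AH[OF f] by (simp add: \<phi>_def RA[OF f refl])
    also have "\<dots> = fourier (riesz p (g0 * f) * reflect w) 0"
      using AH[OF f] by (simp add: w(2) pairing_def A_def toeplitz_def)
    also have "\<dots> = fourier (g0 * f * reflect w) 0"
      by (rule fourier_mult_reflect_riesz[OF p Lp_mult_Linf[OF g0 p0(1) HardyD(1)[OF f]] w(1)])
    also have "g0 * f * reflect w = tpow (- n) * z" by (simp only: f_def z_def y_def mult_ac)
    finally have "fourier z n = fourier (tpow (- n)) 0" by (simp add: fourier_tpow_mult f_def)
    thus ?thesis by (simp add: fourier_tpow)
  qed
  have zH: "z \<in> Hardy ?q" using zL zc by (simp add: Hardy_def)
  have eq: "x * z = gm * y" by (simp only: z_def gm_def mult_ac)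
  define \<kappa> where "\<kappa> = fourier (x * z) 0"
  have xz: "x * z = cscale \<kappa> 1"
    unfolding \<kappa>_def
  proof (rule analytic_coanalytic)
    show "x * z \<in> Lp 1" by (rule Lp_mult_dual[OF p HardyD(1)[OF x(1)] zL])
    show "fourier (x * z) n = 0" if "n < 0" for n by (rule fourier_Hardy_mult(1)[OF p x(1) zH that])
    show "fourier (x * z) n = 0" if "n > 0" for n
      unfolding eq by (rule fourier_conj_Hardy_mult(1)[OF p gmH yH that])
  qed
  have "\<kappa> \<noteq> 0"
  proof
    assume "\<kappa> = 0"
    hence "x * z = 0" using xz by simp
    moreover have "z \<noteq> 0" using zc[of 0] by auto
    ultimately have "x = 0" using analytic_mult_eq_0[OF Hardy_L1[OF p x(1)]] HardyD(2)[OF x(1)] by blast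
    thus False using gmc[of 0] by (simp add: gm_def)
  qed
  define gp where "gp = cscale (1 / \<kappa>) z"
  define y' where "y' = cscale (1 / \<kappa>) y"
  have gpx: "gp * x = 1" using \<open>\<kappa> \<noteq> 0\<close> xz by (simp add: gp_def cscale_mult_left mult.commute[of z])
  have gmy: "gm * y' = 1" using \<open>\<kappa> \<noteq> 0\<close> xz eq by (simp add: y'_def cscale_mult_right)
  have igp: "inverse gp = x" by (rule inverse_eqI[OF gpx])
  have igm: "inverse gm = y'" by (rule inverse_eqI[OF gmy])
  have gpH: "gp \<in> Hardy ?q" unfolding gp_def by (rule Hardy_cscale[OF q(1) zH])
  have y'H: "y' \<in> conj_Hardy ?q" using yH by (simp add: y'_def conj_Hardy_def Lp_cscale fourier_cscale)
  have y'L: "y' \<in> Lp ?q" by (rule conj_HardyD(1)[OF y'H])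
  have fact: "g0 * tpow \<nu> = gm * tpow \<nu> * gp"
  proof -
    have "gm * tpow \<nu> * gp = g0 * tpow \<nu> * (gp * x)" by (simp only: gm_def mult_ac)
    thus ?thesis by (simp add: gpx)
  qed
  have Rtpow: "R (tpow (int k)) = x * riesz ?q (y' * tpow (int k))" for k :: nat
  proof -
    let ?t = "tpow (int k)"
    \<comment> \<open>The projection of \<open>y' * tpow k\<close> written out: \<open>y'\<close> is
      coanalytic, so only the indices from 0 to \<open>k\<close> occur, and \<open>x * h\<close>
      stays in \<open>Hardy p\<close> as a finite combination.\<close>
    define h where "h = (\<Sum>n\<in>{0..int k}. cscale (fourier (y' * ?t) n) (tpow n))"
    have yt: "y' * ?t \<in> Lp ?q" using Lp_tpow_mult[OF p0(2) y'L] by (simp add: mult.commute)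
    have hL: "h \<in> Lp r" if "r > 0" for r unfolding h_def using that by (intro Lp_sum Lp_cscale tpow_Lp) auto
    have hc: "fourier h n = (if 0 \<le> n then fourier (y' * ?t) n else 0)" for n
    proof -
      have "fourier h n = (\<Sum>m\<in>{0..int k}. fourier (y' * ?t) m * (if n = m then 1 else 0))"
        unfolding h_def by (subst fourier_sum) (simp_all add: Lp_cscale fourier_cscale fourier_tpow)
      also have "\<dots> = (if n \<in> {0..int k} then fourier (y' * ?t) n else 0)"
        by (simp add: if_distrib[of "\<lambda>x. _ * x"] sum.delta cong: if_cong)
      also have "\<dots> = (if 0 \<le> n then fourier (y' * ?t) n else 0)"
        using conj_HardyD(2)[OF y'H, of "n - int k"] by (auto simp: fourier_mult_tpow)
      finally show ?thesis .
    qed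
    have Ph: "riesz ?q (y' * ?t) = h"
      by (rule riesz_eqI[OF q(1) yt hL[OF p0(2)]]) (simp_all add: hc)
    have xh: "x * h \<in> Hardy p"
    proof -
      have "x * h = (\<Sum>n\<in>{0..int k}. cscale (fourier (y' * ?t) n) (tpow n * x))"
        by (simp add: h_def sum_distrib_left cscale_mult_right mult.commute)
      also have "\<dots> \<in> Hardy p"
        using p0 x by (intro cvs.subspace_sum[OF Hardy_subspace[OF p]] Hardy_cscale[OF p] tpow_mult_Hardy) auto
      finally show ?thesis .
    qed
    have "A (x * h) = ?t"
      unfolding A_def toeplitz_def
    proof (rule riesz_eqI[OF p])
      have gxh: "g0 * (x * h) = gm * h" by (simp only: gm_def mult_ac)
      show L: "g0 * (x * h) \<in> Lp p" by (rule Lp_mult_Linf[OF g0 p0(1) HardyD(1)[OF xh]])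
      show "?t \<in> Lp p" using p0 by simp
      \<comment> \<open>The part of \<open>y' * tpow k\<close> with negative indices. Multiplied by
        the coanalytic \<open>gm\<close> it still has negative indices only, so the projection
        removes it.\<close>
      define v where "v = y' * ?t - h"
      have vL: "v \<in> Lp ?q" unfolding v_def using yt hL[OF p0(2)] p0 by (simp add: Lp_diff)
      have v1: "fourier v n = 0" if "n \<ge> 0" for n
        using that Lp_norm_1_le(1)[OF q(1) yt] hL[of 1] by (simp add: v_def fourier_diff hc)
      have tv: "tpow 1 * v \<in> conj_Hardy ?q"
        using vL p0 v1 by (simp add: conj_Hardy_def Lp_tpow_mult fourier_tpow_mult)
      have "?t = gm * h + gm * v"
      proof -
        have "gm * h + gm * v = (gm * y') * ?t" by (simp add: v_def algebra_simps)
        thus ?thesis by (simp add: gmy)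
      qed
      moreover have gv: "fourier (gm * v) n = 0" if "n \<ge> 0" for n
      proof -
        have "fourier (gm * (tpow 1 * v)) (n + 1) = 0"
          by (rule fourier_conj_Hardy_mult(1)[OF p gmH tv]) (use that in simp)
        also have "gm * (tpow 1 * v) = tpow 1 * (gm * v)" by (simp only: mult_ac)
        finally show ?thesis by (simp add: fourier_tpow_mult)
      qed
      moreover have "gm * h \<in> Lp 1" "gm * v \<in> Lp 1"
        using Lp_mult_dual[OF p gmL vL] Lp_norm_1_le(1)[OF p L] by (simp_all add: gxh)
      ultimately show "fourier ?t n = fourier (g0 * (x * h)) n" if "n \<ge> 0" for n
        using that by (simp add: gxh fourier_add)
      show "fourier ?t n = 0" if "n < 0" for n using that by (simp add: fourier_tpow)
    qed
    thus ?thesis unfolding Ph by (rule RA[OF xh])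
  qed
  have "R f = inverse gp * riesz ?q (inverse gm * f)" if f: "f \<in> cvs.span (range (\<lambda>k::nat. tpow (int k)))" for f
  proof -
    \<comment> \<open>Membership of \<open>y' * f\<close> in the dual space belongs to the
      invariant, since additivity of \<open>riesz\<close> is available only there.\<close>
    define S where "S = {f \<in> Hardy p. y' * f \<in> Lp ?q \<and> R f = x * riesz ?q (y' * f)}"
    have "range (\<lambda>k::nat. tpow (int k)) \<subseteq> S"
    proof
      fix f assume "f \<in> range (\<lambda>k::nat. tpow (int k))"
      then obtain k where "f = tpow (int k)" by blast
      thus "f \<in> S" using Rtpow[of k] tpow_Hardy[OF p0(1), of "int k"] Lp_tpow_mult[OF p0(2) y'L, of "int k"]
        by (simp add: S_def mult.commute[of y'])
    qed
    moreover have "cvs.subspace S"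
      unfolding cvs.subspace_def
    proof (intro conjI ballI allI)
      have "riesz ?q 0 = 0" by (rule riesz_eqI[OF q(1)]) auto
      moreover have "R 0 = 0" by (rule bounded_opD(5)[OF Rop p one one])
      ultimately show "0 \<in> S" using Hardy_0[OF p] by (simp add: S_def)
      show "f + g \<in> S" if "f \<in> S" "g \<in> S" for f g
        using that p0 by (simp add: S_def Hardy_add[OF p] Radd distrib_left Lp_add riesz_add[OF q(1)])
      show "cscale c f \<in> S" if "f \<in> S" for c f
        using that by (simp add: S_def Hardy_cscale[OF p] Rscale cscale_mult_right Lp_cscale riesz_cscale[OF q(1)])
    qed
    ultimately have "cvs.span (range (\<lambda>k::nat. tpow (int k))) \<subseteq> S" by (rule cvs.span_minimal)
    thus ?thesis using f by (auto simp: S_def igp igm)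
  qed
  hence "wiener_hopf p (g0 * tpow \<nu>) gm \<nu> gp"
    unfolding wiener_hopf_def
    using fact gpx gmy gpH x(1) gmH y'H gmc[of 0] Rop by (intro conjI exI[of _ R]) (simp_all add: igp igm)
  thus ?thesis by blast
qed

lemma wiener_hopfD:
  assumes "wiener_hopf p g gm \<nu> gp"
  shows "g = gm * tpow \<nu> * gp" "gp * inverse gp = 1" "gp \<in> Hardy (dual_exponent p)" "inverse gp \<in> Hardy p"
    "gm * inverse gm = 1" "gm \<in> conj_Hardy p" "inverse gm \<in> conj_Hardy (dual_exponent p)" "fourier gm 0 = 1"
  using assms unfolding wiener_hopf_def by blast+

lemma wiener_hopf_mean:
  assumes p: "1 < p" and wh: "wiener_hopf p g gm \<nu> gp"
  shows "fourier (inverse gm) 0 = 1" "fourier (inverse gp) 0 * fourier gp 0 = 1"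
proof -
  note w = wiener_hopfD[OF wh]
  have "fourier gm 0 * fourier (inverse gm) 0 = fourier (gm * inverse gm) 0"
    by (rule fourier_conj_Hardy_mult(2)[OF p w(6,7), symmetric])
  thus "fourier (inverse gm) 0 = 1" by (simp add: w(5,8) fourier_1)
  have "fourier (inverse gp) 0 * fourier gp 0 = fourier (inverse gp * gp) 0"
    by (rule fourier_Hardy_mult(2)[OF p w(4,3), symmetric])
  thus "fourier (inverse gp) 0 * fourier gp 0 = 1" by (simp add: w(2) mult.commute[of "inverse gp"] fourier_1)
qed

text \<open>Comparing two factorizations puts the analytic factors and a power of \<open>t\<close>
  on one side and the coanalytic factors on the other.\<close>

lemma wiener_hopf_quotient:
  assumes p: "1 < p" and wh: "wiener_hopf p g gm \<nu> gp" and wh': "wiener_hopf p g gm' \<nu>' gp'"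
  shows "tpow (\<nu> - \<nu>') * (inverse gp' * gp) = gm' * inverse gm"
proof -
  note w = wiener_hopfD[OF wh] and w' = wiener_hopfD[OF wh']
  have "tpow (\<nu> - \<nu>') * (inverse gp' * gp) = (gm * inverse gm) * (tpow (\<nu> - \<nu>') * (inverse gp' * gp))"
    by (simp add: w)
  also have "\<dots> = (gm * tpow \<nu> * gp) * (inverse gm * tpow (- \<nu>') * inverse gp')"
    unfolding diff_conv_add_uminus tpow_add by (simp only: mult_ac)
  also have "\<dots> = (gm' * tpow \<nu>' * gp') * (inverse gm * tpow (- \<nu>') * inverse gp')"
    by (simp only: w(1)[symmetric] w'(1)[symmetric])
  also have "\<dots> = (gm' * inverse gm) * (gp' * inverse gp') * (tpow \<nu>' * tpow (- \<nu>'))"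
    by (simp only: mult_ac)
  also have "\<dots> = gm' * inverse gm" by (simp add: w')
  finally show ?thesis .
qed

text \<open>If \<open>\<nu> > \<nu>'\<close>, the left side of \<open>wiener_hopf_quotient\<close>
  has positive indices only, whereas the right side has mean 1.\<close>

lemma wiener_hopf_index_le:
  assumes p: "1 < p" and wh: "wiener_hopf p g gm \<nu> gp" and wh': "wiener_hopf p g gm' \<nu>' gp'"
  shows "\<nu> \<le> \<nu>'"
proof (rule ccontr)
  assume "\<not> \<nu> \<le> \<nu>'"
  note w = wiener_hopfD[OF wh] and w' = wiener_hopfD[OF wh']
  have "fourier (gm' * inverse gm) 0 = fourier gm' 0 * fourier (inverse gm) 0"
    by (rule fourier_conj_Hardy_mult(2)[OF p w'(6) w(7)])
  also have "\<dots> = 1" by (simp add: w' wiener_hopf_mean[OF p wh])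
  finally have "fourier (inverse gp' * gp) (\<nu>' - \<nu>) = 1"
    using arg_cong[OF wiener_hopf_quotient[OF p wh wh'], of "\<lambda>f. fourier f 0"] by (simp add: fourier_tpow_mult)
  moreover have "fourier (inverse gp' * gp) (\<nu>' - \<nu>) = 0"
    by (rule fourier_Hardy_mult(1)[OF p w'(4) w(3)]) (use \<open>\<not> \<nu> \<le> \<nu>'\<close> in simp)
  ultimately show False by simp
qed

text \<open>Once the exponents agree, the quotient identity compares means, so the value at 0 is the
  same for all factorizations and the definite description in \<open>signature\<close> is
  legitimate.\<close>

lemma signature_eq:
  assumes p: "1 < p" and wh: "wiener_hopf p g gm \<nu> gp"
  shows "signature p g = fourier gp 0"
  unfolding signature_def
proof (rule the_equality)
  show "\<exists>gm \<nu> gp'. wiener_hopf p g gm \<nu> gp' \<and> fourier gp 0 = fourier gp' 0" using wh by blast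
  fix s assume "\<exists>gm \<nu> gp. wiener_hopf p g gm \<nu> gp \<and> s = fourier gp 0"
  then obtain gm' \<nu>' gp' where wh': "wiener_hopf p g gm' \<nu>' gp'" and s: "s = fourier gp' 0" by blast
  note w = wiener_hopfD[OF wh] and w' = wiener_hopfD[OF wh']
  have "\<nu> = \<nu>'" using wiener_hopf_index_le[OF p wh wh'] wiener_hopf_index_le[OF p wh' wh] by simp
  hence "inverse gp' * gp = gm' * inverse gm" using wiener_hopf_quotient[OF p wh wh'] by simp
  hence "fourier (inverse gp' * gp) 0 = fourier (gm' * inverse gm) 0" by simp
  hence "fourier (inverse gp') 0 * fourier gp 0 = 1"
    by (simp add: fourier_Hardy_mult(2)[OF p w'(4) w(3)] fourier_conj_Hardy_mult(2)[OF p w'(6) w(7)]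
        w'(8) wiener_hopf_mean(1)[OF p wh])
  moreover have "fourier (inverse gp') 0 * fourier gp' 0 = 1" by (rule wiener_hopf_mean(2)[OF p wh'])
  ultimately have "fourier (inverse gp') 0 * fourier gp 0 = fourier (inverse gp') 0 * fourier gp' 0" "fourier (inverse gp') 0 \<noteq> 0"
    by auto
  thus "s = fourier gp 0" by (simp add: s)
qed

section \<open>Toeplitz plus Hankel operators\<close>

lemma riesz_eq_0_iff:
  assumes "1 < p" "f \<in> Lp p"
  shows "riesz p f = 0 \<longleftrightarrow> (\<forall>n\<ge>0. fourier f n = 0)"
proof
  assume "riesz p f = 0"
  hence "fourier f n = 0" if "n \<ge> 0" for n using riesz_Lp(2)[OF assms, of n] that by simp
  thus "\<forall>n\<ge>0. fourier f n = 0" by blast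
next
  assume "\<forall>n\<ge>0. fourier f n = 0"
  thus "riesz p f = 0" by (intro riesz_eqI[OF assms]) auto
qed

lemma coriesz_flip:
  assumes "1 < p" "f \<in> Hardy p"
  shows "coriesz p (flip f) = flip f"
proof -
  have "riesz p (flip f) = 0"
    using assms by (subst riesz_eq_0_iff) (auto simp: flip_Lp HardyD(1) fourier_flip HardyD(2))
  thus ?thesis by (simp add: coriesz_def)
qed

lemma pairing_reflect_eq_0:
  assumes p: "1 < p" and w: "w \<in> Hardy (dual_exponent p)" and 0: "pairing p (reflect w) = 0"
  shows "w = 0"
proof (rule fourier_unique_0)
  show "w \<in> Lp 1" by (rule Hardy_L1[OF dual_exponent(1)[OF p] w])
  fix n
  show "fourier w n = 0"
  proof (cases "n < 0")
    case True thus ?thesis by (rule HardyD(2)[OF w])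
  next
    case False
    have "pairing p (reflect w) (tpow n) = 0" using 0 by simp
    thus ?thesis using False p by (simp add: pairing_def tpow_Hardy fourier_tpow_mult fourier_reflect)
  qed
qed

lemma annihilates_Hardy:
  assumes p: "1 < p" and n: "n \<le> 0" and ann: "\<And>f. f \<in> Hardy p \<Longrightarrow> fourier (f * y) 0 = 0"
  shows "fourier y n = 0"
proof -
  have "fourier (tpow (- n) * y) 0 = 0"
    by (rule ann, rule tpow_Hardy) (use n p in auto)
  thus ?thesis by (simp add: fourier_tpow_mult)
qed

text \<open>Stated through \<open>a = c * b\<close>, so that the opposite sign is covered by passing
  from \<open>b\<close> and \<open>c\<close> to \<open>- b\<close> and \<open>- c\<close>. The last
  two hypotheses isolate what has to be known about \<open>c\<close>.\<close>

lemma toeplitz_plus_hankel_alternative: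
  assumes p: "1 < p" and a: "a \<in> Linf" and b: "b \<in> Linf" and bb: "b * b' = 1"
    and ab: "a * reflect a = b * reflect b" and c: "a = c * b"
    and ker: "\<And>f. f \<in> Hardy p \<Longrightarrow> c * f = - flip f \<Longrightarrow> f = 0"
    and coker: "\<And>h. h \<in> Hardy (dual_exponent p) \<Longrightarrow> h = c * flip h \<Longrightarrow> h = 0"
  shows "ker_op p (\<lambda>f. toeplitz p a f + hankel p b f) = {0} \<or> coker_op p (\<lambda>f. toeplitz p a f + hankel p b f) = {0}"
proof -
  let ?q = "dual_exponent p"
  let ?T = "\<lambda>f. toeplitz p a f + hankel p b f"
  note q = dual_exponent[OF p]
  have p0: "p > 0" "?q > 0" using p q by auto
  have b0: "f = g" if "b * f = b * g" for f g
  proof -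
    have "b' * (b * f) = b' * (b * g)" using that by simp
    thus ?thesis by (simp add: mult.assoc[symmetric] mult.commute[of b'] bb)
  qed
  have fL: "f \<in> Lp p" "flip f \<in> Lp p" "a * f \<in> Lp p" "b * flip f \<in> Lp p" if "f \<in> Hardy p" for f
    using HardyD(1)[OF that] p0 a b by (simp_all add: flip_Lp Lp_mult_Linf)
  have T: "?T f = riesz p (a * f + b * flip f)" if f: "f \<in> Hardy p" for f
    using fL[OF f] by (simp add: toeplitz_def hankel_def coriesz_flip[OF p f] riesz_add[OF p])
  have T0: "?T 0 = 0"
    using T[OF Hardy_0[OF p]] riesz_eq_0_iff[OF p zero_Lp] by simp
  have "0 \<in> ker_op p ?T" using T0 Hardy_0[OF p] by (simp add: ker_op_def)
  moreover have "0 \<in> coker_op p ?T"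
    by (auto simp: coker_op_def adjoint_op_def Hardy_dual_def fun_eq_iff intro: exI[of _ 0])
  moreover have False if f: "f \<in> ker_op p ?T" "f \<noteq> 0" and \<phi>: "\<phi> \<in> coker_op p ?T" "\<phi> \<noteq> 0" for f \<phi>
  proof -
    have fH: "f \<in> Hardy p" and Tf: "?T f = 0" using f(1) by (auto simp: ker_op_def)
    define g where "g = flip (a * f + b * flip f)"
    have uL: "a * f + b * flip f \<in> Lp p" using fL[OF fH] p0 by (simp add: Lp_add)
    have u0: "fourier (a * f + b * flip f) n = 0" if "n \<ge> 0" for n
      using Tf T[OF fH] riesz_eq_0_iff[OF p uL] that by simp
    have gH: "g \<in> Hardy p"
      using uL p0 u0 by (simp add: g_def Hardy_def flip_Lp fourier_flip)
    have E1: "a * f + b * flip f = flip g" by (simp add: g_def)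
    have E2: "reflect a * flip f + reflect b * f = g" by (simp add: g_def flip_add flip_mult)
    have E3: "reflect a * flip g = b * g"
    proof -
      have "reflect a * flip g = (a * reflect a) * f + b * (reflect a * flip f)"
        unfolding E1[symmetric] by (simp add: algebra_simps)
      also have "\<dots> = b * (reflect a * flip f + reflect b * f)"
        unfolding ab by (simp add: algebra_simps)
      finally show ?thesis by (simp only: E2)
    qed
    have g0: "g \<noteq> 0"
    proof
      assume "g = 0"
      hence "b * (c * f) = b * (- flip f)" using E1 by (simp add: c add_eq_0_iff mult_ac)
      hence "c * f = - flip f" by (rule b0)
      thus False using ker[OF fH] f(2) by simp
    qed
    have "\<phi> \<in> Hardy_dual p" using \<phi>(1) by (simp add: coker_op_def)
    then obtain w where w: "w \<in> Hardy ?q" "\<phi> = pairing p (reflect w)"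
      using Hardy_dual_representation[OF p] by blast
    have w0: "w \<noteq> 0"
    proof
      assume "w = 0"
      hence "\<phi> = 0" by (auto simp: w(2) pairing_def fun_eq_iff)
      thus False using \<phi>(2) by simp
    qed
    have wL: "w \<in> Lp ?q" "reflect w \<in> Lp ?q" using HardyD(1)[OF w(1)] reflect_Lp by auto
    \<comment> \<open>Represents the functional composed with the operator: the Hankel term is moved
      onto \<open>w\<close> by reflecting the integral, which produces \<open>tpow 1\<close> and
      \<open>reflect b\<close>.\<close>
    define y where "y = a * reflect w + tpow 1 * (reflect b * w)"
    have rb: "reflect b \<in> Linf" by (rule reflect_Linf[OF b])
    have aw: "a * reflect w \<in> Lp ?q" and bw: "tpow 1 * (reflect b * w) \<in> Lp ?q"
      using a rb wL p0 by (simp_all add: Lp_mult_Linf Lp_tpow_mult)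
    have yL: "y \<in> Lp ?q" unfolding y_def using p0 by (intro Lp_add aw bw) simp
    have ann: "fourier (x * y) 0 = 0" if x: "x \<in> Hardy p" for x
    proof -
      have xb: "a * x + b * flip x \<in> Lp p" using fL[OF x] p0 by (simp add: Lp_add)
      have "0 = \<phi> (?T x)"
        using \<phi>(1) x unfolding coker_op_def adjoint_op_def by (auto simp: fun_eq_iff split: if_splits)
      also have "\<dots> = fourier (riesz p (a * x + b * flip x) * reflect w) 0"
        unfolding T[OF x] w(2) pairing_def using riesz_Hardy[OF p xb] by simp
      also have "\<dots> = fourier ((a * x + b * flip x) * reflect w) 0"
        by (rule fourier_mult_reflect_riesz[OF p xb w(1)])
      also have "\<dots> = fourier (a * x * reflect w) 0 + fourier (b * flip x * reflect w) 0"
        using Lp_mult_dual[OF p fL(3)[OF x] wL(2)] Lp_mult_dual[OF p fL(4)[OF x] wL(2)]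
        by (simp add: distrib_right fourier_add)
      also have "fourier (b * flip x * reflect w) 0 = fourier (reflect (b * flip x * reflect w)) 0"
        by (simp add: fourier_reflect)
      also have "reflect (b * flip x * reflect w) = x * (tpow 1 * (reflect b * w))"
        by (simp add: reflect_mult flip_eq reflect_tpow mult_ac)
      also have "a * x * reflect w = x * (a * reflect w)" by (simp only: mult_ac)
      also have "fourier (x * (a * reflect w)) 0 + fourier (x * (tpow 1 * (reflect b * w))) 0 = fourier (x * y) 0"
        using Lp_mult_dual[OF p fL(1)[OF x] aw] Lp_mult_dual[OF p fL(1)[OF x] bw]
        by (simp add: y_def distrib_left fourier_add)
      finally show ?thesis by simp
    qed
    \<comment> \<open>\<open>y\<close> annihilates \<open>Hardy p\<close>, so its coefficients
      vanish for all \<open>n \<le> 0\<close>, the constant term included; this permits division by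
      \<open>t\<close> within the Hardy space.\<close>
    define h where "h = tpow (- 1) * y"
    have hH: "h \<in> Hardy ?q"
      unfolding h_def by (rule Hardy_div_tpow[OF p0(2) yL annihilates_Hardy[OF p _ ann]])
    have D1: "h = a * flip w + reflect b * w"
    proof -
      have "h = a * (tpow (- 1) * reflect w) + (tpow (- 1) * tpow 1) * (reflect b * w)"
        unfolding h_def y_def distrib_left by (simp only: mult_ac)
      thus ?thesis by (simp only: tpow_minus_cancel(2) mult_1_left flip_eq[symmetric])
    qed
    have D2: "flip h = reflect a * w + b * flip w"
      by (simp add: D1 flip_add flip_mult)
    have "b * h = a * flip h"
    proof -
      have "b * h = a * (b * flip w) + (b * reflect b) * w" by (simp add: D1 algebra_simps)
      also have "\<dots> = a * flip h" unfolding ab[symmetric] D2 by (simp add: algebra_simps)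
      finally show ?thesis .
    qed
    hence "b * h = b * (c * flip h)" by (simp add: c mult_ac)
    hence "h = c * flip h" by (rule b0)
    hence h0: "h = 0" by (rule coker[OF hH])
    have D3: "reflect a * w = - (b * flip w)" using D2 h0 by (simp add: eq_neg_iff_add_eq_0)
    have "b * (g * w) = (reflect a * flip g) * w" by (simp add: E3 mult.assoc)
    also have "\<dots> = flip g * (reflect a * w)" by (simp only: mult_ac)
    also have "\<dots> = flip g * - (b * flip w)" by (simp only: D3)
    also have "\<dots> = b * (- (flip g * flip w))" by (simp add: mult_ac)
    finally have gw: "g * w = - (flip g * flip w)" by (rule b0)
    have "g * w = 0"
    proof (rule fourier_unique_0)
      show "g * w \<in> Lp 1" by (rule Lp_mult_dual[OF p HardyD(1)[OF gH] wL(1)])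
      fix n
      show "fourier (g * w) n = 0"
      proof (cases "n < 0")
        case True thus ?thesis by (rule fourier_Hardy_mult(1)[OF p gH w(1)])
      next
        case False
        \<comment> \<open>The two flips contribute \<open>tpow (- 2)\<close>, so the right side has
          no index above \<open>- 2\<close>, while \<open>g * w\<close> has none below 0.\<close>
        have "flip g * flip w = tpow (- 2) * (reflect g * reflect w)"
          using tpow_add[of "- 1" "- 1"] by (simp add: flip_eq mult_ac)
        hence "fourier (g * w) n = - fourier (reflect g * reflect w) (n + 2)"
          unfolding gw by (simp add: fourier_uminus fourier_tpow_mult)
        also have "fourier (reflect g * reflect w) (n + 2) = 0"
          by (rule fourier_conj_Hardy_mult(1)[OF p reflect_Hardy[OF gH] reflect_Hardy[OF w(1)]]) (use False in simp)
        finally show ?thesis by simp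
      qed
    qed
    hence "g = 0" using analytic_mult_eq_0[OF Hardy_L1[OF p gH] HardyD(2)[OF gH] _ w0] by blast
    thus False using g0 by simp
  qed
  ultimately show ?thesis by blast
qed

section \<open>The Toeplitz operator with symbol \<open>c\<close>\<close>

text \<open>\<open>flip f\<close> has negative indices only, so the projection annihilates it,
  whatever the scalar.\<close>

lemma flip_kernel:
  assumes p: "1 < p" and f: "f \<in> Hardy p" and cf: "c * f = cscale s (flip f)"
  shows "f \<in> ker_op p (toeplitz p c)"
proof -
  have "toeplitz p c f = riesz p (cscale s (flip f))" by (simp add: toeplitz_def cf)
  also have "\<dots> = 0"
    using p f by (subst riesz_eq_0_iff) (auto simp: Lp_cscale flip_Lp HardyD(1) fourier_cscale fourier_flip HardyD(2))
  finally show ?thesis using f by (simp add: ker_op_def)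
qed

text \<open>The transposed operator multiplies \<open>reflect w\<close> by \<open>c\<close>.
  Annihilating \<open>Hardy p\<close> is tested on the powers \<open>tpow k\<close> with
  \<open>k \<ge> 0\<close>, and these read off the coefficients of nonpositive index.\<close>

lemma coker_toeplitz_iff:
  assumes p: "1 < p" and c: "c \<in> Linf" and w: "w \<in> Hardy (dual_exponent p)"
  shows "pairing p (reflect w) \<in> coker_op p (toeplitz p c) \<longleftrightarrow> (\<forall>n\<le>0. fourier (c * reflect w) n = 0)"
proof -
  have wL: "reflect w \<in> Lp (dual_exponent p)" by (rule reflect_Lp[OF HardyD(1)[OF w]])
  have cw: "c * reflect w \<in> Lp (dual_exponent p)"
    using dual_exponent(1)[OF p] by (intro Lp_mult_Linf[OF c _ wL]) simp
  have eq: "pairing p (reflect w) (toeplitz p c f) = fourier (f * (c * reflect w)) 0" if f: "f \<in> Hardy p" for f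
  proof -
    have cf: "c * f \<in> Lp p" using p by (intro Lp_mult_Linf[OF c _ HardyD(1)[OF f]]) simp
    have "pairing p (reflect w) (toeplitz p c f) = fourier (riesz p (c * f) * reflect w) 0"
      using riesz_Hardy[OF p cf] by (simp add: pairing_def toeplitz_def)
    also have "\<dots> = fourier (c * f * reflect w) 0" by (rule fourier_mult_reflect_riesz[OF p cf w])
    finally show ?thesis by (simp only: mult_ac)
  qed
  have "pairing p (reflect w) \<in> coker_op p (toeplitz p c) \<longleftrightarrow> (\<forall>f\<in>Hardy p. fourier (f * (c * reflect w)) 0 = 0)"
    unfolding coker_op_def adjoint_op_def using pairing_Hardy_dual[OF p wL] eq by (auto simp: fun_eq_iff)
  also have "\<dots> \<longleftrightarrow> (\<forall>n\<le>0. fourier (c * reflect w) n = 0)"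
  proof
    assume "\<forall>f\<in>Hardy p. fourier (f * (c * reflect w)) 0 = 0"
    thus "\<forall>n\<le>0. fourier (c * reflect w) n = 0" using annihilates_Hardy[OF p, of _ "c * reflect w"] by blast
  next
    assume 0: "\<forall>n\<le>0. fourier (c * reflect w) n = 0"
    hence "c * reflect w \<in> Hardy (dual_exponent p)" using cw by (simp add: Hardy_def)
    thus "\<forall>f\<in>Hardy p. fourier (f * (c * reflect w)) 0 = 0"
      using 0 by (simp add: fourier_Hardy_mult(2)[OF p])
  qed
  finally show ?thesis .
qed

text \<open>Clearing the \<open>tpow (- 1)\<close> in \<open>flip\<close> gives
  \<open>c * reflect h = tpow 1 * cscale s h\<close>, whose indices start at 1. The condition on
  \<open>s\<close> covers both signs.\<close>

lemma flip_cokernel: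
  assumes p: "1 < p" and c: "c \<in> Linf" and h: "h \<in> Hardy (dual_exponent p)"
    and ch: "h = cscale s (c * flip h)" and s: "s * s = 1"
  shows "pairing p (reflect h) \<in> coker_op p (toeplitz p c)"
proof -
  have "cscale s h = cscale (s * s) (c * flip h)" by (subst ch) simp
  hence eq: "cscale s h = c * (tpow (- 1) * reflect h)" by (simp add: s flip_eq)
  have "tpow 1 * cscale s h = (tpow 1 * tpow (- 1)) * (c * reflect h)" unfolding eq by (simp only: mult_ac)
  hence "c * reflect h = tpow 1 * cscale s h" by simp
  thus ?thesis
    unfolding coker_toeplitz_iff[OF p c h] using HardyD(2)[OF h] by (simp add: fourier_tpow_mult fourier_cscale)
qed

text \<open>For \<open>u\<close> in the kernel and \<open>w\<close> representing a cokernel element,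
  \<open>u * c * reflect w\<close> is analytic with mean zero in one grouping and coanalytic in the
  other, so it vanishes.\<close>

lemma Coburn:
  assumes p: "1 < p" and c: "c \<in> Linf" "c * c' = 1"
  shows "ker_op p (toeplitz p c) \<subseteq> {0} \<or> coker_op p (toeplitz p c) \<subseteq> {0}"
proof (rule ccontr)
  assume "\<not> ?thesis"
  then obtain u \<phi> where u: "u \<in> ker_op p (toeplitz p c)" "u \<noteq> 0" and \<phi>: "\<phi> \<in> coker_op p (toeplitz p c)" "\<phi> \<noteq> 0"
    by blast
  let ?q = "dual_exponent p"
  note q = dual_exponent[OF p]
  have p0: "p > 0" "?q > 0" using p q by auto
  have uH: "u \<in> Hardy p" and Tu: "riesz p (c * u) = 0" using u(1) by (auto simp: ker_op_def toeplitz_def)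
  have cuL: "c * u \<in> Lp p" by (rule Lp_mult_Linf[OF c(1) p0(1) HardyD(1)[OF uH]])
  have cu0: "\<forall>n\<ge>0. fourier (c * u) n = 0" using riesz_eq_0_iff[OF p cuL] Tu by blast
  hence cuH: "c * u \<in> conj_Hardy p" using cuL by (simp add: conj_Hardy_def)
  obtain w where w: "w \<in> Hardy ?q" "\<phi> = pairing p (reflect w)"
    using Hardy_dual_representation[OF p] \<phi>(1) unfolding coker_op_def by blast
  define y where "y = c * reflect w"
  have yL: "y \<in> Lp ?q" unfolding y_def by (rule Lp_mult_Linf[OF c(1) p0(2) reflect_Lp[OF HardyD(1)[OF w(1)]]])
  have y0: "\<forall>n\<le>0. fourier y n = 0"
    using \<phi>(1) coker_toeplitz_iff[OF p c(1) w(1)] unfolding w(2) y_def by blast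
  have yH: "y \<in> Hardy ?q" using yL y0 by (simp add: Hardy_def)
  have eq: "u * y = (c * u) * reflect w" unfolding y_def by (simp only: mult_ac)
  have "u * y = 0"
  proof (rule fourier_unique_0)
    show "u * y \<in> Lp 1" by (rule Lp_mult_dual[OF p HardyD(1)[OF uH] yL])
    show "fourier (u * y) n = 0" for n
    proof (cases n "0::int" rule: linorder_cases)
      case less thus ?thesis by (rule fourier_Hardy_mult(1)[OF p uH yH])
    next
      case equal thus ?thesis using fourier_Hardy_mult(2)[OF p uH yH] y0 by simp
    next
      case greater thus ?thesis unfolding eq by (intro fourier_conj_Hardy_mult(1)[OF p cuH reflect_Hardy[OF w(1)]])
    qed
  qed
  moreover have "y \<noteq> 0"
  proof
    assume "y = 0"
    hence "c' * (c * reflect w) = 0" by (simp add: y_def)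
    hence "reflect w = 0" by (simp add: mult.assoc[symmetric] mult.commute[of c'] c(2))
    hence "\<phi> = 0" by (auto simp: w(2) pairing_def fun_eq_iff)
    thus False using \<phi>(2) by simp
  qed
  ultimately have "u = 0" using analytic_mult_eq_0[OF Hardy_L1[OF p uH] HardyD(2)[OF uH]] by blast
  thus False using u(2) by simp
qed

section \<open>One-dimensional kernels and cokernels, and the factorization signature\<close>

lemma (in vector_space) dim_1_span:
  assumes "dim S = 1"
  obtains u where "S \<subseteq> span {u}"
proof -
  obtain B where B: "B \<subseteq> S" "independent B" "S \<subseteq> span B" "card B = dim S" by (rule basis_exists)
  have "card B = 1" using B(4) assms by simp
  then obtain u where "B = {u}" by (rule card_1_singletonE)
  hence "S \<subseteq> span {u}" using B(3) by simp
  thus ?thesis by (rule that)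
qed

text \<open>\<open>dim\<close> is the cardinality of a basis and hence also 0 for an infinite one;
  the finite spanning set rules this case out.\<close>

lemma (in vector_space) dim_0_finite_span:
  assumes "dim S = 0" "finite B" "S \<subseteq> span B"
  shows "S \<subseteq> {0}"
proof -
  obtain C where C: "C \<subseteq> S" "independent C" "S \<subseteq> span C" "card C = dim S" by (rule basis_exists)
  have "finite C" using independent_span_bound[OF assms(2) C(2)] C(1) assms(3) by blast
  hence "C = {}" using C(4) assms(1) by simp
  thus ?thesis using C(3) by simp
qed

lemma self_eq_minus:
  fixes x :: complex
  assumes "x = - x"
  shows "x = 0"
proof -
  have "x + x = 0" using eq_neg_iff_add_eq_0[THEN iffD1, OF assms] .
  hence "2 * x = 0" by (simp only: mult_2)
  thus ?thesis by simp
qed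

text \<open>A nonzero \<open>f0\<close> spans the kernel and has nonzero mean. Multiplying the
  symbol by \<open>t\<close> removes exactly this direction, so \<open>c\<close> gets a
  factorization with exponent \<open>- 1\<close>. At \<open>gp(0) = 1\<close>, comparing means in
  \<open>f0 * gp = - (reflect f0 * inverse gm)\<close> gives \<open>f0(0) = - f0(0)\<close>.\<close>

lemma signature_index_1:
  assumes p: "1 < p" and c: "c \<in> Linf" and F: "fredholm p (toeplitz p c)"
    and ker: "vector_space.dim cscale (ker_op p (toeplitz p c)) = 1"
    and coker: "coker_op p (toeplitz p c) \<subseteq> {0}"
    and f0: "f0 \<in> Hardy p" "c * f0 = - flip f0" and sig: "signature p c = 1"
  shows "f0 = 0"
proof (rule ccontr)
  assume "f0 \<noteq> 0"
  let ?q = "dual_exponent p"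
  have p0: "p > 0" using p by simp
  let ?A = "toeplitz p c"
  define g where "g = c * tpow 1"
  have gL: "g \<in> Linf" unfolding g_def by (rule mult_Linf[OF c tpow_Linf])
  have A: "bounded_op p ?A" and cl: "closed_range p ?A" using F by (auto simp: fredholm_def)
  have t1: "tpow 1 * f \<in> Hardy p" if "f \<in> Hardy p" for f by (rule tpow_mult_Hardy[OF p0 _ that]) simp
  have gA: "toeplitz p g f = ?A (tpow 1 * f)" for f by (simp add: toeplitz_def g_def mult.assoc)
  have cL: "c * f \<in> Lp p" if "f \<in> Hardy p" for f by (rule Lp_mult_Linf[OF c p0 HardyD(1)[OF that]])
  have f0k: "?A f0 = 0" using flip_kernel[OF p f0(1), of c "- 1"] f0(2) by (simp add: ker_op_def cscale_minus_one)
  obtain u where u: "ker_op p ?A \<subseteq> cvs.span {u}" using cvs.dim_1_span[OF ker] by blast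
  have inj: "f = 0" if f: "f \<in> Hardy p" "toeplitz p g f = 0" for f
  proof (rule ccontr)
    assume "f \<noteq> 0"
    have "?A (tpow 1 * f) = 0" using f(2) by (simp only: gA)
    hence ctf: "\<forall>n\<ge>0. fourier (c * (tpow 1 * f)) n = 0"
      using riesz_eq_0_iff[OF p cL[OF t1[OF f(1)]]] by (simp add: toeplitz_def)
    have "fourier (c * f) n = 0" if "n \<ge> 0" for n
    proof -
      have "fourier (c * (tpow 1 * f)) (n + 1) = 0" using ctf that by simp
      also have "c * (tpow 1 * f) = tpow 1 * (c * f)" by (simp only: mult_ac)
      finally show ?thesis by (simp add: fourier_tpow_mult)
    qed
    hence "?A f = 0" using riesz_eq_0_iff[OF p cL[OF f(1)]] by (simp add: toeplitz_def)
    \<comment> \<open>Both \<open>f\<close> and \<open>t f\<close> would lie in a one-dimensional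
      kernel, so \<open>t f\<close> would be a multiple of \<open>f\<close>, which is impossible for
      a nonzero analytic \<open>f\<close>.\<close>
    hence "f \<in> cvs.span {u}" "tpow 1 * f \<in> cvs.span {u}"
      using u f t1[OF f(1)] by (auto simp: ker_op_def gA)
    then obtain \<alpha> \<beta> where ab: "f = cscale \<alpha> u" "tpow 1 * f = cscale \<beta> u" by (auto simp: cvs.span_singleton)
    have "\<alpha> \<noteq> 0" using ab(1) \<open>f \<noteq> 0\<close> by auto
    hence "u = cscale (1 / \<alpha>) f" by (simp add: ab(1))
    hence "tpow 1 * f = cscale (\<beta> / \<alpha>) f" using ab(2) by simp
    hence "f * (tpow 1 - cscale (\<beta> / \<alpha>) 1) = 0"
      by (simp add: right_diff_distrib cscale_mult_right mult.commute[of f])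
    moreover have "tpow 1 - cscale (\<beta> / \<alpha>) 1 \<noteq> 0"
    proof
      assume "tpow 1 - cscale (\<beta> / \<alpha>) 1 = 0"
      hence "fourier (tpow 1) 1 = fourier (cscale (\<beta> / \<alpha>) 1) 1" by simp
      thus False by (simp add: fourier_tpow fourier_cscale fourier_1)
    qed
    ultimately show False
      using analytic_mult_eq_0[OF Hardy_L1[OF p f(1)] HardyD(2)[OF f(1)]] \<open>f \<noteq> 0\<close> by blast
  qed
  have div: "tpow (- 1) * f \<in> Hardy p" if f: "f \<in> Hardy p" "fourier f 0 = 0" for f
  proof (rule Hardy_div_tpow[OF p0 HardyD(1)[OF f(1)]])
    show "fourier f n = 0" if "n \<le> 0" for n using that f(2) HardyD(2)[OF f(1), of n] by (cases "n = 0") auto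
  qed
  have tt: "tpow 1 * (tpow (- 1) * f) = f" for f
    by (simp only: mult.assoc[symmetric] tpow_minus_cancel mult_1_left)
  \<comment> \<open>If the mean were zero, \<open>tpow (- 1) * f0\<close> would be a nonzero kernel
    element of the injective operator with symbol \<open>g\<close>.\<close>
  have f00: "fourier f0 0 \<noteq> 0"
  proof
    assume "fourier f0 0 = 0"
    hence "tpow (- 1) * f0 \<in> Hardy p" by (rule div[OF f0(1)])
    hence "tpow (- 1) * f0 = 0" by (rule inj) (simp only: gA tt f0k)
    hence "tpow 1 * (tpow (- 1) * f0) = 0" by simp
    thus False using \<open>f0 \<noteq> 0\<close> by (simp only: tt)
  qed
  have surj: "\<exists>f\<in>Hardy p. toeplitz p g f = h" if h: "h \<in> Hardy p" for h
  proof -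
    have "h \<in> ?A ` Hardy p"
      by (rule range_annihilator[OF p A cl h]) (use coker in auto)
    then obtain f where f: "f \<in> Hardy p" "?A f = h" by blast
    \<comment> \<open>Subtracting a kernel element leaves the image unchanged and makes the mean
      zero, so that division by \<open>t\<close> stays in \<open>Hardy p\<close>.\<close>
    define f1 where "f1 = f - cscale (fourier f 0 / fourier f0 0) f0"
    have z: "cscale (fourier f 0 / fourier f0 0) f0 \<in> Hardy p" by (rule Hardy_cscale[OF p f0(1)])
    have f1: "f1 \<in> Hardy p" unfolding f1_def by (rule Hardy_diff[OF p f(1) z])
    have "fourier f1 0 = 0"
      using Hardy_L1[OF p f(1)] Hardy_L1[OF p z] f00 by (simp add: f1_def fourier_diff fourier_cscale)
    hence "tpow (- 1) * f1 \<in> Hardy p" by (rule div[OF f1])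
    moreover have "?A f1 = h"
      by (simp add: f1_def bounded_opD(4)[OF A p f(1) z] bounded_opD(3)[OF A p f0(1) f0(1)] f0k f(2))
    ultimately show ?thesis by (intro bexI[of _ "tpow (- 1) * f1"]) (simp_all add: gA tt)
  qed
  obtain gm gp where "wiener_hopf p (g * tpow (- 1)) gm (- 1) gp"
    using wiener_hopf_exists[OF p gL inj surj] by blast
  moreover have gc: "g * tpow (- 1) = c" by (simp add: g_def mult.assoc)
  ultimately have wh: "wiener_hopf p c gm (- 1) gp" by simp
  note W = wiener_hopfD[OF wh]
  have gp0: "fourier gp 0 = 1" using signature_eq[OF p wh] sig by simp
  have eq: "f0 * gp = - (reflect f0 * inverse gm)"
  proof -
    have "f0 * gp = inverse gm * tpow 1 * (gm * tpow (- 1) * gp * f0)"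
    proof -
      have "inverse gm * tpow 1 * (gm * tpow (- 1) * gp * f0) = (gm * inverse gm) * (tpow 1 * tpow (- 1)) * (f0 * gp)"
        by (simp only: mult_ac)
      thus ?thesis by (simp add: W(5))
    qed
    also have "\<dots> = inverse gm * tpow 1 * (- (tpow (- 1) * reflect f0))"
      by (simp only: W(1)[symmetric] f0(2) flip_eq)
    also have "\<dots> = - (inverse gm * (tpow 1 * (tpow (- 1) * reflect f0)))" by (simp add: mult.assoc)
    finally show ?thesis by (simp only: tt mult.commute[of "inverse gm"])
  qed
  have mean: "fourier (f0 * gp) 0 = fourier f0 0" by (simp add: fourier_Hardy_mult(2)[OF p f0(1) W(3)] gp0)
  have "fourier (f0 * gp) 0 = - fourier f0 0"
    unfolding eq by (simp add: fourier_uminus fourier_conj_Hardy_mult(2)[OF p reflect_Hardy[OF f0(1)] W(7)]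
        wiener_hopf_mean(1)[OF p wh] fourier_reflect)
  from self_eq_minus[OF trans[OF mean[symmetric] this]] f00 show False by blast
qed

text \<open>Dividing the symbol by \<open>t\<close> enlarges the range by the one missing dimension,
  and the exponent becomes 1. The means give \<open>h0(0) = 0\<close>; as a nonzero mean is not
  known beforehand, the contradiction comes from \<open>inverse gp * h0\<close> being
  constant.\<close>

lemma signature_index_minus_1:
  assumes p: "1 < p" and c: "c \<in> Linf" "c * c' = 1" and F: "fredholm p (toeplitz p c)"
    and ker: "ker_op p (toeplitz p c) \<subseteq> {0}"
    and coker: "vector_space.dim dual_scale (coker_op p (toeplitz p c)) = 1"
    and h0: "h0 \<in> Hardy (dual_exponent p)" "h0 = - (c * flip h0)" and sig: "signature p c = 1"
  shows "h0 = 0"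
proof (rule ccontr)
  assume "h0 \<noteq> 0"
  let ?q = "dual_exponent p"
  note q = dual_exponent[OF p]
  have p0: "p > 0" "?q > 0" using p q by auto
  let ?A = "toeplitz p c"
  define g where "g = c * tpow (- 1)"
  have gL: "g \<in> Linf" unfolding g_def by (rule mult_Linf[OF c(1) tpow_Linf])
  have A: "bounded_op p ?A" and cl: "closed_range p ?A" using F by (auto simp: fredholm_def)
  have G: "bounded_op p (toeplitz p g)" by (rule toeplitz_bounded[OF p gL])
  have t1: "tpow 1 * f \<in> Hardy p" if "f \<in> Hardy p" for f by (rule tpow_mult_Hardy[OF p0(1) _ that]) simp
  have tt: "tpow (- 1) * (tpow 1 * f) = f" "tpow 1 * (tpow (- 1) * f) = f" for f
    by (simp_all only: mult.assoc[symmetric] tpow_minus_cancel mult_1_left)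
  have gA: "toeplitz p g (tpow 1 * f) = ?A f" for f by (simp add: toeplitz_def g_def mult.assoc tt)
  define \<phi>0 where "\<phi>0 = pairing p (reflect h0)"
  have \<phi>0: "\<phi>0 \<in> coker_op p ?A"
    unfolding \<phi>0_def by (rule flip_cokernel[OF p c(1) h0(1), of "- 1"]) (use h0(2) in \<open>simp_all add: cscale_minus_one\<close>)
  have \<phi>00: "\<phi>0 \<noteq> 0" using pairing_reflect_eq_0[OF p h0(1)] \<open>h0 \<noteq> 0\<close> by (auto simp: \<phi>0_def)
  interpret dvs: vector_space dual_scale by (rule vector_space_dual_scale)
  obtain \<phi>1 where \<phi>1: "coker_op p ?A \<subseteq> dvs.span {\<phi>1}" using dvs.dim_1_span[OF coker] by blast
  \<comment> \<open>The cokernel is one-dimensional, so \<open>\<phi>0\<close> alone decides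
    membership in the range of \<open>?A\<close>.\<close>
  have vanish: "\<phi> x = 0" if \<phi>: "\<phi> \<in> coker_op p ?A" and "\<phi>0 x = 0" for \<phi> x
  proof -
    have "\<phi>0 \<in> range (\<lambda>k. dual_scale k \<phi>1)" "\<phi> \<in> range (\<lambda>k. dual_scale k \<phi>1)"
      using subsetD[OF \<phi>1 \<phi>0] subsetD[OF \<phi>1 \<phi>] by (simp_all only: dvs.span_singleton)
    then obtain \<alpha> \<beta> where ab: "\<phi>0 = dual_scale \<alpha> \<phi>1" "\<phi> = dual_scale \<beta> \<phi>1"
      by (elim rangeE)
    have "\<alpha> \<noteq> 0"
    proof
      assume "\<alpha> = 0"
      hence "\<phi>0 = 0" by (simp only: ab(1) dvs.scale_zero_left)
      thus False using \<phi>00 by simp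
    qed
    thus ?thesis using that(2) by (simp add: ab dual_scale_def)
  qed
  have ch0: "c * reflect h0 = - (tpow 1 * h0)"
  proof -
    have "tpow 1 * h0 = - ((tpow 1 * tpow (- 1)) * (c * reflect h0))"
      by (subst h0(2)) (simp add: flip_eq mult_ac)
    thus ?thesis by simp
  qed
  \<comment> \<open>For \<open>x\<close> in the kernel, \<open>c * x\<close> is coanalytic.
    Multiplication by \<open>reflect h0\<close> equates a product of coanalytic functions with
    \<open>- (tpow 1 * (x * h0))\<close>, whose indices are at least 1.\<close>
  have inj: "x = 0" if x: "x \<in> Hardy p" "toeplitz p g x = 0" for x
  proof -
    have gx: "g * x \<in> Lp p" by (rule Lp_mult_Linf[OF gL p0(1) HardyD(1)[OF x(1)]])
    have cxL: "c * x \<in> Lp p" by (rule Lp_mult_Linf[OF c(1) p0(1) HardyD(1)[OF x(1)]])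
    have cx: "c * x \<in> conj_Hardy p"
      unfolding conj_Hardy_def
    proof (intro CollectI conjI allI impI cxL)
      fix n :: int assume "n > 0"
      hence "fourier (g * x) (n - 1) = 0" using x(2) riesz_eq_0_iff[OF p gx] by (simp add: toeplitz_def)
      also have "g * x = tpow (- 1) * (c * x)" unfolding g_def by (simp only: mult_ac)
      finally show "fourier (c * x) n = 0" by (simp add: fourier_tpow_mult)
    qed
    have eq: "- (tpow 1 * (x * h0)) = (c * x) * reflect h0"
    proof -
      have "(c * x) * reflect h0 = x * (c * reflect h0)" by (simp only: mult_ac)
      thus ?thesis by (simp add: ch0 mult_ac)
    qed
    have "x * h0 = 0"
    proof (rule fourier_unique_0)
      show "x * h0 \<in> Lp 1" by (rule Lp_mult_dual[OF p HardyD(1)[OF x(1)] HardyD(1)[OF h0(1)]])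
      show "fourier (x * h0) n = 0" for n
      proof (cases "n < 0")
        case True thus ?thesis by (rule fourier_Hardy_mult(1)[OF p x(1) h0(1)])
      next
        case False
        have "fourier (- (tpow 1 * (x * h0))) (n + 1) = 0"
          unfolding eq by (rule fourier_conj_Hardy_mult(1)[OF p cx reflect_Hardy[OF h0(1)]]) (use False in simp)
        thus ?thesis by (simp add: fourier_uminus fourier_tpow_mult)
      qed
    qed
    thus "x = 0" using analytic_mult_eq_0[OF Hardy_L1[OF p x(1)] HardyD(2)[OF x(1)]] \<open>h0 \<noteq> 0\<close> by blast
  qed
  have one: "1 \<in> Hardy p" using tpow_Hardy[OF p0(1), of 0] by simp
  \<comment> \<open>The image of the constant 1 supplies the missing direction: a preimage
    \<open>f\<close> of it under \<open>?A\<close> would make \<open>1 - tpow 1 * f\<close> a kernel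
    element, although its mean is 1.\<close>
  define e where "e = toeplitz p g 1"
  have e: "e \<in> Hardy p" unfolding e_def by (rule bounded_opD(1)[OF G p one one])
  have \<phi>e: "\<phi>0 e \<noteq> 0"
  proof
    assume "\<phi>0 e = 0"
    hence "\<phi> e = 0" if "\<phi> \<in> coker_op p ?A" for \<phi> using vanish[OF that] by blast
    hence "e \<in> ?A ` Hardy p" by (rule range_annihilator[OF p A cl e])
    then obtain f where f: "f \<in> Hardy p" "e = ?A f" by blast
    hence "toeplitz p g (1 - tpow 1 * f) = 0"
      by (simp add: bounded_opD(4)[OF G p one t1[OF f(1)]] gA e_def)
    hence "1 - tpow 1 * f = 0" by (rule inj[OF Hardy_diff[OF p one t1[OF f(1)]]])
    hence "fourier 1 0 = fourier (tpow 1 * f) 0" by simp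
    thus False using HardyD(2)[OF f(1)] by (simp add: fourier_1 fourier_tpow_mult)
  qed
  have \<phi>0D: "\<phi>0 \<in> Hardy_dual p" using \<phi>0 by (simp add: coker_op_def)
  have surj: "\<exists>f\<in>Hardy p. toeplitz p g f = h" if h: "h \<in> Hardy p" for h
  proof -
    let ?z = "\<phi>0 h / \<phi>0 e"
    have ze: "cscale ?z e \<in> Hardy p" by (rule Hardy_cscale[OF p e])
    have d: "h - cscale ?z e \<in> Hardy p" by (rule Hardy_diff[OF p h ze])
    have "\<phi>0 (h - cscale ?z e) + \<phi>0 (cscale ?z e) = \<phi>0 h"
      using Hardy_dualD(1)[OF \<phi>0D d ze] by simp
    hence "\<phi>0 (h - cscale ?z e) = 0" using \<phi>e by (simp add: Hardy_dualD(2)[OF \<phi>0D e])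
    hence "\<phi> (h - cscale ?z e) = 0" if "\<phi> \<in> coker_op p ?A" for \<phi> using vanish[OF that] by blast
    hence "h - cscale ?z e \<in> ?A ` Hardy p" by (rule range_annihilator[OF p A cl d])
    then obtain f where f: "f \<in> Hardy p" "h - cscale ?z e = ?A f" by blast
    have z1: "cscale ?z 1 \<in> Hardy p" by (rule Hardy_cscale[OF p one])
    have "toeplitz p g (cscale ?z 1 + tpow 1 * f) = cscale ?z e + ?A f"
      by (simp only: bounded_opD(2)[OF G p z1 t1[OF f(1)]] bounded_opD(3)[OF G p one one] gA e_def[symmetric])
    also have "\<dots> = h" by (simp add: f(2)[symmetric])
    finally show ?thesis using Hardy_add[OF p z1 t1[OF f(1)]] by blast
  qed
  obtain gm gp where "wiener_hopf p (g * tpow 1) gm 1 gp"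
    using wiener_hopf_exists[OF p gL inj surj] by blast
  moreover have gc: "g * tpow 1 = c" by (simp add: g_def mult.assoc)
  ultimately have wh: "wiener_hopf p c gm 1 gp" by simp
  note W = wiener_hopfD[OF wh]
  have "fourier gp 0 = 1" using signature_eq[OF p wh] sig by simp
  hence igp: "fourier (inverse gp) 0 = 1" using wiener_hopf_mean(2)[OF p wh] by simp
  have eq: "inverse gp * h0 = - (gm * reflect h0)"
  proof -
    have "inverse gp * h0 = inverse gp * - ((gm * tpow 1 * gp) * (tpow (- 1) * reflect h0))"
      by (subst h0(2)) (simp only: W(1)[symmetric] flip_eq)
    also have "\<dots> = - ((gp * inverse gp) * (tpow 1 * tpow (- 1)) * (gm * reflect h0))"
      by (simp add: mult_ac)
    finally show ?thesis by (simp add: W(2))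
  qed
  have m1: "fourier (inverse gp * h0) 0 = fourier h0 0"
    by (simp add: fourier_Hardy_mult(2)[OF p W(4) h0(1)] igp)
  have m2: "fourier (inverse gp * h0) 0 = - fourier h0 0"
    unfolding eq by (simp add: fourier_uminus fourier_conj_Hardy_mult(2)[OF p W(6) reflect_Hardy[OF h0(1)]]
        W(8) fourier_reflect)
  have m0: "fourier (inverse gp * h0) 0 = 0"
    unfolding m1 by (rule self_eq_minus[OF trans[OF m1[symmetric] m2]])
  \<comment> \<open>This side is analytic and the right side of \<open>eq\<close> is coanalytic, so
    only the mean remains, and it has just been shown to vanish.\<close>
  have "inverse gp * h0 = cscale (fourier (inverse gp * h0) 0) 1"
  proof (rule analytic_coanalytic)
    show "inverse gp * h0 \<in> Lp 1" by (rule Lp_mult_dual[OF p HardyD(1)[OF W(4)] HardyD(1)[OF h0(1)]])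
    show "fourier (inverse gp * h0) n = 0" if "n < 0" for n by (rule fourier_Hardy_mult(1)[OF p W(4) h0(1) that])
    show "fourier (inverse gp * h0) n = 0" if "n > 0" for n
      unfolding eq fourier_uminus by (simp add: fourier_conj_Hardy_mult(1)[OF p W(6) reflect_Hardy[OF h0(1)] that])
  qed
  hence "inverse gp * h0 = 0" unfolding m0 by simp
  hence "(gp * inverse gp) * h0 = 0" by (simp add: mult.assoc)
  thus False using \<open>h0 \<noteq> 0\<close> by (simp add: W(2))
qed

theorem corollary6p4:
  fixes p :: real and a b c d :: circ_fun
  assumes "1 < p"
    and "matching_pair a b"
    and "(c, d) = subordinated_pair a b"
    and "fredholm p (toeplitz p c)"
  shows "(fredholm_index p (toeplitz p c) = 1 \<and> signature p c = 1 \<longrightarrow>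
            ker_op p (\<lambda>f. toeplitz p a f + hankel p b f) = {0} \<or>
            coker_op p (\<lambda>f. toeplitz p a f + hankel p b f) = {0})
       \<and> (fredholm_index p (toeplitz p c) = - 1 \<and> signature p c = 1 \<longrightarrow>
            ker_op p (\<lambda>f. toeplitz p a f - hankel p b f) = {0} \<or>
            coker_op p (\<lambda>f. toeplitz p a f - hankel p b f) = {0})
       \<and> (fredholm_index p (toeplitz p c) = 0 \<longrightarrow>
            (ker_op p (\<lambda>f. toeplitz p a f + hankel p b f) = {0} \<or>
             coker_op p (\<lambda>f. toeplitz p a f + hankel p b f) = {0}) \<and>
            (ker_op p (\<lambda>f. toeplitz p a f - hankel p b f) = {0} \<or>
             coker_op p (\<lambda>f. toeplitz p a f - hankel p b f) = {0}))"
proof -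
  note p = assms(1) and F = assms(4)
  let ?q = "dual_exponent p"
  let ?A = "toeplitz p c"
  obtain a' where a: "a \<in> Linf" "a' \<in> Linf" "a * a' = 1" and b: "b \<in> Linf" and ab: "a * reflect a = b * reflect b"
    using assms(2) unfolding matching_pair_def by blast
  \<comment> \<open>An explicit inverse of \<open>b\<close>: by the matching condition,
    \<open>b * b'\<close> collapses to \<open>(a * a') * reflect (a * a')\<close>.\<close>
  define b' where "b' = reflect b * (a' * reflect a')"
  have b': "b' \<in> Linf" unfolding b'_def by (intro mult_Linf reflect_Linf a b)
  have bb: "b * b' = 1"
  proof -
    have "b * b' = (a * a') * reflect (a * a')" 
      unfolding b'_def reflect_mult mult.assoc[symmetric] ab[symmetric] by (simp only: mult_ac)
    thus ?thesis by (simp add: a(3))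
  qed
  have cb: "c = a * b'"
    using assms(3) inverse_eqI[OF bb] by (simp add: subordinated_pair_def)
  have cL: "c \<in> Linf" unfolding cb by (rule mult_Linf[OF a(1) b'])
  have ac: "a = c * b"
  proof -
    have "c * b = a * (b * b')" unfolding cb by (simp only: mult_ac)
    thus ?thesis by (simp add: bb)
  qed
  have cc: "c * (b * a') = 1"
  proof -
    have "c * (b * a') = (a * a') * (b * b')" unfolding cb by (simp only: mult_ac)
    thus ?thesis by (simp add: a(3) bb)
  qed
  interpret dvs: vector_space dual_scale by (rule vector_space_dual_scale)
  define k where "k = cvs.dim (ker_op p ?A)"
  define l where "l = dvs.dim (coker_op p ?A)"
  have index: "fredholm_index p ?A = int k - int l" by (simp add: fredholm_index_def k_def l_def)
  have k0: "k = 0 \<longleftrightarrow> ker_op p ?A \<subseteq> {0}"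
  proof
    show "ker_op p ?A \<subseteq> {0}" if "k = 0"
      using F cvs.dim_0_finite_span[of "ker_op p ?A"] that unfolding fredholm_def k_def by blast
    show "k = 0" if "ker_op p ?A \<subseteq> {0}"
      using cvs.dim_le_card[of "ker_op p ?A" "{}"] that by (simp add: k_def)
  qed
  have l0: "l = 0 \<longleftrightarrow> coker_op p ?A \<subseteq> {0}"
  proof
    show "coker_op p ?A \<subseteq> {0}" if "l = 0"
      using F dvs.dim_0_finite_span[of "coker_op p ?A"] that unfolding fredholm_def l_def by blast
    show "l = 0" if "coker_op p ?A \<subseteq> {0}"
      using dvs.dim_le_card[of "coker_op p ?A" "{}"] that by (simp add: l_def)
  qed
  \<comment> \<open>Coburn's alternative turns the index into the dimensions themselves: for index
    1, -1 and 0 the pair \<open>k\<close>, \<open>l\<close> is 1, 0 or 0, 1 or 0, 0.\<close>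
  have cob: "k = 0 \<or> l = 0" unfolding k0 l0 by (rule Coburn[OF p cL cc])
  have kerA: "f = 0" if "k = 0" "f \<in> Hardy p" "c * f = flip f \<or> c * f = - flip f" for f
  proof -
    have "f \<in> ker_op p ?A"
      using that(3) flip_kernel[OF p that(2), of c 1] flip_kernel[OF p that(2), of c "- 1"]
      by (auto simp: cscale_minus_one)
    thus ?thesis using that(1) k0 by blast
  qed
  have cokerA: "h = 0" if "l = 0" "h \<in> Hardy ?q" "h = c * flip h \<or> h = - (c * flip h)" for h
  proof -
    have "pairing p (reflect h) \<in> coker_op p ?A"
      using that(3) flip_cokernel[OF p cL that(2), of 1] flip_cokernel[OF p cL that(2), of "- 1"]
      by (auto simp: cscale_minus_one)
    hence "pairing p (reflect h) = 0" using that(1) l0 by blast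
    thus ?thesis by (rule pairing_reflect_eq_0[OF p that(2)])
  qed
  have plus: "ker_op p (\<lambda>f. toeplitz p a f + hankel p b f) = {0} \<or> coker_op p (\<lambda>f. toeplitz p a f + hankel p b f) = {0}"
    if "\<And>f. f \<in> Hardy p \<Longrightarrow> c * f = - flip f \<Longrightarrow> f = 0" "\<And>h. h \<in> Hardy ?q \<Longrightarrow> h = c * flip h \<Longrightarrow> h = 0"
    by (rule toeplitz_plus_hankel_alternative[OF p a(1) b bb ab ac that])
  have minus: "ker_op p (\<lambda>f. toeplitz p a f - hankel p b f) = {0} \<or> coker_op p (\<lambda>f. toeplitz p a f - hankel p b f) = {0}"
    if ker: "\<And>f. f \<in> Hardy p \<Longrightarrow> c * f = flip f \<Longrightarrow> f = 0"
      and coker: "\<And>h. h \<in> Hardy ?q \<Longrightarrow> h = - (c * flip h) \<Longrightarrow> h = 0"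
  proof -
    \<comment> \<open>The equality is established on \<open>Hardy p\<close>, which is all that
      \<open>ker_op\<close> and \<open>coker_op\<close> depend on.\<close>
    have neg: "hankel p (- b) f = - hankel p b f" if f: "f \<in> Hardy p" for f
    proof -
      have "b * flip f \<in> Lp p" using p by (intro Lp_mult_Linf[OF b] flip_Lp HardyD(1)[OF f]) auto
      from riesz_cscale[OF p this, of "- 1"] show ?thesis
        by (simp add: hankel_def coriesz_flip[OF p f] cscale_minus_one)
    qed
    have "ker_op p (\<lambda>f. toeplitz p a f + hankel p (- b) f) = {0} \<or> coker_op p (\<lambda>f. toeplitz p a f + hankel p (- b) f) = {0}"
    proof (rule toeplitz_plus_hankel_alternative[OF p a(1) uminus_Linf[OF b], of "- b'" "- c"])
      show "a * reflect a = - b * reflect (- b)" by (simp add: ab reflect_uminus)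
    qed (use bb ac ker coker in auto)
    moreover have "ker_op p (\<lambda>f. toeplitz p a f + hankel p (- b) f) = ker_op p (\<lambda>f. toeplitz p a f - hankel p b f)"
      by (auto simp: ker_op_def neg)
    moreover have "coker_op p (\<lambda>f. toeplitz p a f + hankel p (- b) f) = coker_op p (\<lambda>f. toeplitz p a f - hankel p b f)"
      unfolding coker_op_def adjoint_op_def by (simp add: neg cong: if_cong)
    ultimately show ?thesis by simp
  qed
  show ?thesis
  proof (intro conjI impI)
    assume "fredholm_index p ?A = 1 \<and> signature p c = 1"
    hence kl: "k = 1" "l = 0" and sig: "signature p c = 1" using cob index by auto
    show "ker_op p (\<lambda>f. toeplitz p a f + hankel p b f) = {0} \<or> coker_op p (\<lambda>f. toeplitz p a f + hankel p b f) = {0}"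
    proof (rule plus)
      show "f = 0" if "f \<in> Hardy p" "c * f = - flip f" for f
        by (rule signature_index_1[OF p cL F kl(1)[unfolded k_def] l0[THEN iffD1, OF kl(2)] that sig])
      show "h = 0" if "h \<in> Hardy ?q" "h = c * flip h" for h
        by (rule cokerA[OF kl(2) that(1)]) (rule disjI1[OF that(2)])
    qed
  next
    assume "fredholm_index p ?A = - 1 \<and> signature p c = 1"
    hence kl: "k = 0" "l = 1" and sig: "signature p c = 1" using cob index by auto
    show "ker_op p (\<lambda>f. toeplitz p a f - hankel p b f) = {0} \<or> coker_op p (\<lambda>f. toeplitz p a f - hankel p b f) = {0}"
    proof (rule minus)
      show "h = 0" if "h \<in> Hardy ?q" "h = - (c * flip h)" for h
        by (rule signature_index_minus_1[OF p cL cc F k0[THEN iffD1, OF kl(1)] kl(2)[unfolded l_def] that sig])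
      show "f = 0" if "f \<in> Hardy p" "c * f = flip f" for f
        by (rule kerA[OF kl(1) that(1)]) (rule disjI1[OF that(2)])
    qed
  next
    assume "fredholm_index p ?A = 0"
    hence kl: "k = 0" "l = 0" using cob index by auto
    show "ker_op p (\<lambda>f. toeplitz p a f + hankel p b f) = {0} \<or> coker_op p (\<lambda>f. toeplitz p a f + hankel p b f) = {0}"
      by (rule plus; rule kerA[OF kl(1)] cokerA[OF kl(2)]; simp)
    show "ker_op p (\<lambda>f. toeplitz p a f - hankel p b f) = {0} \<or> coker_op p (\<lambda>f. toeplitz p a f - hankel p b f) = {0}"
      by (rule minus; rule kerA[OF kl(1)] cokerA[OF kl(2)]; simp)
  qed
qed

end
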